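(* Let $n$ be a positive integer, let $\lambda_1,\dots,\lambda_n>0$, and let $(u_1,\dots,u_n)$, $u_i:\mathbb{R}^2\to\mathbb{C}$, be a solution of $$-\lambda_i\Delta u_i = u_i\Big(n-\sum_{j=1}^n|u_j|^2\Big)\quad\text{in }\mathbb{R}^2,\qquad i=1,\dots,n,$$ such that $$E(u_1,\dots,u_n)=\int_{\mathbb{R}^2}\Big(n-\sum_{j=1}^n|u_j|^2\Big)^2dx<\infty.$$ Suppose that there are nonnegative real numbers $\alpha_1,\dots,\alpha_n$ such that $$\alpha_1^2+\cdots+\alpha_n^2=n\quad\text{and}\quad I_{\alpha_j}(u_j)<\infty\ \text{ for every } j=1,\dots,n.$$ Then there exist nonnegative integers $d_j\in\{0,1,2,\dots\}$, $1\le j\le n$, such that $$E(u_1,\dots,u_n)=2\pi\sum_{j=1}^n\lambda_j\alpha_j^2d_j^2.$$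
   Context: A solution means a tuple of smooth functions $u_i:\mathbb{R}^2\to\mathbb{C}$ satisfying the equations pointwise. For a nonnegative real number $\alpha$ and a smooth function $u:\mathbb{R}^2\to\mathbb{C}$, $$I_\alpha(u)=\int_{\mathbb{R}^2}(\alpha^2-|u|^2)^2\,dx.$$ *)

theory Defs
  imports "HOL-Analysis.Analysis"
begin

definition dir_deriv ::
    "('a::real_normed_vector \<Rightarrow> 'b::real_normed_vector) \<Rightarrow> 'a \<Rightarrow> 'a \<Rightarrow> 'b" where
  "dir_deriv f v = (\<lambda>x. frechet_derivative f (at x) v)"

(* On a finite-dimensional domain this is the usual class of k times continuously
   differentiable functions: continuity of all directional derivatives of order k
   is continuity of the k-th derivative. *)
primrec C_diff :: "nat \<Rightarrow> ('a::euclidean_space \<Rightarrow> 'b::real_normed_vector) \<Rightarrow> bool" where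
  "C_diff 0 f \<longleftrightarrow> continuous_on UNIV f"
| "C_diff (Suc k) f \<longleftrightarrow>
     (\<forall>x. f differentiable (at x)) \<and> (\<forall>v. C_diff k (dir_deriv f v))"

definition smooth :: "('a::euclidean_space \<Rightarrow> 'b::real_normed_vector) \<Rightarrow> bool" where
  "smooth f \<longleftrightarrow> (\<forall>k. C_diff k f)"

definition laplacian ::
    "('a::euclidean_space \<Rightarrow> 'b::real_normed_vector) \<Rightarrow> 'a \<Rightarrow> 'b" where
  "laplacian f x = (\<Sum>b\<in>Basis. dir_deriv (dir_deriv f b) b x)"

(* Components carry the indices 1, ..., n; the values of lam and u outside {1..n}
   are irrelevant. *)
definition is_solution ::
    "nat \<Rightarrow> (nat \<Rightarrow> real) \<Rightarrow> (nat \<Rightarrow> real ^ 2 \<Rightarrow> complex) \<Rightarrow> bool" where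
  "is_solution n lam u \<longleftrightarrow>
     (\<forall>i\<in>{1..n}. smooth (u i)) \<and>
     (\<forall>i\<in>{1..n}. \<forall>x.
        - (complex_of_real (lam i) * laplacian (u i) x) =
          u i x * complex_of_real (real n - (\<Sum>j=1..n. (cmod (u j x))\<^sup>2)))"

(* The integrals take values in [0, \<infinity>], so that finiteness is a
   genuine condition. *)
definition energy :: "nat \<Rightarrow> (nat \<Rightarrow> real ^ 2 \<Rightarrow> complex) \<Rightarrow> ennreal" where
  "energy n u =
     (\<integral>\<^sup>+ x. ennreal ((real n - (\<Sum>j=1..n. (cmod (u j x))\<^sup>2))\<^sup>2) \<partial>lborel)"

definition I_func :: "real \<Rightarrow> (real ^ 2 \<Rightarrow> complex) \<Rightarrow> ennreal" where
  "I_func a v = (\<integral>\<^sup>+ x. ennreal ((a\<^sup>2 - (cmod (v x))\<^sup>2)\<^sup>2) \<partial>lborel)"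

end

theory Submission
  imports Defs
begin

text \<open>
  The energy is read off at infinity from a Pohozaev identity. In logarithmic polar coordinates
  around a point the plane becomes the cylinder of pairs \<open>(t, h)\<close>, where \<open>t\<close> is the logarithm of
  the radius and \<open>h\<close> the angle, and the Laplacian becomes \<open>exp (- 2 t)\<close> times the flat Laplacian
  of the cylinder. Write \<open>W = n - |u_1|^2 - ... - |u_n|^2\<close> and let the stress of \<open>u_j\<close> at \<open>t\<close>
  be the integral of \<open>|d_t u_j|^2 - |d_h u_j|^2\<close> over the circle. Half of \<open>exp (2 t)\<close> times the
  integral of \<open>W^2\<close> over the circle, minus the sum of \<open>\<lambda>_j\<close> times the stress of \<open>u_j\<close>, is a
  function \<open>Q\<close> of \<open>t\<close> whose derivative is \<open>exp (2 t)\<close> times the integral of \<open>W^2\<close> over the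
  circle (\<open>pohozaev\<close>). Since \<open>Q\<close> tends to zero as \<open>t\<close> tends to \<open>-\<infinity>\<close>, its limit at \<open>t = \<infinity>\<close> is the energy.

  For \<open>u_j\<close> close to \<open>\<alpha>_j exp (i d_j h)\<close> the stress is close to \<open>- 2 \<pi> \<alpha>_j^2 d_j^2\<close>.
  The core of the proof is that the difference of the two is integrable in \<open>t\<close> near infinity, for
  an integer \<open>d_j\<close> (\<open>stress_quantized\<close>). Then \<open>Q\<close> differs by an integrable function from the
  constant in the theorem, and it converges, so its limit is that constant.

  If \<open>\<alpha>_j = 0\<close>, then the whole Dirichlet energy of \<open>u_j\<close> is finite, and \<open>d_j = 0\<close> will do. This
  comes from the identity for the second derivative of the integral of \<open>|u_j|^2\<close> over circles
  (\<open>gradient_bound\<close>), which for any \<open>\<alpha>_j\<close> bounds the Dirichlet energy in a disc of radius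
  \<open>R\<close> by a multiple of \<open>R\<close>.

  If \<open>\<alpha>_j > 0\<close>, there are two stages. First, \<open>|u_j|\<close> tends to \<open>\<alpha>_j\<close> uniformly at infinity
  (\<open>local_modulus\<close>): in a far unit disc the deviation \<open>\<alpha>_j^2 - |u_j|^2\<close> and \<open>W\<close> are small
  in \<open>L^2\<close>, hence so is the Dirichlet energy of a smaller disc; some circle around the centre then
  carries a nearly constant \<open>u_j\<close> of modulus nearly \<open>\<alpha>_j\<close>, and the equation keeps the mean over the
  circle close to the value at the centre. Second, outside a large disc \<open>u_j\<close> has a phase. Its
  winding number is \<open>d_j\<close>, and after subtraction of \<open>d_j h\<close> a single-valued part \<open>\<psi>\<close> is left.
  The current is divergence free with zero flux, so pairing it with \<open>\<psi>\<close> controls the energy of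
  \<open>\<psi>\<close> up to \<open>t\<close> by its density at \<open>t\<close> with a factor below one. Such an energy is bounded or grows faster
  than \<open>exp t\<close>, and the linear growth in \<open>R\<close> excludes the latter (\<open>phase_energy_finite\<close>). With
  the phase under control the modulus has finite Dirichlet energy as well
  (\<open>modulus_energy_finite\<close>), and what is left of the stress is integrable (\<open>stress_limit\<close>).
\<close>

section \<open>Calculus on the cylinder\<close>

definition dt :: "(real \<Rightarrow> real \<Rightarrow> real) \<Rightarrow> real \<Rightarrow> real \<Rightarrow> real" where
  "dt f t h = deriv (\<lambda>s. f s h) t"

definition dh :: "(real \<Rightarrow> real \<Rightarrow> real) \<Rightarrow> real \<Rightarrow> real \<Rightarrow> real" where
  "dh f t h = deriv (f t) h"

text \<open>The cylinder is \<open>S \<times> \<real> / 2\<pi>\<int>\<close>; functions on it are curried functions of the time \<open>t\<close> and the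
  angle \<open>h\<close>. The set \<open>S\<close> of times is a parameter because phases exist only outside a large disc.\<close>

definition cyl_cont :: "real set \<Rightarrow> (real \<Rightarrow> real \<Rightarrow> real) \<Rightarrow> bool" where
  "cyl_cont S f \<longleftrightarrow>
     continuous_on (S \<times> UNIV) (\<lambda>x. f (fst x) (snd x)) \<and> (\<forall>t\<in>S. \<forall>h. f t (h + 2 * pi) = f t h)"

text \<open>Being \<open>k\<close> times continuously differentiable on the cylinder.\<close>

primrec cyl :: "nat \<Rightarrow> real set \<Rightarrow> (real \<Rightarrow> real \<Rightarrow> real) \<Rightarrow> bool" where
  "cyl 0 S f \<longleftrightarrow> cyl_cont S f"
| "cyl (Suc k) S f \<longleftrightarrow> cyl_cont S f \<and>
     (\<forall>t\<in>S. \<forall>h. (\<lambda>s. f s h) field_differentiable at t \<and> f t field_differentiable at h) \<and>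
     cyl k S (dt f) \<and> cyl k S (dh f)"

definition circ :: "(real \<Rightarrow> real \<Rightarrow> real) \<Rightarrow> real \<Rightarrow> real" where
  "circ f t = integral {0..2 * pi} (f t)"

lemma cyl_imp_cont: "cyl k S f \<Longrightarrow> cyl_cont S f"
  by (cases k) auto

lemma cyl_has_dt:
  "cyl (Suc k) S f \<Longrightarrow> t \<in> S \<Longrightarrow> ((\<lambda>s. f s h) has_real_derivative dt f t h) (at t)"
  by (simp add: dt_def field_differentiable_derivI)

lemma cyl_has_dh:
  "cyl (Suc k) S f \<Longrightarrow> t \<in> S \<Longrightarrow> (f t has_real_derivative dh f t h) (at h)"
  by (simp add: dh_def field_differentiable_derivI)

lemma cyl_Suc_dt: "cyl (Suc k) S f \<Longrightarrow> cyl k S (dt f)"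
  and cyl_Suc_dh: "cyl (Suc k) S f \<Longrightarrow> cyl k S (dh f)"
  by auto

lemma cyl_cont_subset: "cyl_cont S f \<Longrightarrow> T \<subseteq> S \<Longrightarrow> cyl_cont T f"
  unfolding cyl_cont_def by (meson Sigma_mono continuous_on_subset order_refl subset_iff)

lemma cyl_Suc_D: "cyl (Suc k) S f \<Longrightarrow> cyl k S f"
proof (induction k arbitrary: f)
  case (Suc k)
  have "cyl k S (dt f)" "cyl k S (dh f)"
    using Suc.IH Suc.prems cyl_Suc_dt cyl_Suc_dh by blast+
  with Suc.prems show ?case by simp
qed auto

lemma cyl_cont_cong:
  assumes "\<And>t h. t \<in> S \<Longrightarrow> f t h = g t h" "cyl_cont S f"
  shows "cyl_cont S g"
proof -
  have "continuous_on (S \<times> UNIV) (\<lambda>x. g (fst x) (snd x))"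
    using assms unfolding cyl_cont_def by (auto intro: continuous_on_eq)
  then show ?thesis using assms unfolding cyl_cont_def by auto
qed

lemma cyl_cong:
  assumes "open S" "\<And>t h. t \<in> S \<Longrightarrow> f t h = g t h" "cyl k S f"
  shows "cyl k S g"
  using assms(2,3)
proof (induction k arbitrary: f g)
  case 0
  then show ?case using cyl_cont_cong[of S f g] by auto
next
  case (Suc k)
  have ft: "((\<lambda>s. g s h) has_real_derivative dt f t h) (at t)" if "t \<in> S" for t h
    by (rule has_field_derivative_transform_within_open[OF cyl_has_dt[OF Suc.prems(2) that] assms(1) that])
       (use Suc in auto)
  have fh: "(g t has_real_derivative dh f t h) (at h)" if "t \<in> S" for t h
  proof -
    have "f t = g t" using Suc.prems(1) that by auto
    then show ?thesis using cyl_has_dh[OF Suc.prems(2) that, of h] by simp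
  qed
  have 1: "dt f t h = dt g t h" "dh f t h = dh g t h" if "t \<in> S" for t h
    using DERIV_imp_deriv[OF ft[OF that]] DERIV_imp_deriv[OF fh[OF that]] by (auto simp: dt_def dh_def)
  show ?case
  proof (unfold cyl.simps, intro conjI ballI allI)
    show "cyl_cont S g" using cyl_cont_cong[of S f g] Suc.prems by auto
    show "cyl k S (dt g)" "cyl k S (dh g)"
      using Suc.IH[of "dt f" "dt g"] Suc.IH[of "dh f" "dh g"] 1 Suc.prems by auto
      show "(\<lambda>s. g s h) field_differentiable at t" "g t field_differentiable at h" if "t \<in> S" for t h
      unfolding field_differentiable_def by (rule exI, rule ft[OF that], rule exI, rule fh[OF that])
  qed
qed

text \<open>The derivatives may be supplied as explicit functions, so that closure properties follow by
  induction on the order from the product and chain rules.\<close>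

lemma cyl_SucI:
  assumes "open S" "cyl_cont S f"
    and "\<And>t h. t \<in> S \<Longrightarrow> ((\<lambda>s. f s h) has_real_derivative f1 t h) (at t)"
    and "\<And>t h. t \<in> S \<Longrightarrow> (f t has_real_derivative f2 t h) (at h)"
    and "cyl k S f1" "cyl k S f2"
  shows "cyl (Suc k) S f"
proof -
  have "f1 t h = dt f t h" "f2 t h = dh f t h" if "t \<in> S" for t h
    using DERIV_imp_deriv[OF assms(3)[OF that]] DERIV_imp_deriv[OF assms(4)[OF that]]
    by (auto simp: dt_def dh_def)
  then have "cyl k S (dt f)" "cyl k S (dh f)"
    using cyl_cong[OF assms(1), of f1 "dt f"] cyl_cong[OF assms(1), of f2 "dh f"] assms(5,6) by auto
  then show ?thesis using assms(2) assms(3,4) unfolding cyl.simps field_differentiable_def by blast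
qed

named_theorems cyl_intros

lemma cyl_cont_fst [cyl_intros]: "continuous_on S f \<Longrightarrow> cyl_cont S (\<lambda>t h. f t)"
  unfolding cyl_cont_def by (auto intro!: continuous_intros intro: continuous_on_compose2)

lemma cyl_cont_add [cyl_intros]: "cyl_cont S f \<Longrightarrow> cyl_cont S g \<Longrightarrow> cyl_cont S (\<lambda>t h. f t h + g t h)"
  and cyl_cont_diff [cyl_intros]: "cyl_cont S f \<Longrightarrow> cyl_cont S g \<Longrightarrow> cyl_cont S (\<lambda>t h. f t h - g t h)"
  and cyl_cont_mult [cyl_intros]: "cyl_cont S f \<Longrightarrow> cyl_cont S g \<Longrightarrow> cyl_cont S (\<lambda>t h. f t h * g t h)"
  and cyl_cont_minus [cyl_intros]: "cyl_cont S f \<Longrightarrow> cyl_cont S (\<lambda>t h. - f t h)"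
  and cyl_cont_power [cyl_intros]: "cyl_cont S f \<Longrightarrow> cyl_cont S (\<lambda>t h. f t h ^ m)"
  and cyl_cont_abs [cyl_intros]: "cyl_cont S f \<Longrightarrow> cyl_cont S (\<lambda>t h. \<bar>f t h\<bar>)"
  unfolding cyl_cont_def by (auto intro!: continuous_intros)

lemma cyl_cont_divide [cyl_intros]:
  "cyl_cont S f \<Longrightarrow> cyl_cont S g \<Longrightarrow> (\<And>t h. t \<in> S \<Longrightarrow> g t h \<noteq> 0) \<Longrightarrow> cyl_cont S (\<lambda>t h. f t h / g t h)"
  unfolding cyl_cont_def by (auto intro!: continuous_intros)

lemma cyl_cont_sum [cyl_intros]:
  "(\<And>i. i \<in> A \<Longrightarrow> cyl_cont S (f i)) \<Longrightarrow> cyl_cont S (\<lambda>t h. \<Sum>i\<in>A. f i t h)"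
  unfolding cyl_cont_def by (auto intro!: continuous_intros)

lemma cyl_add:
  assumes "open S" "cyl k S f" "cyl k S g"
  shows "cyl k S (\<lambda>t h. f t h + g t h)"
  using assms(2,3)
proof (induction k arbitrary: f g)
  case 0
  then show ?case by (auto intro: cyl_intros)
next
  case (Suc k)
  show ?case
    by (rule cyl_SucI[where ?f1.0="\<lambda>t h. dt f t h + dt g t h" and ?f2.0="\<lambda>t h. dh f t h + dh g t h"])
      (use assms(1) Suc in \<open>auto intro!: cyl_intros DERIV_add intro: cyl_has_dt cyl_has_dh Suc.IH\<close>)
qed

lemma cyl_mult:
  assumes "open S" "cyl k S f" "cyl k S g"
  shows "cyl k S (\<lambda>t h. f t h * g t h)"
  using assms(2,3)
proof (induction k arbitrary: f g)
  case 0
  then show ?case by (auto intro: cyl_intros)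
next
  case (Suc k)
  note D = cyl_Suc_D[OF Suc.prems(1)] cyl_Suc_D[OF Suc.prems(2)]
  show ?case
  proof (rule cyl_SucI[where ?f1.0="\<lambda>t h. dt f t h * g t h + dt g t h * f t h"
        and ?f2.0="\<lambda>t h. dh f t h * g t h + dh g t h * f t h"])
    show "cyl k S (\<lambda>t h. dt f t h * g t h + dt g t h * f t h)"
      "cyl k S (\<lambda>t h. dh f t h * g t h + dh g t h * f t h)"
      using D Suc.prems by (auto intro!: cyl_add assms Suc.IH)
  qed (use assms(1) Suc in \<open>auto intro!: cyl_intros DERIV_mult intro: cyl_has_dt cyl_has_dh\<close>)
qed

lemma cyl_exp_cos: "cyl k UNIV (\<lambda>t h. c * exp t * cos (h + b))"
proof (induction k arbitrary: b)
  case 0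
  have "cos (h + 2 * pi + b) = cos (h + b)" for h
    using cos_periodic[of "h + b"] by (simp add: algebra_simps)
  then show ?case by (auto simp: cyl_cont_def intro!: continuous_intros)
next
  case (Suc k)
  show ?case
  proof (rule cyl_SucI[where ?f1.0="\<lambda>t h. c * exp t * cos (h + b)"
        and ?f2.0="\<lambda>t h. c * exp t * cos (h + (b + pi/2))"])
    show "cyl_cont UNIV (\<lambda>t h. c * exp t * cos (h + b))" using Suc cyl_imp_cont by blast
    show "((\<lambda>h. c * exp t * cos (h + b)) has_real_derivative c * exp t * cos (h + (b + pi / 2))) (at h)" for t h
    proof -
      have "cos (h + (b + pi / 2)) = - sin (h + b)"
        using cos_add[of "h + b" "pi/2"] by (simp add: add.assoc)
      then show ?thesis by (auto intro!: derivative_eq_intros)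
    qed
  qed (auto intro!: derivative_eq_intros Suc)
qed

lemma cyl_cont_slice: "cyl_cont S f \<Longrightarrow> t \<in> S \<Longrightarrow> continuous_on A (f t)"
proof -
  assume *: "cyl_cont S f" "t \<in> S"
  have "continuous_on A (\<lambda>h. (t, h))" by (intro continuous_intros)
  then show ?thesis
    using continuous_on_compose2[of "S \<times> UNIV" "\<lambda>x. f (fst x) (snd x)" A "\<lambda>h. (t,h)"] *
    unfolding cyl_cont_def by auto
qed

lemma cyl_cont_int: "cyl_cont S f \<Longrightarrow> t \<in> S \<Longrightarrow> f t integrable_on {a..b}"
  using cyl_cont_slice integrable_continuous_real by blast

lemma circ_continuous:
  assumes "cyl_cont S f"
  shows "continuous_on S (circ f)"
proof -
  have "continuous_on (S \<times> cbox 0 (2*pi)) (\<lambda>(t,h). f t h)"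
    using assms unfolding cyl_cont_def split_beta by (auto intro: continuous_on_subset)
  from integral_continuous_on_param[OF this] show ?thesis by (simp add: circ_def[abs_def])
qed

lemma circ_has_derivative:
  assumes "open S" "cyl_cont S f" "cyl_cont S f'" "t \<in> S"
    and "\<And>t h. t \<in> S \<Longrightarrow> ((\<lambda>s. f s h) has_real_derivative f' t h) (at t)"
  shows "(circ f has_real_derivative circ f' t) (at t)"
proof -
  obtain e where e: "e > 0" "ball t e \<subseteq> S" using assms(1,4) open_contains_ball by blast
  have "((\<lambda>x. integral (cbox 0 (2*pi)) (f x)) has_field_derivative integral (cbox 0 (2*pi)) (f' t)) (at t within ball t e)"
  proof (rule leibniz_rule_field_derivative)
    show "continuous_on (ball t e \<times> cbox 0 (2*pi)) (\<lambda>(x, t). f' x t)"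
      using assms(3) e unfolding cyl_cont_def split_beta by (auto intro: continuous_on_subset)
    show "f x integrable_on cbox 0 (2*pi)" if "x \<in> ball t e" for x
      using that e assms(2) cyl_cont_int[of S f x 0 "2*pi"] by auto
    show "((\<lambda>x. f x h) has_field_derivative f' x h) (at x within ball t e)" if "x \<in> ball t e" for x h
      by (rule has_field_derivative_at_within, rule assms(5)) (use that e in auto)
  qed (use e in auto)
  then show ?thesis
    using e at_within_open[of t "ball t e"] by (simp add: circ_def[abs_def])
qed

text \<open>Integration by parts around the circle: periodicity leaves no boundary term.\<close>

lemma circ_dh_zero:
  assumes "cyl_cont S f" "cyl_cont S f'" "t \<in> S"
    and "\<And>h. (f t has_real_derivative f' t h) (at h)"
  shows "circ f' t = 0"
proof -
  have "(f' t has_integral (f t (2*pi) - f t 0)) {0..2*pi}"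
    by (rule fundamental_theorem_of_calculus)
      (use assms(4) in \<open>auto intro: has_field_derivative_at_within simp flip: has_real_derivative_iff_has_vector_derivative\<close>)
  moreover have "f t (2*pi) = f t 0"
    using assms(1,3) unfolding cyl_cont_def by (metis add_0_left)
  ultimately show ?thesis by (auto simp: circ_def)
qed

lemma circ_add: "cyl_cont S f \<Longrightarrow> cyl_cont S g \<Longrightarrow> t \<in> S \<Longrightarrow> circ (\<lambda>t h. f t h + g t h) t = circ f t + circ g t"
  and circ_diff: "cyl_cont S f \<Longrightarrow> cyl_cont S g \<Longrightarrow> t \<in> S \<Longrightarrow> circ (\<lambda>t h. f t h - g t h) t = circ f t - circ g t"
  unfolding circ_def using cyl_cont_int[of S] by (auto intro!: Henstock_Kurzweil_Integration.integral_add Henstock_Kurzweil_Integration.integral_diff)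

lemma circ_cmult: "circ (\<lambda>t h. c t * f t h) t = c t * circ f t"
  and circ_minus: "circ (\<lambda>t h. - f t h) t = - circ f t"
  unfolding circ_def by auto

lemma circ_const: "circ (\<lambda>t h. c t) t = 2 * pi * c t"
  by (simp add: circ_def)

lemma circ_sum: "finite A \<Longrightarrow> (\<And>i. i \<in> A \<Longrightarrow> cyl_cont S (f i)) \<Longrightarrow> t \<in> S \<Longrightarrow>
    circ (\<lambda>t h. \<Sum>i\<in>A. f i t h) t = (\<Sum>i\<in>A. circ (f i) t)"
  unfolding circ_def using cyl_cont_int[of S] by (auto intro!: Henstock_Kurzweil_Integration.integral_sum)

lemma circ_mono: "cyl_cont S f \<Longrightarrow> cyl_cont S g \<Longrightarrow> t \<in> S \<Longrightarrow> (\<And>h. f t h \<le> g t h) \<Longrightarrow> circ f t \<le> circ g t"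
  unfolding circ_def using cyl_cont_int[of S] by (intro integral_le) auto

lemma circ_nonneg: "cyl_cont S f \<Longrightarrow> t \<in> S \<Longrightarrow> (\<And>h. 0 \<le> f t h) \<Longrightarrow> 0 \<le> circ f t"
  unfolding circ_def using cyl_cont_int[of S] by (intro Henstock_Kurzweil_Integration.integral_nonneg) auto

lemma circ_abs_le: "cyl_cont S f \<Longrightarrow> cyl_cont S g \<Longrightarrow> t \<in> S \<Longrightarrow> (\<And>h. \<bar>f t h\<bar> \<le> g t h) \<Longrightarrow> \<bar>circ f t\<bar> \<le> circ g t"
  unfolding circ_def using cyl_cont_int[of S] integral_norm_bound_integral[of "f t" "{0..2*pi}" "g t"] by auto

text \<open>Both mixed derivatives have the same integral over every angular interval, because the angular
  derivative may be integrated before or after differentiation in time. Continuity does the rest.\<close>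

lemma cyl_mixed_partials:
  assumes S: "open S" and f: "cyl 2 S f" and t: "t \<in> S"
  shows "dt (dh f) t h = dh (dt f) t h"
proof -
  have f': "cyl (Suc (Suc 0)) S f" using f by (simp add: numeral_2_eq_2)
  have c1: "cyl (Suc 0) S (dt f)" "cyl (Suc 0) S (dh f)" using f' by auto
  have c0: "cyl_cont S (dt (dh f))" "cyl_cont S (dh (dt f))" using f' by auto
  have eq: "integral {h..k} (dh (dt f) t) = integral {h..k} (dt (dh f) t)" if "h \<le> k" for k
  proof -
    have 1: "(dh (dt f) t has_integral (dt f t k - dt f t h)) {h..k}"
      by (rule fundamental_theorem_of_calculus)
        (use cyl_has_dh[OF c1(1) t] that in \<open>auto intro: has_field_derivative_at_within simp flip: has_real_derivative_iff_has_vector_derivative\<close>)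
    have 2: "integral {h..k} (dh f s) = f s k - f s h" if "s \<in> S" for s
      using fundamental_theorem_of_calculus[of h k "f s" "dh f s"] cyl_has_dh[OF f' that] \<open>h \<le> k\<close>
      by (auto intro!: integral_unique intro: has_field_derivative_at_within simp flip: has_real_derivative_iff_has_vector_derivative)
    obtain e where e: "e > 0" "ball t e \<subseteq> S" using S t open_contains_ball by blast
    have "((\<lambda>x. integral (cbox h k) (dh f x)) has_field_derivative integral (cbox h k) (dt (dh f) t)) (at t within ball t e)"
    proof (rule leibniz_rule_field_derivative)
      show "continuous_on (ball t e \<times> cbox h k) (\<lambda>(x, t). dt (dh f) x t)"
        using c0 e unfolding cyl_cont_def split_beta by (auto intro: continuous_on_subset)
      show "dh f x integrable_on cbox h k" if "x \<in> ball t e" for x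
        using that e cyl_imp_cont[OF c1(2)] cyl_cont_int[of S "dh f" x h k] by auto
      show "((\<lambda>x. dh f x l) has_field_derivative dt (dh f) x l) (at x within ball t e)" if "x \<in> ball t e" for x l
        by (rule has_field_derivative_at_within, rule cyl_has_dt[OF c1(2)]) (use that e in auto)
    qed (use e in auto)
    then have "((\<lambda>x. integral {h..k} (dh f x)) has_field_derivative integral {h..k} (dt (dh f) t)) (at t)"
      using e at_within_open[of t "ball t e"] by simp
    moreover have "((\<lambda>x. integral {h..k} (dh f x)) has_field_derivative dt f t k - dt f t h) (at t)"
      by (rule has_field_derivative_transform_within_open[of "\<lambda>s. f s k - f s h" _ _ S])
        (use S t 2 cyl_has_dt[OF f' t] in \<open>auto intro!: derivative_intros\<close>)
    ultimately show ?thesis using 1 DERIV_unique integral_unique by metis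
  qed
  have D: "((\<lambda>k. integral {h..k} (g t)) has_vector_derivative g t h) (at h within {h..h+1})" if "cyl_cont S g" for g
    by (rule integral_has_vector_derivative) (use that t cyl_cont_slice in auto)
  have "((\<lambda>k. integral {h..k} (dh (dt f) t)) has_vector_derivative dt (dh f) t h) (at h within {h..h+1})"
    by (rule has_vector_derivative_transform[OF _ _ D[OF c0(1)]]) (auto simp: eq)
  with D[OF c0(2)] show ?thesis
    using vector_derivative_unique_within[of h "{h..h+1}"]
      at_within_Icc_at_right[of h "h+1"] by simp
qed

section \<open>Estimates in one real variable\<close>

lemma ftc_real:
  assumes "a \<le> b" "\<And>t. t \<in> {a..b} \<Longrightarrow> (F has_real_derivative f t) (at t)"
  shows "(f has_integral (F b - F a)) {a..b}"
  by (rule fundamental_theorem_of_calculus)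
    (use assms in \<open>auto intro: has_field_derivative_at_within simp flip: has_real_derivative_iff_has_vector_derivative\<close>)

lemma cont_int: "continuous_on {T0..} f \<Longrightarrow> T0 \<le> a \<Longrightarrow> f integrable_on {a..b}" for f :: "real \<Rightarrow> real"
  by (rule integrable_continuous_real) (auto elim: continuous_on_subset)

lemma int_mono_upper:
  fixes f :: "real \<Rightarrow> real"
  assumes "continuous_on {a..} f" "\<And>t. t \<ge> a \<Longrightarrow> f t \<ge> 0" "T \<le> T'"
  shows "integral {a..T} f \<le> integral {a..T'} f"
  by (rule integral_subset_le) (use assms in \<open>auto intro: cont_int\<close>)

text \<open>Integrability on a half-line, in the form in which it is obtained and used here: bounds on
  integrals over compact intervals that are uniform in the upper end point.\<close>

definition integrable_tail :: "real \<Rightarrow> (real \<Rightarrow> real) \<Rightarrow> bool" where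
  "integrable_tail T0 f \<longleftrightarrow> continuous_on {T0..} f \<and> (\<exists>C. \<forall>T\<ge>T0. integral {T0..T} (\<lambda>t. \<bar>f t\<bar>) \<le> C)"

lemma integrable_tailI:
  "continuous_on {T0..} f \<Longrightarrow> (\<And>T. T \<ge> T0 \<Longrightarrow> integral {T0..T} (\<lambda>t. \<bar>f t\<bar>) \<le> C) \<Longrightarrow> integrable_tail T0 f"
  unfolding integrable_tail_def by blast

lemma integrable_tail_cont: "integrable_tail T0 f \<Longrightarrow> continuous_on {T0..} f"
  unfolding integrable_tail_def by blast

lemma integrable_tail_mono:
  assumes "integrable_tail T0 g" "continuous_on {T0..} f" "\<And>t. t \<ge> T0 \<Longrightarrow> \<bar>f t\<bar> \<le> \<bar>g t\<bar>"
  shows "integrable_tail T0 f"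
proof -
  obtain C where C: "\<And>T. T \<ge> T0 \<Longrightarrow> integral {T0..T} (\<lambda>t. \<bar>g t\<bar>) \<le> C" and g: "continuous_on {T0..} g"
    using assms(1) unfolding integrable_tail_def by blast
  have "integral {T0..T} (\<lambda>t. \<bar>f t\<bar>) \<le> integral {T0..T} (\<lambda>t. \<bar>g t\<bar>)" for T
    by (rule integral_le) (use assms g in \<open>auto intro!: cont_int[of T0] continuous_intros\<close>)
  with C show ?thesis by (intro integrable_tailI[of _ _ C] assms) (meson order_trans)
qed

lemma integrable_tail_add:
  assumes "integrable_tail T0 f" "integrable_tail T0 g"
  shows "integrable_tail T0 (\<lambda>t. f t + g t)"
proof -
  obtain C D where C: "\<And>T. T \<ge> T0 \<Longrightarrow> integral {T0..T} (\<lambda>t. \<bar>f t\<bar>) \<le> C"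
    and D: "\<And>T. T \<ge> T0 \<Longrightarrow> integral {T0..T} (\<lambda>t. \<bar>g t\<bar>) \<le> D"
    and c: "continuous_on {T0..} f" "continuous_on {T0..} g"
    using assms unfolding integrable_tail_def by blast
  have "integral {T0..T} (\<lambda>t. \<bar>f t + g t\<bar>) \<le> C + D" if "T \<ge> T0" for T
  proof -
    have "integral {T0..T} (\<lambda>t. \<bar>f t + g t\<bar>) \<le> integral {T0..T} (\<lambda>t. \<bar>f t\<bar> + \<bar>g t\<bar>)"
      by (rule integral_le) (use c in \<open>auto intro!: cont_int[of T0] continuous_intros\<close>)
    also have "\<dots> = integral {T0..T} (\<lambda>t. \<bar>f t\<bar>) + integral {T0..T} (\<lambda>t. \<bar>g t\<bar>)"
      by (rule Henstock_Kurzweil_Integration.integral_add) (use c in \<open>auto intro!: cont_int[of T0] continuous_intros\<close>)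
    finally show ?thesis using C[OF that] D[OF that] by linarith
  qed
  then show ?thesis by (intro integrable_tailI[of _ _ "C + D"]) (use c in \<open>auto intro!: continuous_intros\<close>)
qed

lemma integrable_tail_cmult: "integrable_tail T0 f \<Longrightarrow> integrable_tail T0 (\<lambda>t. c * f t)"
proof -
  assume f: "integrable_tail T0 f"
  then obtain C where C: "\<And>T. T \<ge> T0 \<Longrightarrow> integral {T0..T} (\<lambda>t. \<bar>f t\<bar>) \<le> C"
    unfolding integrable_tail_def by blast
  show ?thesis
    by (rule integrable_tailI[of _ _ "\<bar>c\<bar> * C"])
      (use C integrable_tail_cont[OF f] in \<open>auto intro!: continuous_intros mult_left_mono simp: abs_mult\<close>)
qed

lemma integrable_tail_exp_minus: "k > 0 \<Longrightarrow> integrable_tail T0 (\<lambda>t. exp (- (k * t)))"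
proof (rule integrable_tailI[of _ _ "exp (- (k * T0)) / k"])
  fix T assume "k > 0" "T0 \<le> T"
  have "((\<lambda>t. exp (- (k * t))) has_integral ((- exp (- (k * T)) / k) - (- exp (- (k * T0)) / k))) {T0..T}"
    by (rule ftc_real) (use \<open>k > 0\<close> \<open>T0 \<le> T\<close> in \<open>auto intro!: derivative_eq_intros\<close>)
  then have "integral {T0..T} (\<lambda>t. exp (- (k * t))) = (exp (- (k * T0)) - exp (- (k * T))) / k"
    by (auto dest!: integral_unique simp: diff_divide_distrib)
  also have "\<dots> \<le> exp (- (k * T0)) / k" using \<open>k > 0\<close> by (simp add: divide_right_mono)
  finally show "integral {T0..T} (\<lambda>t. \<bar>exp (- (k * t))\<bar>) \<le> exp (- (k * T0)) / k" by simp
qed (auto intro!: continuous_intros)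

lemma integrable_tail_later:
  assumes "integrable_tail T0 f" "T0 \<le> T1"
  shows "integrable_tail T1 f"
proof -
  obtain C where C: "\<And>T. T \<ge> T0 \<Longrightarrow> integral {T0..T} (\<lambda>t. \<bar>f t\<bar>) \<le> C"
    using assms unfolding integrable_tail_def by blast
  have c: "continuous_on {T0..} (\<lambda>t. \<bar>f t\<bar>)" using integrable_tail_cont[OF assms(1)] by (intro continuous_intros)
  have "integral {T1..T} (\<lambda>t. \<bar>f t\<bar>) \<le> C" if "T \<ge> T1" for T
  proof -
    have "integral {T1..T} (\<lambda>t. \<bar>f t\<bar>) \<le> integral {T0..T} (\<lambda>t. \<bar>f t\<bar>)"
      by (rule integral_subset_le) (use assms cont_int[OF c] in auto)
    then show ?thesis using C[of T] that assms(2) by linarith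
  qed
  then show ?thesis
    by (intro integrable_tailI[of _ _ C]) (use integrable_tail_cont[OF assms(1)] assms(2) in \<open>auto elim: continuous_on_subset\<close>)
qed

lemma integrable_tail_sum: "(\<And>i. i \<in> A \<Longrightarrow> integrable_tail T0 (f i)) \<Longrightarrow> integrable_tail T0 (\<lambda>t. \<Sum>i\<in>A. f i t)"
proof (induction A rule: infinite_finite_induct)
  case (insert x F)
  then show ?case using integrable_tail_add[of T0 "f x" "\<lambda>t. \<Sum>i\<in>F. f i t"] by auto
qed (auto intro!: integrable_tailI[of _ _ 0])

text \<open>This turns integrability of an error into the value of a limit.\<close>

lemma integrable_tail_limit_zero:
  assumes "integrable_tail T0 f" "(f \<longlongrightarrow> L) at_top"
  shows "L = 0"
proof (rule ccontr)
  assume "L \<noteq> 0"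
  then have "\<forall>\<^sub>F t in at_top. dist (f t) L < \<bar>L\<bar> / 2" using assms(2) by (intro tendstoD) auto
  then obtain T1 where T1: "\<And>t. t \<ge> T1 \<Longrightarrow> dist (f t) L < \<bar>L\<bar> / 2" by (auto simp: eventually_at_top_linorder)
  define T2 where "T2 = max T0 T1"
  obtain C where C: "\<And>T. T \<ge> T2 \<Longrightarrow> integral {T2..T} (\<lambda>t. \<bar>f t\<bar>) \<le> C"
    using integrable_tail_later[OF assms(1), of T2] unfolding integrable_tail_def T2_def by auto
  have c: "continuous_on {T2..} (\<lambda>t. \<bar>f t\<bar>)"
    using integrable_tail_cont[OF integrable_tail_later[OF assms(1), of T2]] by (auto intro!: continuous_intros simp: T2_def)
  define T where "T = T2 + 2 * (\<bar>C\<bar> + 1) / \<bar>L\<bar>"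
  have "T \<ge> T2" unfolding T_def by simp
  have "(\<bar>C\<bar> + 1) = integral {T2..T} (\<lambda>t. \<bar>L\<bar> / 2)" using \<open>L \<noteq> 0\<close> \<open>T \<ge> T2\<close> by (simp add: T_def)
  also have "\<dots> \<le> integral {T2..T} (\<lambda>t. \<bar>f t\<bar>)"
  proof (rule integral_le)
    show "\<bar>L\<bar> / 2 \<le> \<bar>f t\<bar>" if "t \<in> {T2..T}" for t
    proof -
      have "\<bar>f t - L\<bar> < \<bar>L\<bar> / 2" using T1[of t] that by (auto simp: T2_def dist_real_def)
      then show ?thesis by linarith
    qed
  qed (use cont_int[OF c] in auto)
  finally show False using C[OF \<open>T \<ge> T2\<close>] by linarith
qed

text \<open>With \<open>m\<close> the integral of \<open>|u|^2\<close> over circles and \<open>g\<close> that of \<open>|\<nabla>u|^2\<close>, this bounds the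
  Dirichlet energy without cut-off functions. Integrating the second derivative from \<open>-\<infinity>\<close> bounds
  \<open>m1\<close> from below on \<open>[T0, T0 + 2]\<close> by twice the energy minus \<open>2 A\<close>, so \<open>m\<close> grows by at least
  that amount over each unit interval in there, while its distance from \<open>\<mu>\<close> is small on average.\<close>

lemma increment_le_double_integral:
  fixes m m1 g h :: "real \<Rightarrow> real"
  assumes m: "\<And>t. (m has_real_derivative m1 t) (at t)"
    and m1: "\<And>t. (m1 has_real_derivative 2 * (g t - h t)) (at t)"
    and c: "continuous_on UNIV g" "continuous_on UNIV h" and g: "\<And>t. g t \<ge> 0"
    and lim: "(m1 \<longlongrightarrow> 0) at_bot"
    and A: "\<And>S. S \<le> T0 + 2 \<Longrightarrow> integral {S..T0+2} (\<lambda>t. \<bar>h t\<bar>) \<le> A"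
    and S: "S \<le> T0"
  shows "2 * integral {S..T0} g \<le> 2 * A + integral {T0..T0+2} (\<lambda>t. \<bar>m t - \<mu>\<bar>)"
proof -
  have ci: "f integrable_on {a..b}" if "continuous_on UNIV f" for f :: "real \<Rightarrow> real" and a b
    using that by (intro integrable_continuous_real) (auto elim: continuous_on_subset)
  have cm: "continuous_on UNIV m"
    using m by (intro DERIV_continuous_on) (auto intro: has_field_derivative_at_within)
  have ch: "continuous_on UNIV (\<lambda>t. \<bar>h t\<bar>)" using c by (intro continuous_intros)
  define L where "L = 2 * integral {S..T0} g - 2 * A"
  have L: "L \<le> m1 t" if t: "T0 \<le> t" "t \<le> T0 + 2" for t
  proof -
    have "m1 s \<le> m1 t - L" if s: "s \<le> S" for s
    proof -
      have "((\<lambda>t. 2 * (g t - h t)) has_integral (m1 t - m1 s)) {s..t}"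
        by (rule ftc_real) (use m1 s t S in auto)
      moreover have "((\<lambda>t. 2 * (g t - h t)) has_integral 2 * (integral {s..t} g - integral {s..t} h)) {s..t}"
        by (intro has_integral_mult_right has_integral_diff integrable_integral ci c)
      ultimately have "m1 t - m1 s = 2 * (integral {s..t} g - integral {s..t} h)"
        by (rule has_integral_unique)
      moreover have "integral {S..T0} g \<le> integral {s..t} g"
        by (rule integral_subset_le) (use s t S g ci[OF c(1)] in auto)
      moreover have "integral {s..t} h \<le> A"
      proof -
      have "integral {s..t} h \<le> integral {s..t} (\<lambda>t. \<bar>h t\<bar>)"
        by (rule integral_le) (use ci c(2) ch in auto)
      also have "\<dots> \<le> integral {s..T0+2} (\<lambda>t. \<bar>h t\<bar>)"
        by (rule integral_subset_le) (use s t S ci[OF ch] in auto)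
      also have "\<dots> \<le> A" using A[of s] s S by auto
      finally show ?thesis .
      qed
      ultimately show ?thesis unfolding L_def by (simp add: algebra_simps)
    qed
    then have "\<forall>\<^sub>F s in at_bot. m1 s \<le> m1 t - L" unfolding eventually_at_bot_linorder by blast
    from tendsto_upperbound[OF lim this] show ?thesis by simp
  qed
  have mv: "L \<le> m (t + 1) - m t" if "t \<in> {T0..T0+1}" for t
  proof -
    have 1: "(m1 has_integral (m (t+1) - m t)) {t..t+1}" by (rule ftc_real) (use m in auto)
    have "((\<lambda>x. L) has_integral L) {t..t+1}" using has_integral_const_real[of L t "t+1"] by simp
    from has_integral_le[OF this 1] show ?thesis using that L by auto
  qed
  have cm1: "continuous_on UNIV (\<lambda>t. m (t + 1))"
    by (rule continuous_on_compose2[OF cm]) (auto intro!: continuous_intros)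
  have cmu: "continuous_on UNIV (\<lambda>t. \<bar>m t - \<mu>\<bar>)" "continuous_on UNIV (\<lambda>t. \<bar>m (t + 1) - \<mu>\<bar>)"
    using cm cm1 by (auto intro!: continuous_intros)
  have "L = integral {T0..T0+1} (\<lambda>t. L)" by simp
  also have "\<dots> \<le> integral {T0..T0+1} (\<lambda>t. \<bar>m (t + 1) - \<mu>\<bar> + \<bar>m t - \<mu>\<bar>)"
  proof (rule integral_le)
    show "(\<lambda>t. \<bar>m (t + 1) - \<mu>\<bar> + \<bar>m t - \<mu>\<bar>) integrable_on {T0..T0+1}"
      using cmu by (intro ci continuous_on_add)
    show "L \<le> \<bar>m (t + 1) - \<mu>\<bar> + \<bar>m t - \<mu>\<bar>" if "t \<in> {T0..T0+1}" for t
      using mv[OF that] by linarith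
  qed auto
  also have "\<dots> = integral {T0..T0+1} (\<lambda>t. \<bar>m (t + 1) - \<mu>\<bar>) + integral {T0..T0+1} (\<lambda>t. \<bar>m t - \<mu>\<bar>)"
    using cmu by (intro Henstock_Kurzweil_Integration.integral_add ci)
  also have "integral {T0..T0+1} (\<lambda>t. \<bar>m (t + 1) - \<mu>\<bar>) = integral {T0+1..T0+2} (\<lambda>t. \<bar>m t - \<mu>\<bar>)"
    using integral_shift_real_ivl[of "T0+1" 1 "T0+2" "\<lambda>t. \<bar>m t - \<mu>\<bar>"] by (simp add: add.commute)
  also have "integral {T0+1..T0+2} (\<lambda>t. \<bar>m t - \<mu>\<bar>) + integral {T0..T0+1} (\<lambda>t. \<bar>m t - \<mu>\<bar>)
      = integral {T0..T0+2} (\<lambda>t. \<bar>m t - \<mu>\<bar>)"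
    using Henstock_Kurzweil_Integration.integral_combine[of T0 "T0+1" "T0+2" "\<lambda>t. \<bar>m t - \<mu>\<bar>"] ci[OF cmu(1)] by simp
  finally show ?thesis unfolding L_def by linarith
qed

text \<open>If the integral of \<open>G\<close> were unbounded, \<open>y\<close> would eventually have slope at least one, and
  then it would not be integrable.\<close>

lemma convex_integrable_imp_bounded:
  fixes y y1 y2 G k :: "real \<Rightarrow> real"
  assumes y: "\<And>t. t \<ge> T0 \<Longrightarrow> (y has_real_derivative y1 t) (at t)"
    and y1: "\<And>t. t \<ge> T0 \<Longrightarrow> (y1 has_real_derivative y2 t) (at t)"
    and y2: "\<And>t. t \<ge> T0 \<Longrightarrow> G t - k t \<le> y2 t"
    and c: "continuous_on {T0..} G" and G: "\<And>t. t \<ge> T0 \<Longrightarrow> G t \<ge> 0"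
    and k: "integrable_tail T0 k" and yb: "integrable_tail T0 y" and y0: "\<And>t. t \<ge> T0 \<Longrightarrow> y t \<ge> 0"
  shows "integrable_tail T0 G"
proof -
  obtain C where C: "\<And>T. T \<ge> T0 \<Longrightarrow> integral {T0..T} (\<lambda>t. \<bar>k t\<bar>) \<le> C"
    using k unfolding integrable_tail_def by blast
  obtain D where D: "\<And>T. T \<ge> T0 \<Longrightarrow> integral {T0..T} (\<lambda>t. \<bar>y t\<bar>) \<le> D"
    using yb unfolding integrable_tail_def by blast
  have low: "y1 T \<ge> y1 T0 + integral {T0..T} G - C" if T: "T \<ge> T0" for T
  proof -
    have 1: "(y2 has_integral (y1 T - y1 T0)) {T0..T}" by (rule ftc_real) (use y1 T in auto)
    have "((\<lambda>t. G t - k t) has_integral (integral {T0..T} G - integral {T0..T} k)) {T0..T}"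
      by (intro has_integral_diff integrable_integral cont_int[of T0] c integrable_tail_cont[OF k]) auto
    from has_integral_le[OF this 1] have "integral {T0..T} G - integral {T0..T} k \<le> y1 T - y1 T0"
      using y2 by auto
    moreover have "integral {T0..T} k \<le> integral {T0..T} (\<lambda>t. \<bar>k t\<bar>)"
      by (rule integral_le) (use integrable_tail_cont[OF k] in \<open>auto intro!: cont_int[of T0] continuous_intros\<close>)
    ultimately show ?thesis using C[OF T] by linarith
  qed
  have "integral {T0..T} G \<le> 1 + C - y1 T0" if T: "T \<ge> T0" for T
  proof (rule ccontr)
    assume n: "\<not> ?thesis"
    have ge1: "y1 t \<ge> 1" if "t \<ge> T" for t
      using low[of t] int_mono_upper[OF c G, of T t] n that T by linarith
    have lin: "y t \<ge> t - T" if "t \<ge> T" for t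
    proof -
      have 1: "(y1 has_integral (y t - y T)) {T..t}" by (rule ftc_real) (use y T that in auto)
      have "((\<lambda>x. 1) has_integral (t - T)) {T..t}" using has_integral_const_real[of "1::real" T t] that by simp
      from has_integral_le[OF this 1] have "t - T \<le> y t - y T" using ge1 by auto
      then show ?thesis using y0[OF T] by linarith
    qed
    \<comment> \<open>Far enough to the right for \<open>(X - T)^2 / 2\<close> to exceed \<open>D\<close>.\<close>
    define X where "X = T + 2 * (\<bar>D\<bar> + 1)"
    have "T \<le> X" unfolding X_def by simp
    have 1: "((\<lambda>t. t - T) has_integral ((X - T)^2/2 - (T - T)^2/2)) {T..X}"
      by (rule ftc_real) (use \<open>T \<le> X\<close> in \<open>auto intro!: derivative_eq_intros\<close>)
    have iy: "(\<lambda>t. \<bar>y t\<bar>) integrable_on {a..X}" if "T0 \<le> a" for a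
      using integrable_tail_cont[OF yb] that by (intro cont_int[of T0] continuous_intros)
    have "t - T \<le> \<bar>y t\<bar>" if "t \<in> {T..X}" for t using lin[of t] that by auto
    then have "(X - T)^2 / 2 \<le> integral {T..X} (\<lambda>t. \<bar>y t\<bar>)"
      using has_integral_le[OF 1 integrable_integral[OF iy[OF T]]] by simp
    also have "\<dots> \<le> integral {T0..X} (\<lambda>t. \<bar>y t\<bar>)"
      by (rule integral_subset_le) (use T iy in auto)
    also have "\<dots> \<le> D" using D[of X] T \<open>T \<le> X\<close> by auto
    finally have "(X - T)^2 / 2 \<le> D" .
    moreover have "(X - T)^2 / 2 = 2 * (\<bar>D\<bar> + 1)^2" by (simp add: X_def power2_eq_square field_simps)
    ultimately have "2 * (\<bar>D\<bar> + 1)^2 \<le> D" by simp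
    moreover have "(\<bar>D\<bar> + 1)^2 \<ge> \<bar>D\<bar> + 1" by (rule self_le_power) auto
    ultimately show False by linarith
  qed
  moreover have "integral {T0..T} (\<lambda>t. \<bar>G t\<bar>) = integral {T0..T} G" for T
    using G by (intro integral_cong) auto
  ultimately show ?thesis by (intro integrable_tailI[of _ _ "1 + C - y1 T0"] c) auto
qed

text \<open>With \<open>y\<close> the integral of \<open>f\<close> minus \<open>C\<close>, the differential inequality \<open>y \<le> K y'\<close> makes
  \<open>y exp (- t / K)\<close> nondecreasing. A positive value of \<open>y\<close> would thus force growth of order
  \<open>exp (t / K)\<close>, which is faster than \<open>exp t\<close>.\<close>

lemma slow_growth_imp_bounded:
  fixes f :: "real \<Rightarrow> real"
  assumes c: "continuous_on {T0..} f" and f: "\<And>t. t \<ge> T0 \<Longrightarrow> f t \<ge> 0"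
    and K: "0 < K" "K < 1"
    and diff: "\<And>T. T \<ge> T0 \<Longrightarrow> integral {T0..T} f \<le> C + K * f T"
    and slow: "\<And>T. T \<ge> T0 \<Longrightarrow> integral {T0..T} f \<le> D * exp T"
  shows "integrable_tail T0 f"
proof -
  have "integral {T0..T} f \<le> C" if T: "T \<ge> T0" for T
  proof (rule ccontr)
    assume n: "\<not> ?thesis"
    define y where "y t = integral {T0..t} f - C" for t
    define T1 where "T1 = T + 1"
    have yp: "y T1 > 0" using n int_mono_upper[OF c f, of T T1] by (auto simp: y_def T1_def)
    have "T1 > T0" using T by (simp add: T1_def)
    have dy: "(y has_real_derivative f t) (at t)" if "t \<ge> T1" for t
    proof -
      have "((\<lambda>t. integral {T0..t} f) has_real_derivative f t) (at t within {T0..t+1})"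
        by (rule integral_has_real_derivative)
          (use c that \<open>T1 > T0\<close> in \<open>auto elim: continuous_on_subset\<close>)
      then have "((\<lambda>t. integral {T0..t} f) has_real_derivative f t) (at t)"
        using that \<open>T1 > T0\<close> at_within_interior[of t "{T0..t+1}"] by (simp add: interior_atLeastAtMost_real)
      then show ?thesis unfolding y_def by (auto intro!: derivative_eq_intros)
    qed
    define z where "z t = y t * exp (- t / K)" for t
    have zmono: "z T1 \<le> z t" if "t \<ge> T1" for t
    proof (rule DERIV_nonneg_imp_nondecreasing[OF that])
      fix x assume x: "T1 \<le> x" "x \<le> t"
      have "(z has_real_derivative (f x - y x / K) * exp (- x / K)) (at x)"
        unfolding z_def using dy[OF x(1)] K by (auto intro!: derivative_eq_intros simp: field_simps)
      moreover have "f x - y x / K \<ge> 0"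
        using diff[of x] x \<open>T1 > T0\<close> K by (auto simp: y_def field_simps)
      ultimately show "\<exists>y. (z has_real_derivative y) (at x) \<and> 0 \<le> y" by auto
    qed
    have zT: "z T1 > 0" using yp unfolding z_def by simp
    define \<kappa> where "\<kappa> = 1 / K - 1"
    have kp: "\<kappa> > 0" using K by (simp add: \<kappa>_def)
    have up: "z t \<le> D * exp (- \<kappa> * t) + \<bar>C\<bar> * exp (- (1/K) * t)" if "t \<ge> T1" for t
    proof -
      have "y t \<le> D * exp t + \<bar>C\<bar>" using slow[of t] that \<open>T1 > T0\<close> by (auto simp: y_def)
      then have "z t \<le> (D * exp t + \<bar>C\<bar>) * exp (- t / K)" unfolding z_def by (intro mult_right_mono) auto
      also have "\<dots> = D * exp (- \<kappa> * t) + \<bar>C\<bar> * exp (- (1/K) * t)"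
        by (simp add: \<kappa>_def algebra_simps flip: exp_add)
      finally show ?thesis .
    qed
    have e0: "((\<lambda>t. exp (- a * t)) \<longlongrightarrow> 0) at_top" if "a > 0" for a :: real
    proof -
      have "filterlim (\<lambda>t. - a * t) at_bot at_top"
        using filterlim_tendsto_pos_mult_at_top[OF tendsto_const[of a] that filterlim_ident]
        by (simp add: filterlim_uminus_at_bot)
      then show ?thesis by (rule filterlim_compose[OF exp_at_bot])
    qed
    have "((\<lambda>t. D * exp (- \<kappa> * t) + \<bar>C\<bar> * exp (- (1/K) * t)) \<longlongrightarrow> D * 0 + \<bar>C\<bar> * 0) at_top"
      using kp K by (intro tendsto_intros e0) auto
    moreover have "\<forall>\<^sub>F t in at_top. z T1 \<le> D * exp (- \<kappa> * t) + \<bar>C\<bar> * exp (- (1/K) * t)"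
      unfolding eventually_at_top_linorder using up zmono order_trans by blast
    ultimately have "z T1 \<le> D * 0 + \<bar>C\<bar> * 0" by (rule tendsto_lowerbound) auto
    with zT show False by simp
  qed
  moreover have "integral {T0..T} (\<lambda>t. \<bar>f t\<bar>) = integral {T0..T} f" for T
    using f by (intro integral_cong) auto
  ultimately show ?thesis by (intro integrable_tailI[of _ _ C] c) auto
qed

text \<open>A substitute for Wirtinger's inequality. Any two points of a circle are joined by two arcs,
  which together cover the circle, so the oscillation is at most half the integral of \<open>|\<psi>'|\<close>;
  taking the midpoint of the range as \<open>\<mu>\<close> halves it again. The constant \<open>1/4\<close> is needed:
  it is what makes the factor in \<open>phase_pairing_bound\<close> smaller than one.\<close>

lemma periodic_midrange:
  fixes \<psi> b :: "real \<Rightarrow> real"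
  assumes "a \<le> c" and d: "\<And>x. x \<in> {a..c} \<Longrightarrow> (\<psi> has_real_derivative b x) (at x)"
    and cb: "continuous_on {a..c} b" and per: "\<psi> a = \<psi> c"
  shows "\<exists>\<mu>. \<forall>x\<in>{a..c}. \<bar>\<psi> x - \<mu>\<bar> \<le> integral {a..c} (\<lambda>x. \<bar>b x\<bar>) / 4"
proof -
  have c\<psi>: "continuous_on {a..c} \<psi>"
    using d by (intro DERIV_continuous_on) (auto intro: has_field_derivative_at_within)
  have ib: "(\<lambda>x. \<bar>b x\<bar>) integrable_on {x..y}" if "{x..y} \<subseteq> {a..c}" for x y
    using that cb by (intro integrable_continuous_real continuous_intros) (auto elim: continuous_on_subset)
  define J where "J x y = integral {x..y} (\<lambda>x. \<bar>b x\<bar>)" for x y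
  have bd: "\<bar>\<psi> y - \<psi> x\<bar> \<le> J x y" if "a \<le> x" "x \<le> y" "y \<le> c" for x y
  proof -
    have h: "(b has_integral (\<psi> y - \<psi> x)) {x..y}" by (rule ftc_real) (use that d in auto)
    have "norm (integral {x..y} b) \<le> integral {x..y} (\<lambda>x. \<bar>b x\<bar>)"
      by (rule integral_norm_bound_integral) (use h ib[of x y] that in auto)
    then show ?thesis using integral_unique[OF h] by (simp add: J_def)
  qed
  have osc: "2 * \<bar>\<psi> y - \<psi> x\<bar> \<le> J a c" if "a \<le> x" "x \<le> y" "y \<le> c" for x y
  proof -
    have "J a x + J x y = J a y" "J a y + J y c = J a c" unfolding J_def
      using that ib by (auto intro!: Henstock_Kurzweil_Integration.integral_combine)
    moreover have "\<bar>\<psi> x - \<psi> a\<bar> \<le> J a x" "\<bar>\<psi> y - \<psi> x\<bar> \<le> J x y" "\<bar>\<psi> c - \<psi> y\<bar> \<le> J y c"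
      using bd[of a x] bd[of x y] bd[of y c] that by auto
    moreover have "\<bar>\<psi> y - \<psi> x\<bar> \<le> \<bar>\<psi> x - \<psi> a\<bar> + \<bar>\<psi> c - \<psi> y\<bar>"
      using per by linarith
    ultimately have "2 * \<bar>\<psi> y - \<psi> x\<bar> \<le> J a x + J x y + J y c" by (simp add: algebra_simps)
    also have "\<dots> = J a c" using \<open>J a x + J x y = J a y\<close> \<open>J a y + J y c = J a c\<close> by simp
    finally show ?thesis .
  qed
  obtain p where p: "p \<in> {a..c}" "\<And>x. x \<in> {a..c} \<Longrightarrow> \<psi> x \<le> \<psi> p"
    using continuous_attains_sup[OF _ _ c\<psi>] assms(1) by auto
  obtain q where q: "q \<in> {a..c}" "\<And>x. x \<in> {a..c} \<Longrightarrow> \<psi> q \<le> \<psi> x"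
    using continuous_attains_inf[OF _ _ c\<psi>] assms(1) by auto
  have pq: "2 * (\<psi> p - \<psi> q) \<le> J a c"
  proof -
    have "2 * \<bar>\<psi> p - \<psi> q\<bar> \<le> J a c"
      using osc[of p q] osc[of q p] p(1) q(1) abs_minus_commute[of "\<psi> p" "\<psi> q"] by (cases "p \<le> q") auto
    moreover have "\<psi> p - \<psi> q \<le> \<bar>\<psi> p - \<psi> q\<bar>" by (rule abs_ge_self)
    ultimately show ?thesis by argo
  qed
  show ?thesis
  proof (intro exI[of _ "(\<psi> p + \<psi> q) / 2"] ballI)
    fix x assume "x \<in> {a..c}"
    with p(2)[of x] q(2)[of x] have "\<bar>\<psi> x - (\<psi> p + \<psi> q) / 2\<bar> \<le> (\<psi> p - \<psi> q) / 2"
      using \<open>x \<in> {a..c}\<close> unfolding abs_le_iff by argo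
    also have "\<dots> \<le> integral {a..c} (\<lambda>x. \<bar>b x\<bar>) / 4" using pq unfolding J_def by simp
    finally show "\<bar>\<psi> x - (\<psi> p + \<psi> q) / 2\<bar> \<le> integral {a..c} (\<lambda>x. \<bar>b x\<bar>) / 4" .
  qed
qed

lemma integral_square_le:
  fixes f :: "real \<Rightarrow> real"
  assumes "a < b" "continuous_on {a..b} f"
  shows "(integral {a..b} f)^2 \<le> (b - a) * integral {a..b} (\<lambda>x. (f x)^2)"
proof -
  define I where "I = integral {a..b} f"
  define k where "k = I / (b - a)"
  have i: "f integrable_on {a..b}" "(\<lambda>x. (f x)^2) integrable_on {a..b}"
    using assms by (auto intro!: integrable_continuous_real continuous_intros)
  have "0 \<le> integral {a..b} (\<lambda>x. (f x - k)^2)"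
    by (rule Henstock_Kurzweil_Integration.integral_nonneg) (use assms in \<open>auto intro!: integrable_continuous_real continuous_intros\<close>)
  also have "(\<lambda>x. (f x - k)^2) = (\<lambda>x. (f x)^2 - 2 * k * f x + k^2)"
    by (auto simp: power2_eq_square algebra_simps)
  also have "integral {a..b} (\<lambda>x. (f x)^2 - 2 * k * f x + k^2)
      = integral {a..b} (\<lambda>x. (f x)^2) - 2 * k * I + (b - a) * k^2"
  proof (rule integral_unique)
    have "((\<lambda>x. k^2) has_integral (b - a) * k^2) {a..b}"
      using has_integral_const_real[of "k^2" a b] assms(1) by simp
    then show "((\<lambda>x. (f x)^2 - 2 * k * f x + k^2) has_integral
        integral {a..b} (\<lambda>x. (f x)^2) - 2 * k * I + (b - a) * k^2) {a..b}"
      unfolding I_def by (intro has_integral_add has_integral_diff has_integral_mult_right integrable_integral i)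
  qed
  also have "\<dots> = integral {a..b} (\<lambda>x. (f x)^2) - I^2 / (b - a)"
  proof -
    have "I = k * (b - a)" using assms(1) by (simp add: k_def)
    then have "I^2 / (b - a) = k * I" "(b - a) * k^2 = k * I"
      using assms(1) by (simp_all add: power2_eq_square)
    then show ?thesis by simp
  qed
  finally show ?thesis using assms(1) unfolding I_def by (simp add: field_simps)
qed

text \<open>With \<open>f = p + i q\<close>, the product of \<open>f\<close> and \<open>exp (- \<integral> f'/f)\<close> is constant, so the integral of
  \<open>f'/f\<close> over a period is a multiple of \<open>2 \<pi> i\<close>. The integrand below is its imaginary part.\<close>

lemma winding_integral_integer:
  fixes p q p' q' :: "real \<Rightarrow> real"
  assumes "a \<le> b"
    and p: "\<And>x. x \<in> {a..b} \<Longrightarrow> (p has_real_derivative p' x) (at x)"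
    and q: "\<And>x. x \<in> {a..b} \<Longrightarrow> (q has_real_derivative q' x) (at x)"
    and c: "continuous_on {a..b} p'" "continuous_on {a..b} q'"
    and nz: "\<And>x. x \<in> {a..b} \<Longrightarrow> (p x)^2 + (q x)^2 \<noteq> 0"
    and per: "p a = p b" "q a = q b"
  shows "\<exists>d::int. integral {a..b} (\<lambda>x. (p x * q' x - q x * p' x) / ((p x)^2 + (q x)^2)) = 2 * pi * d"
proof -
  have cp: "continuous_on {a..b} p" "continuous_on {a..b} q"
    by (rule DERIV_continuous_on, rule has_field_derivative_at_within, erule p,
        rule DERIV_continuous_on, rule has_field_derivative_at_within, erule q)
  define f where "f x = Complex (p x) (q x)" for x
  define f' where "f' x = Complex (p' x) (q' x)" for x
  define L where "L x = f' x / f x" for x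
  have f0: "f x \<noteq> 0" if "x \<in> {a..b}" for x
    using nz[OF that] by (auto simp: f_def complex_eq_iff)
  have cL: "continuous_on {a..b} L"
    unfolding L_def f_def f'_def Complex_eq using f0 cp c
    by (auto intro!: continuous_intros simp: f_def Complex_eq)
  define I where "I x = integral {a..x} L" for x
  have dI: "(I has_vector_derivative L x) (at x within {a..b})" if "x \<in> {a..b}" for x
    unfolding I_def by (rule integral_has_vector_derivative[OF cL that])
  have df: "(f has_vector_derivative f' x) (at x within {a..b})" if "x \<in> {a..b}" for x
    unfolding f_def f'_def Complex_eq
    using has_field_derivative_at_within[OF p[OF that]] has_field_derivative_at_within[OF q[OF that]]
    by (intro has_vector_derivative_add has_vector_derivative_mult_right has_vector_derivative_of_real)
  have dE: "((\<lambda>x. exp (- I x)) has_vector_derivative - L x * exp (- I x)) (at x within {a..b})" if "x \<in> {a..b}" for x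
  proof -
    have "((exp \<circ> (\<lambda>x. - I x)) has_vector_derivative (- L x) * exp (- I x)) (at x within {a..b})"
      by (rule field_vector_diff_chain_within) (use dI[OF that] in \<open>auto intro!: derivative_intros DERIV_subset[OF DERIV_exp] has_vector_derivative_minus\<close>)
    then show ?thesis by (simp add: o_def)
  qed
  have "\<exists>k. \<forall>x\<in>{a..b}. f x * exp (- I x) = k"
  proof (rule has_vector_derivative_zero_constant)
    fix x assume x: "x \<in> {a..b}"
    have "((\<lambda>x. f x * exp (- I x)) has_vector_derivative f x * (- L x * exp (- I x)) + f' x * exp (- I x)) (at x within {a..b})"
      by (rule has_vector_derivative_mult[OF df[OF x] dE[OF x]])
    moreover have "f x * (- L x * exp (- I x)) + f' x * exp (- I x) = 0"
      using f0[OF x] by (simp add: L_def field_simps)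
    ultimately show "((\<lambda>x. f x * exp (- I x)) has_vector_derivative 0) (at x within {a..b})" by simp
  qed auto
  then have "f a * exp (- I a) = f b * exp (- I b)" using assms(1) by fastforce
  moreover have "f a = f b" using per by (simp add: f_def)
  moreover have "I a = 0" by (simp add: I_def)
  ultimately have "exp (I b) = 1"
    using f0[of b] assms(1) by (simp add: exp_minus field_simps)
  then obtain d :: int where d: "Im (I b) = of_int (2 * d) * pi" using exp_eq_1 by blast
  have "Im (I b) = integral {a..b} (\<lambda>x. Im (L x))"
    unfolding I_def using integral_linear[OF integrable_continuous_real[OF cL] bounded_linear_Im] by (simp add: o_def)
  also have "(\<lambda>x. Im (L x)) = (\<lambda>x. (p x * q' x - q x * p' x) / ((p x)^2 + (q x)^2))"
    by (auto simp: L_def f_def f'_def Im_divide algebra_simps)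
  finally show ?thesis using d by (intro exI[of _ d]) (simp add: mult_ac)
qed

lemma abs_le_amgm: "k > 0 \<Longrightarrow> \<bar>x\<bar> \<le> 1 / (2 * k) + k / 2 * x^2" for x :: real
proof -
  assume k: "k > 0"
  have "0 \<le> (1 - k * \<bar>x\<bar>)^2 / (2 * k)" using k by simp
  also have "\<dots> = 1 / (2 * k) + k / 2 * x^2 - \<bar>x\<bar>"
    using k by (simp add: power2_eq_square field_simps)
  finally show ?thesis by simp
qed

lemma abs_mult_amgm: "k > 0 \<Longrightarrow> \<bar>x * y\<bar> \<le> k / 2 * x^2 + 1 / (2 * k) * y^2" for x y :: real
proof -
  assume k: "k > 0"
  have "0 \<le> (k * \<bar>x\<bar> - \<bar>y\<bar>)^2 / (2 * k)" using k by simp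
  also have "\<dots> = k / 2 * x^2 + 1 / (2 * k) * y^2 - \<bar>x * y\<bar>"
    using k by (simp add: power2_eq_square field_simps abs_mult)
  finally show ?thesis by simp
qed

section \<open>One component of the system in logarithmic polar coordinates\<close>

lemma circ_cong: "(\<And>h. f t h = g t h) \<Longrightarrow> circ f t = circ g t"
  unfolding circ_def by presburger

lemma cyl_cont_const [cyl_intros]: "cyl_cont S (\<lambda>t h. c)"
  by (rule cyl_cont_fst) simp

lemma cyl_cont_exp [cyl_intros]: "cyl_cont S (\<lambda>t h. exp (c * t))"
  by (rule cyl_cont_fst) (intro continuous_intros)

lemma circ_affine:
  assumes "cyl_cont S f" "cyl_cont S g" "t \<in> S"
  shows "circ (\<lambda>t h. a t + b t * f t h + c t * g t h) t = 2 * pi * a t + b t * circ f t + c t * circ g t"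
proof -
  have "(f t has_integral circ f t) {0..2*pi}" "(g t has_integral circ g t) {0..2*pi}"
    unfolding circ_def using cyl_cont_int assms by blast+
  moreover have "((\<lambda>h. a t) has_integral 2 * pi * a t) {0..2*pi}"
    using has_integral_const_real[of "a t" 0 "2*pi"] by simp
  ultimately show ?thesis
    unfolding circ_def[of "\<lambda>t h. a t + b t * f t h + c t * g t h"]
    by (intro integral_unique has_integral_add has_integral_mult_right)
qed

text \<open>One component \<open>u = p + i q\<close> of a solution around an arbitrary centre; the other components
  enter only through \<open>W\<close>. The bounds for \<open>t \<le> 0\<close> reflect smoothness at the centre.\<close>

locale component =
  fixes p q W :: "real \<Rightarrow> real \<Rightarrow> real" and lam \<alpha> :: real
  assumes lam: "lam > 0"
    and p2: "cyl 2 UNIV p" and q2: "cyl 2 UNIV q" and W0: "cyl_cont UNIV W"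
    and eqp: "\<And>t h. dt (dt p) t h + dh (dh p) t h = - (exp (2 * t) * p t h * W t h / lam)"
    and eqq: "\<And>t h. dt (dt q) t h + dh (dh q) t h = - (exp (2 * t) * q t h * W t h / lam)"
    and bnd: "\<exists>C. \<forall>t\<le>0. \<forall>h. \<bar>p t h\<bar> \<le> C \<and> \<bar>q t h\<bar> \<le> C \<and>
        \<bar>dt p t h\<bar> \<le> C * exp t \<and> \<bar>dt q t h\<bar> \<le> C * exp t \<and>
        \<bar>dh p t h\<bar> \<le> C * exp t \<and> \<bar>dh q t h\<bar> \<le> C * exp t"
begin

text \<open>The functions \<open>cur_t\<close> and \<open>cur_h\<close> are the components of the current \<open>Im (cnj u \<nabla>u)\<close>.\<close>

definition "modsq = (\<lambda>t h. (p t h)^2 + (q t h)^2)"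
definition "w = (\<lambda>t h. \<alpha>^2 - modsq t h)"
definition "grad2 = (\<lambda>t h. (dt p t h)^2 + (dh p t h)^2 + (dt q t h)^2 + (dh q t h)^2)"
definition "cur_t = (\<lambda>t h. p t h * dt q t h - q t h * dt p t h)"
definition "cur_h = (\<lambda>t h. p t h * dh q t h - q t h * dh p t h)"

lemma p2': "cyl (Suc (Suc 0)) UNIV p" and q2': "cyl (Suc (Suc 0)) UNIV q"
  using p2 q2 by (simp_all add: numeral_2_eq_2)

lemma conts [cyl_intros]:
  "cyl_cont UNIV p" "cyl_cont UNIV q" "cyl_cont UNIV W"
  "cyl_cont UNIV (dt p)" "cyl_cont UNIV (dh p)" "cyl_cont UNIV (dt q)" "cyl_cont UNIV (dh q)"
  "cyl_cont UNIV (dt (dt p))" "cyl_cont UNIV (dh (dt p))" "cyl_cont UNIV (dh (dh p))"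
  "cyl_cont UNIV (dt (dt q))" "cyl_cont UNIV (dh (dt q))" "cyl_cont UNIV (dh (dh q))"
  using p2' q2' W0 by auto

lemma conts2 [cyl_intros]: "cyl_cont UNIV modsq" "cyl_cont UNIV w" "cyl_cont UNIV grad2" "cyl_cont UNIV cur_t" "cyl_cont UNIV cur_h"
  unfolding w_def modsq_def grad2_def cur_t_def cur_h_def by (intro cyl_intros)+

lemma derivs:
  "((\<lambda>s. p s h) has_real_derivative dt p t h) (at t)"
  "((\<lambda>s. q s h) has_real_derivative dt q t h) (at t)"
  "((\<lambda>s. dt p s h) has_real_derivative dt (dt p) t h) (at t)"
  "((\<lambda>s. dt q s h) has_real_derivative dt (dt q) t h) (at t)"
  "((\<lambda>s. dh p s h) has_real_derivative dh (dt p) t h) (at t)"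
  "((\<lambda>s. dh q s h) has_real_derivative dh (dt q) t h) (at t)"
  "(p t has_real_derivative dh p t h) (at h)"
  "(q t has_real_derivative dh q t h) (at h)"
  "(dt p t has_real_derivative dh (dt p) t h) (at h)"
  "(dt q t has_real_derivative dh (dt q) t h) (at h)"
  "(dh p t has_real_derivative dh (dh p) t h) (at h)"
  "(dh q t has_real_derivative dh (dh q) t h) (at h)"
  using cyl_has_dt[OF p2'] cyl_has_dt[OF q2'] cyl_has_dh[OF p2'] cyl_has_dh[OF q2']
    cyl_has_dt[OF cyl_Suc_dt[OF p2']] cyl_has_dt[OF cyl_Suc_dt[OF q2']]
    cyl_has_dt[OF cyl_Suc_dh[OF p2']] cyl_has_dt[OF cyl_Suc_dh[OF q2']]
    cyl_has_dh[OF cyl_Suc_dt[OF p2']] cyl_has_dh[OF cyl_Suc_dt[OF q2']]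
    cyl_has_dh[OF cyl_Suc_dh[OF p2']] cyl_has_dh[OF cyl_Suc_dh[OF q2']]
    cyl_mixed_partials[OF open_UNIV p2] cyl_mixed_partials[OF open_UNIV q2]
  by auto

lemma circ_intros:
  "cyl_cont UNIV f \<Longrightarrow> cyl_cont UNIV f' \<Longrightarrow> (\<And>t h. ((\<lambda>s. f s h) has_real_derivative f' t h) (at t)) \<Longrightarrow>
     (circ f has_real_derivative circ f' t) (at t)"
  by (rule circ_has_derivative[OF open_UNIV]) auto

lemma circ_cont: "cyl_cont UNIV f \<Longrightarrow> continuous_on A (circ f)"
  using circ_continuous continuous_on_subset by blast

lemma circ_cont' [continuous_intros]:
  "cyl_cont UNIV f \<Longrightarrow> continuous_on A g \<Longrightarrow> continuous_on A (\<lambda>x. circ f (g x))"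
  using circ_cont continuous_on_compose2[of UNIV "circ f" A g] by auto

definition "stress = circ (\<lambda>t h. (dt p t h)^2 + (dt q t h)^2 - (dh p t h)^2 - (dh q t h)^2)"

definition "source = (\<lambda>t. exp (2 * t) / lam * circ (\<lambda>t h. modsq t h * W t h) t)"
definition "mass_rate = (\<lambda>t. 2 * circ (\<lambda>t h. p t h * dt p t h + q t h * dt q t h) t)"

lemma mass_deriv: "(circ modsq has_real_derivative mass_rate t) (at t)"
proof -
  have "(circ modsq has_real_derivative circ (\<lambda>t h. 2 * (p t h * dt p t h + q t h * dt q t h)) t) (at t)"
    by (rule circ_intros; (intro cyl_intros)?)
      (unfold modsq_def, auto intro!: derivative_eq_intros derivs simp: algebra_simps)
  then show ?thesis by (simp only: mass_rate_def circ_cmult[of "\<lambda>_. 2"])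
qed

text \<open>The identity \<open>\<Delta>|u|^2 = 2 |\<nabla>u|^2 + 2 Re (cnj u \<Delta>u)\<close>, integrated over circles.\<close>

lemma mass_deriv2: "(mass_rate has_real_derivative 2 * (circ grad2 t - source t)) (at t)"
proof -
  let ?A = "\<lambda>t h. (dt p t h)^2 + p t h * dt (dt p) t h + (dt q t h)^2 + q t h * dt (dt q) t h"
  let ?B = "\<lambda>t h. (dh p t h)^2 + p t h * dh (dh p) t h + (dh q t h)^2 + q t h * dh (dh q) t h"
  have "(circ (\<lambda>t h. p t h * dt p t h + q t h * dt q t h) has_real_derivative circ ?A t) (at t)"
    by (rule circ_intros; (intro cyl_intros)?)
      (auto intro!: derivative_eq_intros derivs simp: algebra_simps power2_eq_square)
  moreover have "circ ?B t = 0"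
    by (rule circ_dh_zero[of UNIV "\<lambda>t h. p t h * dh p t h + q t h * dh q t h"]; (intro cyl_intros)?)
      (auto intro!: derivative_eq_intros derivs simp: algebra_simps power2_eq_square)
  moreover have "circ (\<lambda>t h. ?A t h + ?B t h) t = circ ?A t + circ ?B t"
    by (rule circ_add[of UNIV]; (intro cyl_intros)?) auto
  moreover have "circ (\<lambda>t h. ?A t h + ?B t h) t = circ (\<lambda>t h. grad2 t h - exp (2 * t) / lam * (modsq t h * W t h)) t"
  proof (rule circ_cong)
    fix h
    have "?A t h + ?B t h = grad2 t h + p t h * (dt (dt p) t h + dh (dh p) t h) + q t h * (dt (dt q) t h + dh (dh q) t h)"
      unfolding grad2_def by algebra
    also have "\<dots> = grad2 t h - exp (2 * t) / lam * (modsq t h * W t h)"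
      unfolding eqp eqq modsq_def using lam by (simp add: field_simps power2_eq_square)
    finally show "?A t h + ?B t h = grad2 t h - exp (2 * t) / lam * (modsq t h * W t h)" .
  qed
  moreover have "circ (\<lambda>t h. grad2 t h - exp (2 * t) / lam * (modsq t h * W t h)) t = circ grad2 t - source t"
    unfolding source_def using circ_cmult[of "\<lambda>t. exp (2 * t) / lam"]
    by (subst circ_diff[of UNIV], intro cyl_intros, intro cyl_intros cyl_cont_fst continuous_intros) (use lam in auto)
  ultimately show ?thesis unfolding mass_rate_def by (auto intro!: derivative_eq_intros)
qed

lemma small_at_bot:
  assumes "cyl_cont UNIV f" "\<And>t h. t \<le> 0 \<Longrightarrow> \<bar>f t h\<bar> \<le> C * exp t"
  shows "(circ f \<longlongrightarrow> 0) at_bot"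
proof (rule Lim_null_comparison)
  have "\<bar>circ f t\<bar> \<le> 2 * pi * (C * exp t)" if "t \<le> 0" for t
  proof -
    have "\<bar>circ f t\<bar> \<le> circ (\<lambda>t h. C * exp t) t"
      by (rule circ_abs_le[of UNIV]) (use assms that in \<open>auto intro!: cyl_cont_fst continuous_intros\<close>)
    then show ?thesis by (simp only: circ_const)
  qed
  then show "\<forall>\<^sub>F t in at_bot. norm (circ f t) \<le> 2 * pi * (C * exp t)"
    unfolding eventually_at_bot_linorder by auto
  have "((\<lambda>t. 2 * pi * (C * exp t)) \<longlongrightarrow> 2 * pi * (C * 0)) at_bot"
    by (intro tendsto_intros exp_at_bot)
  then show "((\<lambda>t. 2 * pi * (C * exp t)) \<longlongrightarrow> 0) at_bot" by simp
qed

lemma products_small_at_bot: "(mass_rate \<longlongrightarrow> 0) at_bot" "(circ cur_t \<longlongrightarrow> 0) at_bot"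
  "(circ (dt p) \<longlongrightarrow> 0) at_bot" "(circ (dt q) \<longlongrightarrow> 0) at_bot"
proof -
  obtain C where C: "\<And>t h. t \<le> 0 \<Longrightarrow> \<bar>p t h\<bar> \<le> C" "\<And>t h. t \<le> 0 \<Longrightarrow> \<bar>q t h\<bar> \<le> C"
    "\<And>t h. t \<le> 0 \<Longrightarrow> \<bar>dt p t h\<bar> \<le> C * exp t" "\<And>t h. t \<le> 0 \<Longrightarrow> \<bar>dt q t h\<bar> \<le> C * exp t"
    using bnd by blast
  have C0: "C \<ge> 0" using C(1)[of 0 0] by simp
  have pr: "\<bar>p t h * dt p t h\<bar> \<le> C * (C * exp t)" "\<bar>q t h * dt q t h\<bar> \<le> C * (C * exp t)"
    "\<bar>p t h * dt q t h\<bar> \<le> C * (C * exp t)" "\<bar>q t h * dt p t h\<bar> \<le> C * (C * exp t)" if "t \<le> 0" for t h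
    using C(1-4)[OF that, of h] C0 by (auto simp: abs_mult intro!: mult_mono)
  have "(circ (\<lambda>t h. p t h * dt p t h + q t h * dt q t h) \<longlongrightarrow> 0) at_bot"
  proof (rule small_at_bot[of _ "2 * C * C"])
    show "\<bar>p t h * dt p t h + q t h * dt q t h\<bar> \<le> 2 * C * C * exp t" if "t \<le> 0" for t h
      using pr(1,2)[OF that, of h] by linarith
  qed (intro cyl_intros)
  from tendsto_mult[OF tendsto_const[of 2] this] show "(mass_rate \<longlongrightarrow> 0) at_bot" by (simp add: mass_rate_def)
  show "(circ cur_t \<longlongrightarrow> 0) at_bot"
  proof (rule small_at_bot[of _ "2 * C * C"])
    show "\<bar>cur_t t h\<bar> \<le> 2 * C * C * exp t" if "t \<le> 0" for t h
      using pr(3,4)[OF that, of h] unfolding cur_t_def by linarith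
  qed (intro cyl_intros)
  show "(circ (dt p) \<longlongrightarrow> 0) at_bot" "(circ (dt q) \<longlongrightarrow> 0) at_bot"
    using C(3,4) by (auto intro!: small_at_bot cyl_intros)
qed

lemma stress_small_at_bot: "(stress \<longlongrightarrow> 0) at_bot"
proof -
  obtain C where C: "\<And>t h. t \<le> 0 \<Longrightarrow> \<bar>dt p t h\<bar> \<le> C * exp t" "\<And>t h. t \<le> 0 \<Longrightarrow> \<bar>dt q t h\<bar> \<le> C * exp t"
    "\<And>t h. t \<le> 0 \<Longrightarrow> \<bar>dh p t h\<bar> \<le> C * exp t" "\<And>t h. t \<le> 0 \<Longrightarrow> \<bar>dh q t h\<bar> \<le> C * exp t"
    using bnd by blast
  show ?thesis unfolding stress_def
  proof (rule small_at_bot[of _ "4 * C^2"])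
    fix t h :: real assume t: "t \<le> 0"
    have sq: "x^2 \<le> C^2 * exp t" if "\<bar>x\<bar> \<le> C * exp t" for x
    proof -
      have "x^2 \<le> (C * exp t)^2" using that by (rule abs_le_square_iff[THEN iffD1, OF order_trans[OF _ abs_ge_self]])
      also have "\<dots> = C^2 * (exp t * exp t)" by (simp add: power2_eq_square)
      also have "\<dots> \<le> C^2 * (exp t * 1)" using t by (intro mult_left_mono) auto
      finally show ?thesis by simp
    qed
    show "\<bar>(dt p t h)^2 + (dt q t h)^2 - (dh p t h)^2 - (dh q t h)^2\<bar> \<le> 4 * C^2 * exp t"
      using C[OF t, of h, THEN sq] zero_le_power2[of "dt p t h"] zero_le_power2[of "dt q t h"]
        zero_le_power2[of "dh p t h"] zero_le_power2[of "dh q t h"]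
      by (intro abs_leI) linarith+
  qed (intro cyl_intros)
qed

text \<open>The energy-momentum tensor is divergence free up to the potential term: integrating the mixed
  term by parts around the circle leaves \<open>2 Re (\<Delta>u cnj (d_t u))\<close>.\<close>

lemma stress_deriv: "(stress has_real_derivative - (2 / lam * exp (2 * t) * circ (\<lambda>t h. W t h * (p t h * dt p t h + q t h * dt q t h)) t)) (at t)"
proof -
  let ?A = "\<lambda>t h. 2 * (dt p t h * dt (dt p) t h + dt q t h * dt (dt q) t h - dh p t h * dh (dt p) t h - dh q t h * dh (dt q) t h)"
  let ?B = "\<lambda>t h. 2 * (dh (dt p) t h * dh p t h + dt p t h * dh (dh p) t h + dh (dt q) t h * dh q t h + dt q t h * dh (dh q) t h)"
  have "(stress has_real_derivative circ ?A t) (at t)" unfolding stress_def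
    by (rule circ_intros; (intro cyl_intros)?) (auto intro!: derivative_eq_intros derivs simp: algebra_simps power2_eq_square)
  moreover have "circ ?B t = 0"
    by (rule circ_dh_zero[of UNIV "\<lambda>t h. 2 * (dt p t h * dh p t h + dt q t h * dh q t h)"]; (intro cyl_intros)?)
      (auto intro!: derivative_eq_intros derivs simp: algebra_simps power2_eq_square)
  moreover have "circ (\<lambda>t h. ?A t h + ?B t h) t = circ ?A t + circ ?B t"
    by (rule circ_add[of UNIV]; (intro cyl_intros)?) auto
  moreover have "circ (\<lambda>t h. ?A t h + ?B t h) t = circ (\<lambda>t h. - (2 / lam * exp (2 * t)) * (W t h * (p t h * dt p t h + q t h * dt q t h))) t"
  proof (rule circ_cong)
    fix h
    have "?A t h + ?B t h = 2 * (dt p t h * (dt (dt p) t h + dh (dh p) t h) + dt q t h * (dt (dt q) t h + dh (dh q) t h))"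
      by algebra
    also have "\<dots> = - (2 / lam * exp (2 * t)) * (W t h * (p t h * dt p t h + q t h * dt q t h))"
      unfolding eqp eqq using lam by (simp add: field_simps)
    finally show "?A t h + ?B t h = \<dots>" .
  qed
  moreover have "circ (\<lambda>t h. - (2 / lam * exp (2 * t)) * (W t h * (p t h * dt p t h + q t h * dt q t h))) t
      = - (2 / lam * exp (2 * t)) * circ (\<lambda>t h. W t h * (p t h * dt p t h + q t h * dt q t h)) t"
    by (rule circ_cmult)
  ultimately have "circ ?A t = - (2 / lam * exp (2 * t)) * circ (\<lambda>t h. W t h * (p t h * dt p t h + q t h * dt q t h)) t"
    by simp
  with \<open>(stress has_real_derivative circ ?A t) (at t)\<close> show ?thesis by (simp only: mult_minus_left)
qed

lemma cur_t_deriv: "((\<lambda>s. cur_t s h) has_real_derivative p t h * dt (dt q) t h - q t h * dt (dt p) t h) (at t)"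
  unfolding cur_t_def by (auto intro!: derivative_eq_intros derivs simp: algebra_simps)

lemma cur_h_deriv: "(cur_h t has_real_derivative p t h * dh (dh q) t h - q t h * dh (dh p) t h) (at h)"
  unfolding cur_h_def by (auto intro!: derivative_eq_intros derivs simp: algebra_simps)

text \<open>The current is divergence free because \<open>W\<close> and \<open>lam\<close> are real.\<close>

lemma current_conserved:
  "p t h * dt (dt q) t h - q t h * dt (dt p) t h = - (p t h * dh (dh q) t h - q t h * dh (dh p) t h)"
proof -
  have "p t h * (dt (dt q) t h + dh (dh q) t h) = q t h * (dt (dt p) t h + dh (dh p) t h)"
    unfolding eqp eqq using lam by (simp add: field_simps)
  then show ?thesis by (simp add: algebra_simps)
qed

text \<open>The flux through circles is constant by conservation, and it vanishes at the centre.\<close>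

lemma flux_zero: "circ cur_t t = 0"
proof -
  have d: "(circ cur_t has_real_derivative 0) (at t)" for t
  proof -
    have "(circ cur_t has_real_derivative circ (\<lambda>t h. p t h * dt (dt q) t h - q t h * dt (dt p) t h) t) (at t)"
      by (rule circ_intros; (intro cyl_intros)?) (auto intro: cur_t_deriv)
    also have "circ (\<lambda>t h. p t h * dt (dt q) t h - q t h * dt (dt p) t h) t
       = circ (\<lambda>t h. - (p t h * dh (dh q) t h - q t h * dh (dh p) t h)) t"
      by (rule circ_cong) (rule current_conserved)
    also have "\<dots> = - circ (\<lambda>t h. p t h * dh (dh q) t h - q t h * dh (dh p) t h) t" by (rule circ_minus)
    also have "circ (\<lambda>t h. p t h * dh (dh q) t h - q t h * dh (dh p) t h) t = 0"
      by (rule circ_dh_zero[of UNIV cur_h]; (intro cyl_intros)?) (auto intro: cur_h_deriv)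
    finally show ?thesis by simp
  qed
  have "circ cur_t s = circ cur_t t" for s t
    by (rule DERIV_isconst_all) (use d in auto)
  then have "circ cur_t = (\<lambda>s. circ cur_t t)" by blast
  with products_small_at_bot(2) have "((\<lambda>s::real. circ cur_t t) \<longlongrightarrow> 0) at_bot" by simp
  then show ?thesis by (simp add: tendsto_const_iff)
qed

lemma modsq_nonneg: "modsq t h \<ge> 0" unfolding modsq_def by simp

text \<open>Here \<open>|u|^2 |W| \<le> \<alpha>^2 |W| + |w| |W|\<close>, which the \<open>L^2\<close> norms of \<open>w\<close> and \<open>W\<close>
  control. The free parameter \<open>\<eta>\<close> plays the part of the
  Cauchy-Schwarz inequality: for large radii it is \<open>exp T\<close>, for small discs far away it is \<open>1 / \<delta>\<close>.\<close>

lemma source_bound: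
  assumes "\<eta> > 0"
  shows "\<bar>source t\<bar> \<le> 1 / lam * (\<alpha>^2 * pi / \<eta> * exp (2 * t)
     + (\<alpha>^2 * \<eta> + 1) / 2 * (exp (2 * t) * circ (\<lambda>t h. (W t h)^2) t) + 1 / 2 * (exp (2 * t) * circ (\<lambda>t h. (w t h)^2) t))"
proof -
  let ?F = "\<lambda>t h. \<alpha>^2 / (2 * \<eta>) + (\<alpha>^2 * \<eta> + 1) / 2 * (W t h)^2 + 1 / 2 * (w t h)^2"
  have pt: "\<bar>modsq t h * W t h\<bar> \<le> ?F t h" for h
  proof -
    have r: "modsq t h \<le> \<alpha>^2 + \<bar>w t h\<bar>" unfolding w_def by linarith
    have "\<bar>modsq t h * W t h\<bar> = modsq t h * \<bar>W t h\<bar>" using modsq_nonneg by (simp add: abs_mult)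
    also have "\<dots> \<le> (\<alpha>^2 + \<bar>w t h\<bar>) * \<bar>W t h\<bar>" using r by (intro mult_right_mono) auto
    also have "\<dots> = \<alpha>^2 * \<bar>W t h\<bar> + \<bar>w t h\<bar> * \<bar>W t h\<bar>" by algebra
    also have "\<dots> \<le> \<alpha>^2 * (1 / (2 * \<eta>) + \<eta> / 2 * (W t h)^2) + ((w t h)^2 + (W t h)^2) / 2"
    proof (intro add_mono mult_left_mono)
      show "\<bar>W t h\<bar> \<le> 1 / (2 * \<eta>) + \<eta> / 2 * (W t h)^2" by (rule abs_le_amgm[OF assms])
      show "\<bar>w t h\<bar> * \<bar>W t h\<bar> \<le> ((w t h)^2 + (W t h)^2) / 2"
        using abs_mult_amgm[of 1 "w t h" "W t h"] by (simp add: abs_mult)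
    qed auto
    also have "\<dots> = ?F t h" by (simp add: field_simps)
    finally show ?thesis .
  qed
  have "\<bar>circ (\<lambda>t h. modsq t h * W t h) t\<bar> \<le> circ ?F t"
    by (rule circ_abs_le[of UNIV]; (intro cyl_intros)?) (use pt in auto)
  also have "\<dots> = \<alpha>^2 * pi / \<eta> + (\<alpha>^2 * \<eta> + 1) / 2 * circ (\<lambda>t h. (W t h)^2) t + 1 / 2 * circ (\<lambda>t h. (w t h)^2) t"
    by (subst circ_affine[of UNIV _ _ t "\<lambda>_. \<alpha>^2 / (2 * \<eta>)" "\<lambda>_. (\<alpha>^2 * \<eta> + 1) / 2" "\<lambda>_. 1/2"], intro cyl_intros, intro cyl_intros) auto
  finally have c: "\<bar>circ (\<lambda>t h. modsq t h * W t h) t\<bar> \<le> \<dots>" .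
  have "\<bar>source t\<bar> = exp (2 * t) / lam * \<bar>circ (\<lambda>t h. modsq t h * W t h) t\<bar>"
    unfolding source_def using lam by (simp add: abs_mult)
  also have "\<dots> \<le> exp (2 * t) / lam * (\<alpha>^2 * pi / \<eta> + (\<alpha>^2 * \<eta> + 1) / 2 * circ (\<lambda>t h. (W t h)^2) t + 1 / 2 * circ (\<lambda>t h. (w t h)^2) t)"
    using c lam by (intro mult_left_mono) auto
  finally show ?thesis by (simp add: algebra_simps)
qed

lemma w_circ_bound:
  assumes "\<kappa> > 0"
  shows "circ (\<lambda>t h. \<bar>w t h\<bar>) t \<le> pi / \<kappa> * exp (- 2 * t) + \<kappa> / 2 * (exp (2 * t) * circ (\<lambda>t h. (w t h)^2) t)"
proof -
  define \<sigma> where "\<sigma> = \<kappa> * exp (2 * t)"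
  have s: "\<sigma> > 0" using assms by (simp add: \<sigma>_def)
  let ?F = "\<lambda>t h. 1 / (2 * \<sigma>) + \<sigma> / 2 * (w t h)^2"
  have "\<bar>w t h\<bar> \<le> ?F t h" for h by (rule abs_le_amgm[OF s])
  then have "circ (\<lambda>t h. \<bar>w t h\<bar>) t \<le> circ ?F t" by (intro circ_mono[of UNIV] cyl_intros) auto
  also have "\<dots> = pi / \<sigma> + \<sigma> / 2 * circ (\<lambda>t h. (w t h)^2) t"
    using circ_cmult[of "\<lambda>_. \<sigma> / 2" "\<lambda>t h. (w t h)^2" t] circ_const[of "\<lambda>_. 1 / (2 * \<sigma>)" t]
    by (subst circ_add[of UNIV], intro cyl_intros, intro cyl_intros) auto
  also have "\<dots> = pi / \<kappa> * exp (- 2 * t) + \<kappa> / 2 * (exp (2 * t) * circ (\<lambda>t h. (w t h)^2) t)"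
    using assms by (simp add: \<sigma>_def exp_minus field_simps)
  finally show ?thesis .
qed

lemma mass_defect: "circ modsq t - 2 * pi * \<alpha>^2 = - circ w t"
proof -
  have "circ w t = 2 * pi * \<alpha>^2 - circ modsq t"
    unfolding w_def using circ_const[of "\<lambda>_. \<alpha>^2" t] by (subst circ_diff[of UNIV], intro cyl_intros, intro cyl_intros) auto
  then show ?thesis by simp
qed

lemma mass_defect_le: "\<bar>circ modsq t - 2 * pi * \<alpha>^2\<bar> \<le> circ (\<lambda>t h. \<bar>w t h\<bar>) t"
  unfolding mass_defect using circ_abs_le[of UNIV w "\<lambda>t h. \<bar>w t h\<bar>" t] by (auto intro!: cyl_intros)

text \<open>The density in \<open>t\<close> of the integral of \<open>f^2\<close> with respect to area.\<close>

abbreviation "dens f \<equiv> (\<lambda>t. exp (2 * t) * circ (\<lambda>t h. (f t h)^2) t)"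

lemma dens_cont: "cyl_cont UNIV f \<Longrightarrow> continuous_on A (dens f)"
  by (intro continuous_intros cyl_intros)

lemma dens_nonneg: "cyl_cont UNIV f \<Longrightarrow> 0 \<le> dens f t"
  by (intro mult_nonneg_nonneg circ_nonneg[of UNIV] cyl_intros) auto

lemma cint: "continuous_on UNIV f \<Longrightarrow> f integrable_on {a..b}" for f :: "real \<Rightarrow> real"
  by (rule integrable_continuous_real) (auto elim: continuous_on_subset)

lemma exp2_integral: "S \<le> T \<Longrightarrow> ((\<lambda>t. exp (2 * t)) has_integral (exp (2 * T) / 2 - exp (2 * S) / 2)) {S..T}" for S T :: real
  by (rule ftc_real) (auto intro!: derivative_eq_intros)

text \<open>The Dirichlet energy up to time \<open>T0\<close> is bounded by \<open>w\<close> and \<open>W\<close> in \<open>L^2\<close> up to time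
  \<open>T0 + 2\<close>. This one inequality serves three purposes: linear growth in the radius, finiteness for
  \<open>\<alpha> = 0\<close>, and smallness in small discs far away.\<close>

lemma gradient_bound:
  assumes Ew: "\<And>S T. S \<le> T \<Longrightarrow> T \<le> T0 + 2 \<Longrightarrow> integral {S..T} (dens w) \<le> Ew"
    and EW: "\<And>S. S \<le> T0 + 2 \<Longrightarrow> integral {S..T0 + 2} (dens W) \<le> EW"
    and pos: "\<eta> > 0" "\<kappa> > 0" and S: "S \<le> T0"
  shows "2 * integral {S..T0} (circ grad2) \<le> 2 / lam * (\<alpha>^2 * pi / (2 * \<eta>) * exp (2 * (T0 + 2)) + (\<alpha>^2 * \<eta> + 1) / 2 * EW + Ew / 2)
     + (2 * pi / \<kappa> * exp (- 2 * T0) + \<kappa> / 2 * Ew)" (is "_ \<le> 2 / lam * ?A + ?B")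
proof -
  have "2 * integral {S..T0} (circ grad2) \<le> 2 * (?A / lam) + integral {T0..T0+2} (\<lambda>t. \<bar>circ modsq t - 2 * pi * \<alpha>^2\<bar>)"
  proof (rule increment_le_double_integral[OF mass_deriv mass_deriv2 _ _ _ products_small_at_bot(1) _ S])
    show "continuous_on UNIV (circ grad2)" by (intro circ_cont cyl_intros)
    show ch: "continuous_on UNIV source" unfolding source_def using lam by (intro continuous_intros cyl_intros) auto
    show "circ grad2 t \<ge> 0" for t by (rule circ_nonneg[of UNIV], intro cyl_intros) (auto simp: grad2_def)
    fix S assume S: "S \<le> T0 + 2"
    let ?T = "T0 + 2"
    let ?F = "\<lambda>t. 1 / lam * (\<alpha>^2 * pi / \<eta> * exp (2 * t) + (\<alpha>^2 * \<eta> + 1) / 2 * dens W t + 1 / 2 * dens w t)"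
    have "((\<lambda>t. \<alpha>^2 * pi / \<eta> * exp (2 * t) + (\<alpha>^2 * \<eta> + 1) / 2 * dens W t + 1 / 2 * dens w t) has_integral
      (\<alpha>^2 * pi / \<eta> * (exp (2 * ?T) / 2 - exp (2 * S) / 2) + (\<alpha>^2 * \<eta> + 1) / 2 * integral {S..?T} (dens W) + 1 / 2 * integral {S..?T} (dens w))) {S..?T}"
      by (intro has_integral_add has_integral_mult_right exp2_integral[OF S] integrable_integral cint dens_cont cyl_intros)
    from has_integral_mult_right[OF this, of "1 / lam"] have F: "(?F has_integral 1 / lam * (\<alpha>^2 * pi / \<eta> * (exp (2 * ?T) / 2 - exp (2 * S) / 2)
       + (\<alpha>^2 * \<eta> + 1) / 2 * integral {S..?T} (dens W) + 1 / 2 * integral {S..?T} (dens w))) {S..?T}" .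
    have "integral {S..?T} (\<lambda>t. \<bar>source t\<bar>) \<le> integral {S..?T} ?F"
    proof (rule integral_le)
      show "(\<lambda>t. \<bar>source t\<bar>) integrable_on {S..?T}" by (rule cint) (rule continuous_on_rabs[OF ch])
      show "?F integrable_on {S..?T}" using F by blast
      show "\<bar>source t\<bar> \<le> ?F t" for t by (rule source_bound[OF pos(1)])
    qed
    also have "\<dots> = 1 / lam * (\<alpha>^2 * pi / \<eta> * (exp (2 * ?T) / 2 - exp (2 * S) / 2)
       + (\<alpha>^2 * \<eta> + 1) / 2 * integral {S..?T} (dens W) + 1 / 2 * integral {S..?T} (dens w))"
      by (rule integral_unique[OF F])
    also have "\<dots> \<le> 1 / lam * (\<alpha>^2 * pi / \<eta> * (exp (2 * ?T) / 2) + (\<alpha>^2 * \<eta> + 1) / 2 * EW + 1 / 2 * Ew)"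
      using lam pos Ew[OF S] EW[OF S] by (intro mult_left_mono add_mono) auto
    finally show "integral {S..?T} (\<lambda>t. \<bar>source t\<bar>) \<le> ?A / lam" by (simp add: field_simps)
  qed
  moreover have "integral {T0..T0+2} (\<lambda>t. \<bar>circ modsq t - 2 * pi * \<alpha>^2\<bar>) \<le> ?B"
  proof -
    let ?F = "\<lambda>t. pi / \<kappa> * exp (- 2 * T0) + \<kappa> / 2 * dens w t"
    have F: "(?F has_integral (T0 + 2 - T0) * (pi / \<kappa> * exp (- 2 * T0)) + \<kappa> / 2 * integral {T0..T0+2} (dens w)) {T0..T0+2}"
      using has_integral_const_real[of "pi / \<kappa> * exp (- 2 * T0)" T0 "T0 + 2"]
      by (intro has_integral_add has_integral_mult_right integrable_integral cint dens_cont cyl_intros) simp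
    have "integral {T0..T0+2} (\<lambda>t. \<bar>circ modsq t - 2 * pi * \<alpha>^2\<bar>) \<le> integral {T0..T0+2} ?F"
    proof (rule integral_le)
      show "\<bar>circ modsq t - 2 * pi * \<alpha>^2\<bar> \<le> ?F t" if "t \<in> {T0..T0+2}" for t
      proof -
        have "pi / \<kappa> * exp (- 2 * t) \<le> pi / \<kappa> * exp (- 2 * T0)" using pos that by (intro mult_left_mono) auto
        with mass_defect_le[of t] w_circ_bound[OF pos(2), of t] show ?thesis by linarith
      qed
    qed (use F in \<open>auto intro!: cint continuous_intros cyl_intros\<close>)
    also have "\<dots> = (T0 + 2 - T0) * (pi / \<kappa> * exp (- 2 * T0)) + \<kappa> / 2 * integral {T0..T0+2} (dens w)"
      by (rule integral_unique[OF F])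
    also have "\<dots> \<le> (T0 + 2 - T0) * (pi / \<kappa> * exp (- 2 * T0)) + \<kappa> / 2 * Ew"
      using Ew[of T0 "T0 + 2"] pos by (intro add_left_mono mult_left_mono) auto
    also have "\<dots> = ?B" by simp
    finally show ?thesis .
  qed
  moreover have "2 * (?A / lam) = 2 / lam * ?A" by simp
  ultimately show ?thesis by linarith
qed

end

section \<open>Growth of the Dirichlet energy and decay of the modulus\<close>

lemma ex_le_average:
  fixes f :: "real \<Rightarrow> real"
  assumes "a < b" "continuous_on {a..b} f" "integral {a..b} f \<le> (b - a) * c"
  shows "\<exists>t\<in>{a..b}. f t \<le> c"
proof -
  obtain t where t: "t \<in> {a..b}" "\<And>s. s \<in> {a..b} \<Longrightarrow> f t \<le> f s"
    using continuous_attains_inf[OF _ _ assms(2)] assms(1) by auto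
  have "(b - a) * f t = integral {a..b} (\<lambda>_. f t)" using assms(1) by simp
  also have "\<dots> \<le> integral {a..b} f" by (rule integral_le) (use t assms integrable_continuous_real in auto)
  finally have "(b - a) * f t \<le> (b - a) * c" using assms(3) by simp
  then show ?thesis using t assms(1) by auto
qed

lemma limit_at_bot_rate:
  fixes f f' :: "real \<Rightarrow> real"
  assumes d: "\<And>s. s \<le> t \<Longrightarrow> (f has_real_derivative f' s) (at s)"
    and b: "\<And>s. s \<le> t \<Longrightarrow> \<bar>f' s\<bar> \<le> C * exp (s / 2)"
    and l: "(f \<longlongrightarrow> L) at_bot"
  shows "\<bar>f t - L\<bar> \<le> 2 * C * exp (t / 2)"
proof -
  have "C * exp (t / 2) \<ge> 0" using b[of t] by linarith
  then have C: "C \<ge> 0" by (simp add: zero_le_mult_iff)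
  have 1: "f t - f s \<le> 2 * C * exp (t / 2)" "f s - f t \<le> 2 * C * exp (t / 2)" if s: "s \<le> t" for s
  proof -
    have "f t - 2 * C * exp (t / 2) \<le> f s - 2 * C * exp (s / 2)"
    proof (rule DERIV_nonpos_imp_nonincreasing[OF s])
      fix x assume x: "s \<le> x" "x \<le> t"
      have "((\<lambda>s. f s - 2 * C * exp (s / 2)) has_real_derivative f' x - C * exp (x / 2)) (at x)"
        by (rule derivative_eq_intros d[OF x(2)] refl | simp)+
      moreover have "f' x - C * exp (x / 2) \<le> 0" using b[OF x(2)] by linarith
      ultimately show "\<exists>y. ((\<lambda>s. f s - 2 * C * exp (s / 2)) has_real_derivative y) (at x) \<and> y \<le> 0" by blast
    qed
    moreover have "f s + 2 * C * exp (s / 2) \<le> f t + 2 * C * exp (t / 2)"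
    proof (rule DERIV_nonneg_imp_nondecreasing[OF s])
      fix x assume x: "s \<le> x" "x \<le> t"
      have "((\<lambda>s. f s + 2 * C * exp (s / 2)) has_real_derivative f' x + C * exp (x / 2)) (at x)"
        by (rule derivative_eq_intros d[OF x(2)] refl | simp)+
      moreover have "f' x + C * exp (x / 2) \<ge> 0" using b[OF x(2)] by linarith
      ultimately show "\<exists>y. ((\<lambda>s. f s + 2 * C * exp (s / 2)) has_real_derivative y) (at x) \<and> 0 \<le> y" by blast
    qed
    moreover have "2 * C * exp (s / 2) \<ge> 0" using C by simp
    ultimately show "f t - f s \<le> 2 * C * exp (t / 2)" "f s - f t \<le> 2 * C * exp (t / 2)" by linarith+
  qed
  have "\<forall>\<^sub>F s in at_bot. \<bar>f t - f s\<bar> \<le> 2 * C * exp (t / 2)"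
    unfolding eventually_at_bot_linorder using 1 by (intro exI[of _ t]) (auto simp: abs_le_iff)
  moreover have "((\<lambda>s. \<bar>f t - f s\<bar>) \<longlongrightarrow> \<bar>f t - L\<bar>) at_bot" by (intro tendsto_intros l)
  ultimately show ?thesis by (intro tendsto_upperbound[where F=at_bot]) auto
qed

text \<open>On each circle the mean of \<open>f^2\<close> and the square of the mean differ by at most the angular
  energy.\<close>

lemma circle_variance:
  assumes f: "cyl (Suc k) S f" and t: "t \<in> S"
  shows "(circ f t)^2 / (2 * pi) \<le> circ (\<lambda>t h. (f t h)^2) t"
    and "circ (\<lambda>t h. (f t h)^2) t \<le> (circ f t)^2 / (2 * pi) + pi^2 / 4 * circ (\<lambda>t h. (dh f t h)^2) t"
proof -
  note c = cyl_imp_cont[OF f] and ch = cyl_imp_cont[OF cyl_Suc_dh[OF f]]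
  show "(circ f t)^2 / (2 * pi) \<le> circ (\<lambda>t h. (f t h)^2) t"
    using integral_square_le[of 0 "2*pi" "f t"] cyl_cont_slice[OF c t] by (simp add: circ_def field_simps)
  have per: "f t 0 = f t (2 * pi)" using c t unfolding cyl_cont_def by (metis add_0_left)
  obtain \<mu> where \<mu>: "\<And>h. h \<in> {0..2*pi} \<Longrightarrow> \<bar>f t h - \<mu>\<bar> \<le> integral {0..2*pi} (\<lambda>h. \<bar>dh f t h\<bar>) / 4"
  proof -
    have "\<exists>\<mu>. \<forall>h\<in>{0..2*pi}. \<bar>f t h - \<mu>\<bar> \<le> integral {0..2*pi} (\<lambda>h. \<bar>dh f t h\<bar>) / 4"
      by (rule periodic_midrange) (use cyl_has_dh[OF f t] cyl_cont_slice[OF ch t] per in auto)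
    then show thesis using that by blast
  qed
  define J where "J = integral {0..2*pi} (\<lambda>h. \<bar>dh f t h\<bar>)"
  have J: "J^2 \<le> 2 * pi * circ (\<lambda>t h. (dh f t h)^2) t"
    using integral_square_le[of 0 "2*pi" "\<lambda>h. \<bar>dh f t h\<bar>"] cyl_cont_slice[OF ch t] 
    by (auto simp: circ_def J_def intro!: continuous_intros)
  have "circ (\<lambda>t h. (f t h)^2) t - 2 * \<mu> * circ f t + 2 * pi * \<mu>^2 = circ (\<lambda>t h. \<mu>^2 + 1 * (f t h)^2 + (- 2 * \<mu>) * f t h) t"
    by (subst circ_affine[of S _ _ t "\<lambda>_. \<mu>^2" "\<lambda>_. 1" "\<lambda>_. - 2 * \<mu>"]) (use c t in \<open>auto intro!: cyl_intros\<close>)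
  also have "\<dots> = integral {0..2*pi} (\<lambda>h. (f t h - \<mu>)^2)"
    unfolding circ_def by (rule integral_cong) (simp add: power2_eq_square algebra_simps)
  also have "\<dots> \<le> integral {0..2*pi} (\<lambda>h. (J / 4)^2)"
  proof (rule integral_le)
    show "(f t h - \<mu>)^2 \<le> (J / 4)^2" if "h \<in> {0..2*pi}" for h
      using \<mu>[OF that] unfolding J_def by (simp add: abs_le_square_iff[symmetric])
  qed (use cyl_cont_slice[OF c t] in \<open>auto intro!: integrable_continuous_real continuous_intros\<close>)
  also have "\<dots> = pi / 8 * J^2" by (simp add: power2_eq_square)
  also have "\<dots> \<le> pi / 8 * (2 * pi * circ (\<lambda>t h. (dh f t h)^2) t)" using J by (intro mult_left_mono) auto
  finally have 1: "circ (\<lambda>t h. (f t h)^2) t - 2 * \<mu> * circ f t + 2 * pi * \<mu>^2 \<le> pi^2 / 4 * circ (\<lambda>t h. (dh f t h)^2) t"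
    by (simp add: power2_eq_square)
  have "0 \<le> (circ f t - 2 * pi * \<mu>)^2 / (2 * pi)" by simp
  also have "\<dots> = (circ f t)^2 / (2 * pi) - 2 * \<mu> * circ f t + 2 * pi * \<mu>^2"
    by (simp add: power2_eq_square field_simps)
  finally show "circ (\<lambda>t h. (f t h)^2) t \<le> (circ f t)^2 / (2 * pi) + pi^2 / 4 * circ (\<lambda>t h. (dh f t h)^2) t"
    using 1 by linarith
qed

text \<open>The constants of the next estimates, explicit because they must not depend on the centre of
  the disc.\<close>

definition mean_const :: "real \<Rightarrow> real \<Rightarrow> real" where
  "mean_const lam \<alpha> = 2 / lam * (pi * \<alpha>^2 / 2 + pi / 4 + 3 / 4)"

definition circle_const :: "real \<Rightarrow> real \<Rightarrow> real" where
  "circle_const lam \<alpha> = 1 / lam * (\<alpha>^2 * pi / 2 + \<alpha>^2 / 2 + 1) + pi * exp 4 + 1 / 4 + (pi * exp 6 + 1 / 2)"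

definition decay_const :: "real \<Rightarrow> real \<Rightarrow> real" where
  "decay_const lam \<alpha> = mean_const lam \<alpha> * (2 * pi * (2 * pi * \<alpha>^2 + circle_const lam \<alpha>) + 2 + 2 * mean_const lam \<alpha>)
     + 2 * pi * (1 + pi^2 / 4) * circle_const lam \<alpha>"

context component
begin

text \<open>Taking \<open>\<eta> = exp T\<close> balances the two terms of the source and gives growth like the radius
  instead of its square. For \<open>\<alpha> = 0\<close> every growing term carries the factor \<open>\<alpha>^2\<close>.\<close>

lemma gradient_growth:
  assumes Ew: "\<And>S T. S \<le> T \<Longrightarrow> integral {S..T} (dens w) \<le> Ew"
    and EW: "\<And>S T. S \<le> T \<Longrightarrow> integral {S..T} (dens W) \<le> EW"
  shows "\<exists>C. \<forall>T\<ge>0. integral {0..T} (circ grad2) \<le> C * exp T"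
    and "\<alpha> = 0 \<Longrightarrow> integrable_tail 0 (circ grad2)"
proof -
  have nn: "0 \<le> Ew" "0 \<le> EW" using Ew[of 0 0] EW[of 0 0] by auto
  define C where "C = 1 / lam * (\<alpha>^2 * pi / 2 * exp 4 + (\<alpha>^2 + 1) / 2 * EW + Ew / 2) + (pi + Ew / 4)"
  have b: "2 * integral {0..T} (circ grad2) \<le> 2 / lam * (\<alpha>^2 * pi / (2 * exp T) * exp (2 * (T + 2)) + (\<alpha>^2 * exp T + 1) / 2 * EW + Ew / 2)
     + (2 * pi / 1 * exp (- 2 * T) + 1 / 2 * Ew)" if "T \<ge> 0" for T
    by (rule gradient_bound) (use Ew EW that in auto)
  have "integral {0..T} (circ grad2) \<le> C * exp T" if T: "T \<ge> 0" for T
  proof -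
    have e1: "exp T \<ge> 1" using T by simp
    \<comment> \<open>The denominator \<open>exp T\<close> coming from the choice of \<open>\<eta>\<close> removes one of the two factors \<open>exp T\<close>.\<close>
    have e2: "exp (2 * (T + 2)) = exp 4 * exp T * exp T" by (simp add: exp_add[symmetric])
    have e3: "exp (- 2 * T) \<le> 1" using T by simp
    have 1: "\<alpha>^2 * pi / (2 * exp T) * exp (2 * (T + 2)) = \<alpha>^2 * pi / 2 * exp 4 * exp T"
      unfolding e2 by (simp add: field_simps)
    have 2: "(\<alpha>^2 * exp T + 1) / 2 * EW \<le> (\<alpha>^2 + 1) / 2 * EW * exp T"
      using mult_left_mono[OF e1, of EW] nn by (simp add: field_simps)
    have 3: "Ew / 2 \<le> Ew / 2 * exp T" using mult_left_mono[OF e1, of "Ew / 2"] nn by simp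
    have 4: "2 * pi / 1 * exp (- 2 * T) + 1 / 2 * Ew \<le> 2 * (pi + Ew / 4) * exp T"
    proof -
      have "2 * pi / 1 * exp (- 2 * T) \<le> 2 * pi * 1" using e3 by (intro mult_mono) auto
      then have "2 * pi / 1 * exp (- 2 * T) + 1 / 2 * Ew \<le> 2 * pi * 1 + 1 / 2 * Ew" by (rule add_right_mono)
      also have "\<dots> = 2 * (pi + Ew / 4) * 1" by simp
      also have "\<dots> \<le> 2 * (pi + Ew / 4) * exp T"
        using e1 nn by (intro mult_left_mono) auto
      finally show ?thesis .
    qed
    have "2 * integral {0..T} (circ grad2) \<le> 2 / lam * (\<alpha>^2 * pi / 2 * exp 4 * exp T + (\<alpha>^2 + 1) / 2 * EW * exp T + Ew / 2 * exp T)
      + 2 * (pi + Ew / 4) * exp T"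
      using b[OF T] 2 3 4 lam unfolding 1 by (elim order_trans, intro add_mono mult_left_mono) auto
    also have "\<dots> = 2 * (C * exp T)" unfolding C_def using lam by (simp add: field_simps)
    finally show ?thesis by simp
  qed
  then show "\<exists>C. \<forall>T\<ge>0. integral {0..T} (circ grad2) \<le> C * exp T" by blast
  assume a: "\<alpha> = 0"
  show "integrable_tail 0 (circ grad2)"
  proof (rule integrable_tailI)
    fix T :: real assume T: "T \<ge> 0"
    have "integral {0..T} (\<lambda>t. \<bar>circ grad2 t\<bar>) = integral {0..T} (circ grad2)"
      by (rule integral_cong) (auto intro!: abs_of_nonneg circ_nonneg[of UNIV] cyl_intros simp: grad2_def)
    also have "\<dots> \<le> 1 / lam * (EW / 2 + Ew / 2) + (pi * exp (- 2 * T) + 1 / 4 * Ew)"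
      using b[OF T] unfolding a by (simp add: field_simps)
    also have "\<dots> \<le> 1 / lam * (EW / 2 + Ew / 2) + (pi + 1 / 4 * Ew)" using T by simp
    finally show "integral {0..T} (\<lambda>t. \<bar>circ grad2 t\<bar>) \<le> 1 / lam * (EW / 2 + Ew / 2) + (pi + 1 / 4 * Ew)" .
  qed (intro circ_cont cyl_intros)
qed

text \<open>The second derivative of the integral of \<open>f\<close> over circles is the integral of the Laplacian, so
  integrating twice from \<open>-\<infinity>\<close> compares circle means with the value at the centre. Although
  \<open>\<Delta>f\<close> is controlled only in \<open>L^1\<close>, the bound on a disc of radius \<open>exp t\<close> is of order \<open>exp (t / 2)\<close>
  because \<open>f\<close> and \<open>W\<close> are square integrable, and this decay makes the second integration
  converge.\<close>

lemma mean_rate: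
  assumes f: "cyl 2 UNIV f" and fr: "\<And>t h. (f t h)^2 \<le> modsq t h"
    and eq: "\<And>t h. dt (dt f) t h + dh (dh f) t h = - (exp (2 * t) * f t h * W t h / lam)"
    and l1: "(circ (dt f) \<longlongrightarrow> 0) at_bot" and l0: "(circ f \<longlongrightarrow> 2 * pi * f0) at_bot"
    and \<delta>: "0 < \<delta>" "\<delta> \<le> 1"
    and Ew: "\<And>S T. S \<le> T \<Longrightarrow> T \<le> 0 \<Longrightarrow> integral {S..T} (dens w) \<le> \<delta>^2"
    and EW: "\<And>S T. S \<le> T \<Longrightarrow> T \<le> 0 \<Longrightarrow> integral {S..T} (dens W) \<le> \<delta>^2"
    and t: "t \<le> 0"
  shows "\<bar>circ f t - 2 * pi * f0\<bar> \<le> mean_const lam \<alpha> * \<delta> * exp (t / 2)"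
proof -
  have f': "cyl (Suc (Suc 0)) UNIV f" using f by (simp add: numeral_2_eq_2)
  note cf = cyl_imp_cont[OF f'] and df = cyl_has_dt[OF f', simplified] and dt2 = cyl_has_dt[OF cyl_Suc_dt[OF f'], simplified]
    and c1 = cyl_imp_cont[OF cyl_Suc_dt[OF f']] and c2 = cyl_imp_cont[OF cyl_Suc_dt[OF cyl_Suc_dt[OF f']]]
    and c3 = cyl_imp_cont[OF cyl_Suc_dh[OF f']] and c4 = cyl_imp_cont[OF cyl_Suc_dh[OF cyl_Suc_dh[OF f']]]
  note [cyl_intros] = cf c1 c2 c3 c4
  have d1: "(circ f has_real_derivative circ (dt f) t) (at t)" for t
    by (rule circ_intros; (intro cyl_intros)?) (rule df)
  define k where "k = (\<lambda>t. - (exp (2 * t) / lam) * circ (\<lambda>t h. f t h * W t h) t)"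
  have d2: "(circ (dt f) has_real_derivative k t) (at t)" for t
  proof -
    have "(circ (dt f) has_real_derivative circ (dt (dt f)) t) (at t)"
      by (rule circ_intros; (intro cyl_intros)?) (rule dt2)
    moreover have "circ (dh (dh f)) t = 0"
      by (rule circ_dh_zero[of UNIV "dh f"]; (intro cyl_intros)?) (use cyl_has_dh[OF cyl_Suc_dh[OF f']] in auto)
    moreover have "circ (\<lambda>t h. dt (dt f) t h + dh (dh f) t h) t = circ (dt (dt f)) t + circ (dh (dh f)) t"
      by (rule circ_add[of UNIV]; (intro cyl_intros)?) auto
    moreover have "circ (\<lambda>t h. dt (dt f) t h + dh (dh f) t h) t = circ (\<lambda>t h. - (exp (2 * t) / lam) * (f t h * W t h)) t"
      by (rule circ_cong) (simp add: eq)
    ultimately show ?thesis unfolding k_def by (simp only: circ_cmult[of "\<lambda>t. - (exp (2 * t) / lam)"] add_0_right)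
  qed
  have ck: "continuous_on UNIV k" unfolding k_def using lam by (intro continuous_intros cyl_intros) auto
  define C where "C = 1 / lam * (pi * \<alpha>^2 / 2 + pi / 4 + 3 / 4) * \<delta>"
  have b: "\<bar>circ (dt f) t\<bar> \<le> C * exp (t / 2)" if t: "t \<le> 0" for t
  proof -
    \<comment> \<open>The optimal weight in \<open>|f W| \<le> \<tau>/2 f^2 + 1/(2 \<tau>) W^2\<close>: both terms become \<open>\<delta> exp (t / 2)\<close>.\<close>
    define \<tau> where "\<tau> = \<delta> * exp (- (t / 2))"
    have tp: "\<tau> > 0" using \<delta> by (simp add: \<tau>_def)
    have et: "exp t > 0" "exp t \<le> 1" using t by auto
    let ?F = "\<lambda>s h. \<tau> / 2 * (\<alpha>^2 + 1 / (2 * exp t)) + \<tau> / 4 * exp t * (w s h)^2 + 1 / (2 * \<tau>) * (W s h)^2"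
    have kb: "\<bar>k s\<bar> \<le> 1 / lam * (pi * \<tau> * (\<alpha>^2 + 1 / (2 * exp t)) * exp (2 * s) + \<tau> / 4 * exp t * dens w s + 1 / (2 * \<tau>) * dens W s)" for s
    proof -
      have pt: "\<bar>f s h * W s h\<bar> \<le> ?F s h" for h
      proof -
        have "\<bar>f s h * W s h\<bar> \<le> \<tau> / 2 * (f s h)^2 + 1 / (2 * \<tau>) * (W s h)^2" by (rule abs_mult_amgm[OF tp])
        also have "(f s h)^2 \<le> \<alpha>^2 + \<bar>w s h\<bar>" using fr[of s h] unfolding w_def by linarith
        also have "\<bar>w s h\<bar> \<le> 1 / (2 * exp t) + exp t / 2 * (w s h)^2" by (rule abs_le_amgm) simp
        finally show ?thesis using tp by (simp add: algebra_simps)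
      qed
      have "\<bar>circ (\<lambda>t h. f t h * W t h) s\<bar> \<le> circ ?F s"
        by (rule circ_abs_le[of UNIV]; (intro cyl_intros)?) (use pt in auto)
      also have "\<dots> = 2 * pi * (\<tau> / 2 * (\<alpha>^2 + 1 / (2 * exp t))) + \<tau> / 4 * exp t * circ (\<lambda>t h. (w t h)^2) s + 1 / (2 * \<tau>) * circ (\<lambda>t h. (W t h)^2) s"
        by (rule circ_affine[of UNIV _ _ s "\<lambda>_. \<tau> / 2 * (\<alpha>^2 + 1 / (2 * exp t))" "\<lambda>_. \<tau> / 4 * exp t" "\<lambda>_. 1 / (2 * \<tau>)"])
          (auto intro!: cyl_intros)
      finally have c: "\<bar>circ (\<lambda>t h. f t h * W t h) s\<bar> \<le> \<dots>" .
      have "\<bar>k s\<bar> = exp (2 * s) / lam * \<bar>circ (\<lambda>t h. f t h * W t h) s\<bar>" using lam by (simp add: k_def abs_mult)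
      also have "\<dots> \<le> exp (2 * s) / lam * (2 * pi * (\<tau> / 2 * (\<alpha>^2 + 1 / (2 * exp t))) + \<tau> / 4 * exp t * circ (\<lambda>t h. (w t h)^2) s + 1 / (2 * \<tau>) * circ (\<lambda>t h. (W t h)^2) s)"
        using c lam by (intro mult_left_mono) auto
      finally show ?thesis by (simp add: algebra_simps)
    qed
    have inc: "\<bar>circ (dt f) t - circ (dt f) s\<bar> \<le> C * exp (t / 2)" if s: "s \<le> t" for s
    proof -
      let ?G = "\<lambda>s. 1 / lam * (pi * \<tau> * (\<alpha>^2 + 1 / (2 * exp t)) * exp (2 * s) + \<tau> / 4 * exp t * dens w s + 1 / (2 * \<tau>) * dens W s)"
      have K: "(k has_integral (circ (dt f) t - circ (dt f) s)) {s..t}" by (rule ftc_real) (use s d2 in auto)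
      have "((\<lambda>s. pi * \<tau> * (\<alpha>^2 + 1 / (2 * exp t)) * exp (2 * s) + \<tau> / 4 * exp t * dens w s + 1 / (2 * \<tau>) * dens W s) has_integral
        (pi * \<tau> * (\<alpha>^2 + 1 / (2 * exp t)) * (exp (2 * t) / 2 - exp (2 * s) / 2) + \<tau> / 4 * exp t * integral {s..t} (dens w) + 1 / (2 * \<tau>) * integral {s..t} (dens W))) {s..t}"
        by (intro has_integral_add has_integral_mult_right exp2_integral[OF s] integrable_integral cint dens_cont cyl_intros)
      from has_integral_mult_right[OF this, of "1 / lam"]
      have G: "(?G has_integral 1 / lam * (pi * \<tau> * (\<alpha>^2 + 1 / (2 * exp t)) * (exp (2 * t) / 2 - exp (2 * s) / 2) + \<tau> / 4 * exp t * integral {s..t} (dens w) + 1 / (2 * \<tau>) * integral {s..t} (dens W))) {s..t}" .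
      have "norm (integral {s..t} k) \<le> integral {s..t} ?G"
      proof (rule integral_norm_bound_integral)
        show "k integrable_on {s..t}" using K by blast
        show "?G integrable_on {s..t}" using G by blast
        show "norm (k x) \<le> ?G x" for x using kb[of x] by simp
      qed
      also have "integral {s..t} ?G = 1 / lam * (pi * \<tau> * (\<alpha>^2 + 1 / (2 * exp t)) * (exp (2 * t) / 2 - exp (2 * s) / 2) + \<tau> / 4 * exp t * integral {s..t} (dens w) + 1 / (2 * \<tau>) * integral {s..t} (dens W))"
        by (rule integral_unique[OF G])
      also have "\<dots> \<le> 1 / lam * (pi * \<tau> * (\<alpha>^2 + 1 / (2 * exp t)) * (exp (2 * t) / 2) + \<tau> / 4 * exp t * \<delta>^2 + 1 / (2 * \<tau>) * \<delta>^2)"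
        using lam tp Ew[OF s t] EW[OF s t] by (intro mult_left_mono add_mono) auto
      also have "\<dots> \<le> 1 / lam * ((pi * \<alpha>^2 / 2 + pi / 4 + 3 / 4) * (\<delta> * exp (t / 2)))"
      proof (intro mult_left_mono)
        have te: "\<tau> * exp t = \<delta> * exp (t / 2)" unfolding \<tau>_def by (simp add: exp_add[symmetric])
        have e2: "exp (2 * t) = exp t * exp t" by (simp add: exp_add[symmetric])
        have "pi * \<tau> * (\<alpha>^2 + 1 / (2 * exp t)) * (exp (2 * t) / 2) = (pi * \<alpha>^2 / 2 * exp t + pi / 4) * (\<tau> * exp t)"
          unfolding e2 by (simp add: field_simps)
        also have "\<dots> \<le> (pi * \<alpha>^2 / 2 * 1 + pi / 4) * (\<tau> * exp t)"
          using tp et by (intro mult_right_mono add_mono mult_left_mono) auto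
        finally have 1: "pi * \<tau> * (\<alpha>^2 + 1 / (2 * exp t)) * (exp (2 * t) / 2) \<le> (pi * \<alpha>^2 / 2 + pi / 4) * (\<delta> * exp (t / 2))"
          unfolding te by simp
        have "\<delta>^2 \<le> 1" using \<delta> by (simp add: power_le_one)
        then have 2: "\<tau> / 4 * exp t * \<delta>^2 \<le> 1 / 4 * (\<delta> * exp (t / 2))"
          using mult_left_mono[of "\<delta>^2" 1 "\<tau> * exp t / 4"] tp te \<delta> by (simp add: zero_le_mult_iff)
        have 3: "1 / (2 * \<tau>) * \<delta>^2 = 1 / 2 * (\<delta> * exp (t / 2))"
          unfolding \<tau>_def using \<delta> by (simp add: exp_minus field_simps power2_eq_square)
        show "pi * \<tau> * (\<alpha>^2 + 1 / (2 * exp t)) * (exp (2 * t) / 2) + \<tau> / 4 * exp t * \<delta>^2 + 1 / (2 * \<tau>) * \<delta>^2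
           \<le> (pi * \<alpha>^2 / 2 + pi / 4 + 3 / 4) * (\<delta> * exp (t / 2))"
          using 1 2 3 by (simp add: algebra_simps)
      qed (use lam in auto)
      also have "\<dots> = C * exp (t / 2)" by (simp add: C_def)
      finally show ?thesis using integral_unique[OF K] by simp
    qed
    have "\<forall>\<^sub>F s in at_bot. \<bar>circ (dt f) t - circ (dt f) s\<bar> \<le> C * exp (t / 2)"
      unfolding eventually_at_bot_linorder using inc by blast
    moreover have "((\<lambda>s. \<bar>circ (dt f) t - circ (dt f) s\<bar>) \<longlongrightarrow> \<bar>circ (dt f) t - 0\<bar>) at_bot" by (intro tendsto_intros l1)
    ultimately have "\<bar>circ (dt f) t - 0\<bar> \<le> C * exp (t / 2)" by (intro tendsto_upperbound[where F=at_bot]) auto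
    then show ?thesis by simp
  qed
  have "\<bar>circ f t - 2 * pi * f0\<bar> \<le> 2 * C * exp (t / 2)"
    by (rule limit_at_bot_rate[OF d1 _ l0]) (use b t in auto)
  moreover have "2 * C * exp (t / 2) = mean_const lam \<alpha> * \<delta> * exp (t / 2)"
    unfolding C_def mean_const_def by (simp add: field_simps)
  ultimately show ?thesis by simp
qed

text \<open>At some time between \<open>-3\<close> and \<open>-2\<close> both the energy on the circle and the deviation of its
  mean of \<open>|u|^2\<close> from \<open>\<alpha>^2\<close> are of order \<open>\<delta>\<close>. Small energy means small variance, so the circle
  mean of \<open>u\<close> has modulus close to \<open>\<alpha>\<close>, and this mean is close to the value at the centre.\<close>

lemma local_modulus:
  assumes l0: "(circ p \<longlongrightarrow> 2 * pi * p0) at_bot" "(circ q \<longlongrightarrow> 2 * pi * q0) at_bot"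
    and \<delta>: "0 < \<delta>" "\<delta> \<le> 1"
    and Ew: "\<And>S T. S \<le> T \<Longrightarrow> T \<le> 0 \<Longrightarrow> integral {S..T} (dens w) \<le> \<delta>^2"
    and EW: "\<And>S T. S \<le> T \<Longrightarrow> T \<le> 0 \<Longrightarrow> integral {S..T} (dens W) \<le> \<delta>^2"
  shows "\<bar>p0^2 + q0^2 - \<alpha>^2\<bar> \<le> decay_const lam \<alpha> * \<delta>"
proof -
  define c1 where "c1 = mean_const lam \<alpha>"
  define c3 where "c3 = circle_const lam \<alpha>"
  have c1: "c1 \<ge> 0" and c3: "c3 \<ge> 0" using lam by (auto simp: c1_def c3_def mean_const_def circle_const_def)
  have d2: "\<delta>^2 \<le> \<delta>" using \<delta> by (simp add: power2_eq_square mult_left_le)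
  have G: "2 * integral {-3..-2} (circ grad2) \<le> 2 / lam * (\<alpha>^2 * pi / (2 * (1 / \<delta>)) * exp (2 * (- 2 + 2)) + (\<alpha>^2 * (1 / \<delta>) + 1) / 2 * \<delta>^2 + \<delta>^2 / 2)
     + (2 * pi / (1 / \<delta>) * exp (- 2 * - 2) + (1 / \<delta>) / 2 * \<delta>^2)"
    by (rule gradient_bound) (use Ew EW \<delta> in auto)
  have "\<dots> = 2 / lam * (\<alpha>^2 * pi / 2 * \<delta> + \<alpha>^2 / 2 * \<delta> + \<delta>^2) + (2 * pi * exp 4 + 1 / 2) * \<delta>"
  proof -
    have "\<alpha>^2 * pi / (2 * (1 / \<delta>)) * exp (2 * (- 2 + 2)) = \<alpha>^2 * pi / 2 * \<delta>" by simp
    moreover have "(\<alpha>^2 * (1 / \<delta>) + 1) / 2 * \<delta>^2 + \<delta>^2 / 2 = \<alpha>^2 / 2 * \<delta> + \<delta>^2"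
      using \<delta> by (simp add: power2_eq_square field_simps)
    moreover have "2 * pi / (1 / \<delta>) * exp (- 2 * - 2) + (1 / \<delta>) / 2 * \<delta>^2 = (2 * pi * exp 4 + 1 / 2) * \<delta>"
      using \<delta> by (simp add: power2_eq_square field_simps)
    ultimately show ?thesis by (simp only: add.assoc)
  qed
  also have "\<dots> \<le> 2 / lam * (\<alpha>^2 * pi / 2 * \<delta> + \<alpha>^2 / 2 * \<delta> + \<delta>) + (2 * pi * exp 4 + 1 / 2) * \<delta>"
    using d2 lam by (intro add_right_mono mult_left_mono) auto
  finally have G': "integral {-3..-2} (circ grad2) \<le> (1 / lam * (\<alpha>^2 * pi / 2 + \<alpha>^2 / 2 + 1) + pi * exp 4 + 1 / 4) * \<delta>"
    using G by (simp add: algebra_simps)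
  have D': "integral {-3..-2} (\<lambda>t. \<bar>circ modsq t - 2 * pi * \<alpha>^2\<bar>) \<le> (pi * exp 6 + 1 / 2) * \<delta>"
  proof -
    let ?F = "\<lambda>t. pi * \<delta> * exp 6 + 1 / (2 * \<delta>) * dens w t"
    have F: "(?F has_integral (pi * \<delta> * exp 6) + 1 / (2 * \<delta>) * integral {-3..-2} (dens w)) {-3..-2}"
    proof (intro has_integral_add has_integral_mult_right integrable_integral cint dens_cont cyl_intros)
      show "((\<lambda>t. c) has_integral c) {-3..-2::real}" for c :: real
        using has_integral_const_real[of c "-3" "-2"] by simp
    qed
    have "integral {-3..-2} (\<lambda>t. \<bar>circ modsq t - 2 * pi * \<alpha>^2\<bar>) \<le> integral {-3..-2} ?F"
    proof (rule integral_le)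
      show "\<bar>circ modsq t - 2 * pi * \<alpha>^2\<bar> \<le> ?F t" if "t \<in> {-3..-2}" for t
      proof -
        have 1: "pi / (1 / \<delta>) * exp (- 2 * t) \<le> pi / (1 / \<delta>) * exp 6" using \<delta> that by (intro mult_left_mono) auto
        have "\<bar>circ modsq t - 2 * pi * \<alpha>^2\<bar> \<le> pi / (1 / \<delta>) * exp (- 2 * t) + (1 / \<delta>) / 2 * dens w t"
          by (rule order_trans[OF mass_defect_le w_circ_bound]) (use \<delta> in simp)
        also have "\<dots> \<le> pi / (1 / \<delta>) * exp 6 + (1 / \<delta>) / 2 * dens w t" using 1 by (rule add_right_mono)
        finally show ?thesis by (simp add: mult.commute)
      qed
      show "(\<lambda>t. \<bar>circ modsq t - 2 * pi * \<alpha>^2\<bar>) integrable_on {-3..-2}"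
        by (intro cint continuous_intros cyl_intros)
    qed (use F in blast)
    also have "\<dots> = (pi * \<delta> * exp 6) + 1 / (2 * \<delta>) * integral {-3..-2} (dens w)" by (rule integral_unique[OF F])
    also have "\<dots> \<le> (pi * \<delta> * exp 6) + 1 / (2 * \<delta>) * \<delta>^2" using Ew[of "-3" "-2"] \<delta> by (intro add_left_mono mult_left_mono) auto
    also have "\<dots> = (pi * exp 6 + 1 / 2) * \<delta>" using \<delta> by (simp add: power2_eq_square field_simps)
    finally show ?thesis .
  qed
  have "\<exists>t\<in>{-3..-2}. circ grad2 t + \<bar>circ modsq t - 2 * pi * \<alpha>^2\<bar> \<le> c3 * \<delta>"
  proof (rule ex_le_average)
    have i: "circ grad2 integrable_on {-3..-2}" "(\<lambda>t. \<bar>circ modsq t - 2 * pi * \<alpha>^2\<bar>) integrable_on {-3..-2}"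
      by (intro cint continuous_intros circ_cont cyl_intros)+
    show "integral {-3..-2} (\<lambda>t. circ grad2 t + \<bar>circ modsq t - 2 * pi * \<alpha>^2\<bar>) \<le> (- 2 - - 3) * (c3 * \<delta>)"
      using G' D' unfolding Henstock_Kurzweil_Integration.integral_add[OF i] c3_def circle_const_def
      by (simp add: algebra_simps)
  qed (auto intro!: continuous_intros circ_cont cyl_intros)
  then obtain t where t: "t \<in> {-3..-2}" "circ grad2 t + \<bar>circ modsq t - 2 * pi * \<alpha>^2\<bar> \<le> c3 * \<delta>" by blast
  define P where "P = circ p t"
  define Q where "Q = circ q t"
  have gr0: "circ grad2 t \<ge> 0" by (rule circ_nonneg[of UNIV], intro cyl_intros) (auto simp: grad2_def)
  have rate: "\<bar>P - 2 * pi * p0\<bar> \<le> c1 * \<delta>" "\<bar>Q - 2 * pi * q0\<bar> \<le> c1 * \<delta>"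
  proof -
    have e: "c1 * \<delta> * exp (t / 2) \<le> c1 * \<delta>" using c1 \<delta> t by (intro mult_left_le) auto
    have "\<bar>P - 2 * pi * p0\<bar> \<le> c1 * \<delta> * exp (t / 2)" unfolding P_def c1_def
      by (rule mean_rate[OF p2 _ eqp products_small_at_bot(3) l0(1) \<delta> Ew EW]) (use t in \<open>auto simp: modsq_def\<close>)
    then show "\<bar>P - 2 * pi * p0\<bar> \<le> c1 * \<delta>" using e by linarith
    have "\<bar>Q - 2 * pi * q0\<bar> \<le> c1 * \<delta> * exp (t / 2)" unfolding Q_def c1_def
      by (rule mean_rate[OF q2 _ eqq products_small_at_bot(4) l0(2) \<delta> Ew EW]) (use t in \<open>auto simp: modsq_def\<close>)
    then show "\<bar>Q - 2 * pi * q0\<bar> \<le> c1 * \<delta>" using e by linarith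
  qed
  have m: "circ modsq t = circ (\<lambda>t h. (p t h)^2) t + circ (\<lambda>t h. (q t h)^2) t"
    unfolding modsq_def by (rule circ_add[of UNIV]; (intro cyl_intros)?) auto
  have g: "circ (\<lambda>t h. (dh p t h)^2) t + circ (\<lambda>t h. (dh q t h)^2) t \<le> circ grad2 t"
  proof -
    have "circ (\<lambda>t h. (dh p t h)^2) t + circ (\<lambda>t h. (dh q t h)^2) t = circ (\<lambda>t h. (dh p t h)^2 + (dh q t h)^2) t"
      by (rule circ_add[of UNIV, symmetric]; (intro cyl_intros)?) auto
    also have "\<dots> \<le> circ grad2 t" by (rule circ_mono[of UNIV]; (intro cyl_intros)?) (auto simp: grad2_def)
    finally show ?thesis .
  qed
  have lo: "(P^2 + Q^2) / (2 * pi) \<le> circ modsq t"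
    using circle_variance(1)[OF p2', of t] circle_variance(1)[OF q2', of t] unfolding m P_def Q_def by (simp add: add_divide_distrib)
  have hi: "circ modsq t \<le> (P^2 + Q^2) / (2 * pi) + pi^2 / 4 * (c3 * \<delta>)"
  proof -
    have "circ modsq t \<le> (P^2 + Q^2) / (2 * pi) + pi^2 / 4 * (circ (\<lambda>t h. (dh p t h)^2) t + circ (\<lambda>t h. (dh q t h)^2) t)"
      using circle_variance(2)[OF p2', of t] circle_variance(2)[OF q2', of t] unfolding m P_def Q_def
      by (simp add: add_divide_distrib distrib_left)
    also have "\<dots> \<le> (P^2 + Q^2) / (2 * pi) + pi^2 / 4 * (c3 * \<delta>)"
      using g t(2) by (intro add_left_mono mult_left_mono) auto
    finally show ?thesis .
  qed
  have md: "\<bar>circ modsq t - 2 * pi * \<alpha>^2\<bar> \<le> c3 * \<delta>" using t(2) gr0 by linarith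
  have A: "\<bar>P^2 + Q^2 - 4 * pi^2 * \<alpha>^2\<bar> \<le> 2 * pi * (1 + pi^2 / 4) * c3 * \<delta>"
  proof -
    define X where "X = (P^2 + Q^2) / (2 * pi)"
    have "\<bar>X - 2 * pi * \<alpha>^2\<bar> \<le> c3 * \<delta> + pi^2 / 4 * (c3 * \<delta>)"
      using lo hi md unfolding X_def[symmetric] by linarith
    then have "2 * pi * \<bar>X - 2 * pi * \<alpha>^2\<bar> \<le> 2 * pi * (c3 * \<delta> + pi^2 / 4 * (c3 * \<delta>))" by (intro mult_left_mono) auto
    moreover have "2 * pi * \<bar>X - 2 * pi * \<alpha>^2\<bar> = \<bar>2 * pi * (X - 2 * pi * \<alpha>^2)\<bar>" by (simp add: abs_mult)
    moreover have "2 * pi * (X - 2 * pi * \<alpha>^2) = P^2 + Q^2 - 4 * pi^2 * \<alpha>^2"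
      by (simp add: X_def power2_eq_square field_simps)
    ultimately show ?thesis by (simp add: algebra_simps)
  qed
  have PQ: "P^2 + Q^2 \<le> 2 * pi * (2 * pi * \<alpha>^2 + c3)"
  proof -
    have "c3 * \<delta> \<le> c3" using c3 \<delta> by (intro mult_left_le) auto
    then have "(P^2 + Q^2) / (2 * pi) \<le> 2 * pi * \<alpha>^2 + c3" using lo md by linarith
    then show ?thesis by (simp add: field_simps)
  qed
  have sq: "\<bar>x^2 - y^2\<bar> \<le> c1 * \<delta> * (y^2 + 1 + c1)" if "\<bar>y - x\<bar> \<le> c1 * \<delta>" for x y :: real
  proof -
    have "\<bar>x^2 - y^2\<bar> = \<bar>y - x\<bar> * \<bar>x + y\<bar>" by (simp add: power2_eq_square abs_mult[symmetric] algebra_simps abs_minus_commute)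
    also have "\<dots> \<le> (c1 * \<delta>) * (y^2 + 1 + c1)"
    proof (rule mult_mono[OF that])
      have "c1 * \<delta> \<le> c1" using c1 \<delta> by (intro mult_left_le) auto
      moreover have "2 * \<bar>y\<bar> \<le> y^2 + 1" using abs_le_amgm[of 1 y] by simp
      ultimately show "\<bar>x + y\<bar> \<le> y^2 + 1 + c1" using that by linarith
    qed (use c1 \<delta> in auto)
    finally show ?thesis .
  qed
  have B: "\<bar>(2 * pi * p0)^2 + (2 * pi * q0)^2 - (P^2 + Q^2)\<bar> \<le> c1 * (2 * pi * (2 * pi * \<alpha>^2 + c3) + 2 + 2 * c1) * \<delta>"
  proof -
    have "\<bar>(2 * pi * p0)^2 + (2 * pi * q0)^2 - (P^2 + Q^2)\<bar> \<le> \<bar>(2 * pi * p0)^2 - P^2\<bar> + \<bar>(2 * pi * q0)^2 - Q^2\<bar>" by linarith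
    also have "\<dots> \<le> c1 * \<delta> * (P^2 + 1 + c1) + c1 * \<delta> * (Q^2 + 1 + c1)" by (intro add_mono sq rate)
    also have "\<dots> = c1 * \<delta> * (P^2 + Q^2 + 2 + 2 * c1)" by algebra
    also have "\<dots> \<le> c1 * \<delta> * (2 * pi * (2 * pi * \<alpha>^2 + c3) + 2 + 2 * c1)"
      using PQ c1 \<delta> by (intro mult_left_mono) auto
    finally show ?thesis by (simp add: mult_ac)
  qed
  have "\<bar>4 * pi^2 * (p0^2 + q0^2 - \<alpha>^2)\<bar> \<le> decay_const lam \<alpha> * \<delta>"
  proof -
    have "4 * pi^2 * (p0^2 + q0^2 - \<alpha>^2) = ((2 * pi * p0)^2 + (2 * pi * q0)^2 - (P^2 + Q^2)) + (P^2 + Q^2 - 4 * pi^2 * \<alpha>^2)"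
      by algebra
    then have "\<bar>4 * pi^2 * (p0^2 + q0^2 - \<alpha>^2)\<bar> \<le> c1 * (2 * pi * (2 * pi * \<alpha>^2 + c3) + 2 + 2 * c1) * \<delta> + 2 * pi * (1 + pi^2 / 4) * c3 * \<delta>"
      using A B by linarith
    then show ?thesis unfolding decay_const_def c1_def c3_def by (simp only: distrib_right)
  qed
  moreover have "\<bar>p0^2 + q0^2 - \<alpha>^2\<bar> \<le> \<bar>4 * pi^2 * (p0^2 + q0^2 - \<alpha>^2)\<bar>"
  proof -
    have "1 * 1 \<le> pi * pi" using pi_ge_two by (intro mult_mono) auto
    then have "1 \<le> 4 * pi^2" unfolding power2_eq_square by linarith
    from mult_right_mono[OF this, of "\<bar>p0^2 + q0^2 - \<alpha>^2\<bar>"] show ?thesis by (simp add: abs_mult)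
  qed
  ultimately show ?thesis by linarith
qed

end

section \<open>Phase and modulus near infinity\<close>

text \<open>Joint continuity of the angular primitive: rescaling moves the variable end point into the
  integrand. The base point \<open>-1\<close> keeps the whole of \<open>[0, 2\<pi>]\<close> in the interior of the domain, where
  the derivatives of the primitive are two-sided.\<close>

lemma primitive_continuous:
  assumes "cyl_cont S g"
  shows "continuous_on (S \<times> {-1..}) (\<lambda>x. integral {-1..snd x} (g (fst x)))"
proof -
  let ?f = "\<lambda>x y. (snd x + 1) * g (fst x) (- 1 + (snd x + 1) * y)"
  have cg: "continuous_on (S \<times> UNIV) (\<lambda>x. g (fst x) (snd x))" using assms by (simp add: cyl_cont_def)
  have "continuous_on ((S \<times> {-1..}) \<times> cbox 0 1) (\<lambda>z. (fst (fst z), - 1 + (snd (fst z) + 1) * snd z :: real))"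
    by (intro continuous_intros)
  from continuous_on_compose2[OF cg this]
  have "continuous_on ((S \<times> {-1..}) \<times> cbox 0 1) (\<lambda>z. g (fst (fst z)) (- 1 + (snd (fst z) + 1) * snd z))"
    by (simp add: image_subset_iff)
  then have "continuous_on ((S \<times> {-1..}) \<times> cbox 0 1) (\<lambda>(x, y). ?f x y)"
    unfolding split_beta by (intro continuous_intros)
  from integral_continuous_on_param[OF this]
  have "continuous_on (S \<times> {-1..}) (\<lambda>x. integral {0..1} (?f x))" by simp
  moreover have "integral {0..1} (?f x) = integral {-1..snd x} (g (fst x))" if x: "x \<in> S \<times> {-1..}" for x
  proof -
    have s: "snd x \<ge> -1" "fst x \<in> S" using x by auto
    have "((\<lambda>y. (snd x + 1) *\<^sub>R g (fst x) (- 1 + (snd x + 1) * y)) has_integral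
        integral {- 1 + (snd x + 1) * 0..- 1 + (snd x + 1) * 1} (g (fst x))) {0..1}"
    proof (rule has_integral_substitution[where c="-1" and d="snd x"])
      show "(\<lambda>y. - 1 + (snd x + 1) * y) ` {0..1} \<subseteq> {- 1..snd x}"
      proof safe
        fix y :: real assume y: "y \<in> {0..1}"
        then have "0 \<le> (snd x + 1) * y" "(snd x + 1) * y \<le> snd x + 1" using s by (auto intro: mult_left_le)
        then show "- 1 + (snd x + 1) * y \<in> {- 1..snd x}" by simp
      qed
      show "continuous_on {- 1..snd x} (g (fst x))" using cyl_cont_slice[OF assms s(2)] .
    qed (use s in \<open>auto intro!: derivative_eq_intros\<close>)
    from integral_unique[OF this] show ?thesis by simp
  qed
  ultimately show ?thesis by (rule continuous_on_eq)
qed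

text \<open>From the time \<open>T1 - 1\<close> on \<open>|u|^2\<close> is within five percent of \<open>\<alpha>^2\<close>, close enough for the
  factor in \<open>phase_energy_finite\<close> to be below one.\<close>

locale far_field = component +
  fixes T1 Ew EW :: real
  assumes T1: "T1 \<ge> 1" and al: "\<alpha> > 0"
    and near: "\<And>t h. t > T1 - 1 \<Longrightarrow> \<bar>w t h\<bar> \<le> \<alpha>^2 / 20"
    and Ew: "\<And>S T. S \<le> T \<Longrightarrow> integral {S..T} (dens w) \<le> Ew"
    and EW: "\<And>S T. S \<le> T \<Longrightarrow> integral {S..T} (dens W) \<le> EW"
begin

definition "far = {T1 - 1<..}"
text \<open>For a local phase \<open>\<phi>\<close> of \<open>u\<close>, these are \<open>d_t \<phi>\<close> and \<open>d_h \<phi>\<close>. The function \<open>bt\<close> is their common mixed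
  derivative, with \<open>cur_ht\<close> the time derivative of \<open>cur_h\<close>.\<close>

definition "a = (\<lambda>t h. cur_t t h / modsq t h)"
definition "b0 = (\<lambda>t h. cur_h t h / modsq t h)"
definition "cur_ht = (\<lambda>t h. dt p t h * dh q t h + p t h * dh (dt q) t h - dt q t h * dh p t h - q t h * dh (dt p) t h)"
definition "bt = (\<lambda>t h. (cur_ht t h * modsq t h - cur_h t h * (2 * (p t h * dt p t h + q t h * dt q t h))) / (modsq t h * modsq t h))"

lemma open_far: "open far" and far_ge: "t \<ge> T1 \<Longrightarrow> t \<in> far"
  unfolding far_def by auto

lemma al2: "\<alpha>^2 > 0" using al by simp

lemma modsq_bounds: "t \<in> far \<Longrightarrow> 19 / 20 * \<alpha>^2 \<le> modsq t h" "t \<in> far \<Longrightarrow> modsq t h \<le> 21 / 20 * \<alpha>^2"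
  using near[of t h] unfolding far_def w_def abs_le_iff greaterThan_iff by linarith+

lemma modsq_pos: "t \<in> far \<Longrightarrow> modsq t h > 0"
  using modsq_bounds(1)[of t h] al2 by linarith

lemma cont_far: "cyl_cont UNIV g \<Longrightarrow> cyl_cont far g" by (rule cyl_cont_subset) auto

lemmas conts_far [cyl_intros] = conts[THEN cont_far] conts2[THEN cont_far]

lemma conts3 [cyl_intros]: "cyl_cont UNIV cur_ht" "cyl_cont far a" "cyl_cont far b0" "cyl_cont far bt"
proof -
  show j: "cyl_cont UNIV cur_ht" unfolding cur_ht_def by (intro cyl_intros)
  note [cyl_intros] = cont_far[OF j]
  have "modsq t h \<noteq> 0" if "t \<in> far" for t h using modsq_pos[OF that, of h] by simp
  then show "cyl_cont far a" "cyl_cont far b0" "cyl_cont far bt"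
    unfolding a_def b0_def bt_def by (intro cyl_intros; simp)+
qed

lemma b0_dt: "t \<in> far \<Longrightarrow> ((\<lambda>s. b0 s h) has_real_derivative bt t h) (at t)"
  and a_dh: "t \<in> far \<Longrightarrow> (a t has_real_derivative bt t h) (at h)"
proof -
  assume t: "t \<in> far"
  have r: "modsq t h \<noteq> 0" using modsq_pos[OF t, of h] by simp
  have 1: "((\<lambda>s. cur_h s h) has_real_derivative cur_ht t h) (at t)"
    unfolding cur_h_def cur_ht_def by (auto intro!: derivative_eq_intros derivs simp: algebra_simps)
  have 2: "((\<lambda>s. modsq s h) has_real_derivative 2 * (p t h * dt p t h + q t h * dt q t h)) (at t)"
    unfolding modsq_def by (auto intro!: derivative_eq_intros derivs simp: algebra_simps)
  from DERIV_divide[OF 1 2 r] show "((\<lambda>s. b0 s h) has_real_derivative bt t h) (at t)"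
    by (simp add: b0_def bt_def)
  let ?j = "dh p t h * dt q t h + p t h * dh (dt q) t h - dh q t h * dt p t h - q t h * dh (dt p) t h"
  have 3: "((\<lambda>h. cur_t t h) has_real_derivative ?j) (at h)"
    unfolding cur_t_def by (auto intro!: derivative_eq_intros derivs simp: algebra_simps)
  have 4: "((\<lambda>h. modsq t h) has_real_derivative 2 * (p t h * dh p t h + q t h * dh q t h)) (at h)"
    unfolding modsq_def by (auto intro!: derivative_eq_intros derivs simp: algebra_simps)
  have "?j * modsq t h - cur_t t h * (2 * (p t h * dh p t h + q t h * dh q t h))
     = cur_ht t h * modsq t h - cur_h t h * (2 * (p t h * dt p t h + q t h * dt q t h))"
    unfolding cur_ht_def cur_h_def cur_t_def modsq_def by algebra
  with DERIV_divide[OF 3 4 r] show "(a t has_real_derivative bt t h) (at h)"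
    by (simp add: a_def[abs_def] bt_def)
qed

text \<open>The gradient of the phase is curl free, so the winding number does not depend on the circle.\<close>

lemma winding: "\<exists>d::int. \<forall>t\<in>far. circ b0 t = 2 * pi * d"
proof -
  have 0: "(circ b0 has_real_derivative 0) (at t)" if t: "t \<in> far" for t
  proof -
    have "(circ b0 has_real_derivative circ bt t) (at t)"
      by (rule circ_has_derivative[OF open_far]) (use t b0_dt in \<open>auto intro!: cyl_intros\<close>)
    moreover have "circ bt t = 0"
      by (rule circ_dh_zero[of far a]) (use t a_dh in \<open>auto intro!: cyl_intros\<close>)
    ultimately show ?thesis by simp
  qed
  obtain c where c: "\<And>t. t \<in> far \<Longrightarrow> circ b0 t = c"
    using has_field_derivative_zero_constant[of far "circ b0"] has_field_derivative_at_within[OF 0]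
    by (auto simp: far_def)
  have "T1 \<in> far" by (rule far_ge) simp
  have per: "p T1 0 = p T1 (2*pi)" "q T1 0 = q T1 (2*pi)"
    using conts(1,2) unfolding cyl_cont_def by (metis add_0_left UNIV_I)+
  have "\<exists>d::int. integral {0..2*pi} (\<lambda>h. (p T1 h * dh q T1 h - q T1 h * dh p T1 h) / ((p T1 h)^2 + (q T1 h)^2)) = 2 * pi * d"
  proof (rule winding_integral_integer)
    show "(p T1 h)^2 + (q T1 h)^2 \<noteq> 0" for h using modsq_pos[OF \<open>T1 \<in> far\<close>, of h] unfolding modsq_def by linarith
  qed (use per in \<open>auto intro!: derivs cyl_cont_slice[of UNIV] cyl_intros\<close>)
  then obtain d :: int where "circ b0 T1 = 2 * pi * d" unfolding circ_def b0_def cur_h_def modsq_def by blast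
  with c \<open>T1 \<in> far\<close> show ?thesis by metis
qed

definition "deg = (SOME d::int. \<forall>t\<in>far. circ b0 t = 2 * pi * d)"

lemma circ_b0: "t \<in> far \<Longrightarrow> circ b0 t = 2 * pi * deg"
  using someI_ex[OF winding] unfolding deg_def by blast

text \<open>What is left of \<open>d_h \<phi>\<close> after the rotating part; its mean is zero, so it has a periodic
  primitive \<open>\<psi>\<close>.\<close>

definition "b = (\<lambda>t h. b0 t h - deg)"

lemma cont_b [cyl_intros]: "cyl_cont far b" unfolding b_def by (intro cyl_intros)

lemma circ_b: "t \<in> far \<Longrightarrow> circ b t = 0"
  unfolding b_def using circ_diff[of far b0 "\<lambda>t h. real_of_int deg" t] circ_const[of "\<lambda>_. real_of_int deg" t]
  by (simp add: circ_b0 conts3 cyl_cont_const)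

definition "\<psi> = (\<lambda>t h. integral {-1..h} (b t))"

lemma psi_dh: "t \<in> far \<Longrightarrow> h > -1 \<Longrightarrow> (\<psi> t has_real_derivative b t h) (at h)"
proof -
  assume t: "t \<in> far" and h: "h > -1"
  have "(\<psi> t has_real_derivative b t h) (at h within {-1..h+1})"
    unfolding \<psi>_def by (rule integral_has_real_derivative) (use h cyl_cont_slice[OF cont_b t] in auto)
  then show ?thesis using h at_within_interior[of h "{-1..h+1}"] by (simp add: interior_atLeastAtMost_real)
qed

text \<open>The primitive is normalised separately on each circle, whence the term \<open>a t (-1)\<close>. It does no
  harm, since \<open>\<psi>\<close> is paired with a current of zero flux.\<close>

lemma psi_dt: "t \<in> far \<Longrightarrow> h \<ge> -1 \<Longrightarrow> ((\<lambda>s. \<psi> s h) has_real_derivative (a t h - a t (-1))) (at t)"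
proof -
  assume t: "t \<in> far" and h: "h \<ge> -1"
  have "((\<lambda>s. integral (cbox (-1) h) (b s)) has_field_derivative integral (cbox (-1) h) (bt t)) (at t within far)"
  proof (rule leibniz_rule_field_derivative)
    show "((\<lambda>s. b s x) has_real_derivative bt s x) (at s within far)" if "s \<in> far" for s x
      unfolding b_def by (rule has_field_derivative_at_within, rule DERIV_cong[OF DERIV_diff[OF b0_dt[OF that] DERIV_const]]) simp
    show "b s integrable_on cbox (-1) h" if "s \<in> far" for s using cyl_cont_int[OF cont_b that] by simp
    show "continuous_on (far \<times> cbox (- 1) h) (\<lambda>(x, y). bt x y)"
      using conts3(4) unfolding cyl_cont_def split_beta by (auto elim: continuous_on_subset)
  qed (use t in \<open>auto simp: far_def\<close>)
  moreover have "integral {-1..h} (bt t) = a t h - a t (-1)"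
    by (rule integral_unique, rule ftc_real) (use h a_dh[OF t] in auto)
  ultimately show ?thesis using at_within_open[OF t open_far] by (simp add: \<psi>_def)
qed

lemma psi_per: "t \<in> far \<Longrightarrow> \<psi> t 0 = \<psi> t (2 * pi)"
proof -
  assume t: "t \<in> far"
  have "integral {-1..0} (b t) + integral {0..2*pi} (b t) = integral {-1..2*pi} (b t)"
    by (rule Henstock_Kurzweil_Integration.integral_combine) (use cyl_cont_int[OF cont_b t] in auto)
  then show ?thesis using circ_b[OF t] by (simp add: \<psi>_def circ_def)
qed

definition "phase_energy = circ (\<lambda>t h. modsq t h * ((a t h)^2 + (b t h)^2))"
definition "phase_pairing = (\<lambda>t. integral {0..2*pi} (\<lambda>h. \<psi> t h * cur_t t h))"

lemma cur_t_eq: "t \<in> far \<Longrightarrow> cur_t t h = modsq t h * a t h" and cur_h_eq: "t \<in> far \<Longrightarrow> cur_h t h = modsq t h * (b t h + deg)"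
  using modsq_pos[of t h] by (auto simp: a_def b_def b0_def)

text \<open>The leading part \<open>\<alpha>^2 b\<close> has mean zero.\<close>

lemma circ_modsq_b: "t \<in> far \<Longrightarrow> circ (\<lambda>t h. modsq t h * b t h) t = - circ (\<lambda>t h. w t h * b t h) t"
proof -
  assume t: "t \<in> far"
  have "circ (\<lambda>t h. modsq t h * b t h) t = circ (\<lambda>t h. 0 + \<alpha>^2 * b t h + (-1) * (w t h * b t h)) t"
    by (rule circ_cong) (simp add: w_def algebra_simps)
  also have "\<dots> = 2 * pi * 0 + \<alpha>^2 * circ b t + (-1) * circ (\<lambda>t h. w t h * b t h) t"
    by (rule circ_affine[of far _ _ t "\<lambda>_. 0" "\<lambda>_. \<alpha>^2" "\<lambda>_. -1"]) (use t in \<open>auto intro!: cyl_intros\<close>)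
  finally show ?thesis using circ_b[OF t] by simp
qed

text \<open>The energy identity for the divergence free current: differentiating \<open>\<psi>\<close> gives \<open>a\<close>, and
  conservation together with an integration by parts around the circle turns \<open>\<psi> d_t (cur_t)\<close> into
  \<open>b cur_h\<close>.\<close>

lemma phase_pairing_deriv: "t \<in> far \<Longrightarrow> (phase_pairing has_real_derivative phase_energy t - deg * circ (\<lambda>t h. w t h * b t h) t) (at t)"
proof -
  assume t: "t \<in> far"
  define jtt where "jtt = (\<lambda>t h. p t h * dt (dt q) t h - q t h * dt (dt p) t h)"
  have cjtt: "cyl_cont UNIV jtt" unfolding jtt_def by (intro cyl_intros)
  let ?D = "\<lambda>t h. (a t h - a t (-1)) * cur_t t h + jtt t h * \<psi> t h"
  have c\<psi>: "continuous_on (far \<times> cbox 0 (2*pi)) (\<lambda>x. \<psi> (fst x) (snd x))"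
    using primitive_continuous[OF cont_b] unfolding \<psi>_def by (rule continuous_on_subset) auto
  have cS: "continuous_on (far \<times> cbox 0 (2*pi)) (\<lambda>x. g (fst x) (snd x))" if "cyl_cont far g" for g
    using that unfolding cyl_cont_def by (auto elim: continuous_on_subset)
  have ca: "continuous_on (far \<times> cbox 0 (2*pi)) (\<lambda>x. a (fst x) (-1))"
    using conts3(2) unfolding cyl_cont_def
    by (auto intro!: continuous_on_compose2[of "far \<times> UNIV" "\<lambda>x. a (fst x) (snd x)" _ "\<lambda>x. (fst x, -1)", simplified] continuous_intros)
  have \<psi>s: "continuous_on {0..2*pi} (\<psi> s)" if "s \<in> far" for s
    by (rule DERIV_continuous_on[where D="b s"], rule has_field_derivative_at_within, rule psi_dh) (use that in auto)
  note js = cyl_cont_slice[OF cont_far[OF conts2(4)]]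
  have "((\<lambda>s. integral (cbox 0 (2*pi)) (\<lambda>h. \<psi> s h * cur_t s h)) has_field_derivative integral (cbox 0 (2*pi)) (?D t)) (at t within far)"
  proof (rule leibniz_rule_field_derivative)
    show "((\<lambda>s. \<psi> s h * cur_t s h) has_real_derivative ?D s h) (at s within far)" if "s \<in> far" "h \<in> cbox 0 (2*pi)" for s h
    proof (rule has_field_derivative_at_within)
      have "((\<lambda>s. cur_t s h) has_real_derivative jtt s h) (at s)" unfolding jtt_def by (rule cur_t_deriv)
      from DERIV_mult[OF psi_dt this] show "((\<lambda>s. \<psi> s h * cur_t s h) has_real_derivative ?D s h) (at s)"
        using that by auto
    qed
    show "(\<lambda>h. \<psi> s h * cur_t s h) integrable_on cbox 0 (2*pi)" if "s \<in> far" for s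
      using \<psi>s[OF that] js[OF that] by (auto intro!: integrable_continuous_real continuous_intros)
    show "continuous_on (far \<times> cbox 0 (2*pi)) (\<lambda>(x, y). ?D x y)"
      unfolding split_beta by (intro continuous_intros cS c\<psi> ca cont_far cjtt conts2 conts3)
  qed (use t in \<open>auto simp: far_def\<close>)
  then have phase_pairing: "(phase_pairing has_real_derivative integral {0..2*pi} (?D t)) (at t)"
    using at_within_open[OF t open_far] by (simp add: phase_pairing_def)
  note sl = cyl_cont_slice[of far, OF _ t]
  have i1: "((\<lambda>h. a t h * cur_t t h - a t (-1) * cur_t t h) has_integral circ (\<lambda>t h. a t h * cur_t t h) t - a t (-1) * 0) {0..2*pi}"
  proof (intro has_integral_diff has_integral_mult_right)
    show "((\<lambda>h. a t h * cur_t t h) has_integral circ (\<lambda>t h. a t h * cur_t t h) t) {0..2*pi}" unfolding circ_def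
      by (intro integrable_integral integrable_continuous_real continuous_intros sl conts3 cont_far conts2)
    show "(cur_t t has_integral 0) {0..2*pi}"
      using flux_zero[of t] integrable_integral[OF integrable_continuous_real[OF sl[OF cont_far[OF conts2(4)]]], of 0 "2*pi"]
      by (simp add: circ_def)
  qed
  have i2: "((\<lambda>h. jtt t h * \<psi> t h) has_integral circ (\<lambda>t h. b t h * cur_h t h) t) {0..2*pi}"
  proof -
    have "((\<lambda>h. jtt t h * \<psi> t h - b t h * cur_h t h) has_integral (- (\<psi> t (2*pi) * cur_h t (2*pi)) - - (\<psi> t 0 * cur_h t 0))) {0..2*pi}"
    proof (rule ftc_real)
      fix h assume "h \<in> {0..2*pi}"
      then have "((\<lambda>h. - (\<psi> t h * cur_h t h)) has_real_derivative - (b t h * cur_h t h + (p t h * dh (dh q) t h - q t h * dh (dh p) t h) * \<psi> t h)) (at h)"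
        by (intro DERIV_minus DERIV_mult psi_dh[OF t] cur_h_deriv) auto
      moreover have "p t h * dh (dh q) t h - q t h * dh (dh p) t h = - jtt t h"
        using current_conserved[of t h] by (simp add: jtt_def)
      ultimately show "((\<lambda>h. - (\<psi> t h * cur_h t h)) has_real_derivative jtt t h * \<psi> t h - b t h * cur_h t h) (at h)" by simp
    qed simp
    moreover have "cur_h t 0 = cur_h t (2*pi)" using conts2(5) unfolding cyl_cont_def by (metis add_0_left UNIV_I)
    ultimately have 1: "((\<lambda>h. jtt t h * \<psi> t h - b t h * cur_h t h) has_integral 0) {0..2*pi}" using psi_per[OF t] by simp
    have "((\<lambda>h. b t h * cur_h t h) has_integral circ (\<lambda>t h. b t h * cur_h t h) t) {0..2*pi}" unfolding circ_def
      by (intro integrable_integral integrable_continuous_real continuous_intros sl cont_b cont_far conts2)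
    from has_integral_add[OF 1 this] show ?thesis by simp
  qed
  have "integral {0..2*pi} (?D t) = circ (\<lambda>t h. a t h * cur_t t h) t + circ (\<lambda>t h. b t h * cur_h t h) t"
    by (rule integral_unique) (use has_integral_add[OF i1 i2] in \<open>simp add: left_diff_distrib\<close>)
  also have "\<dots> = circ (\<lambda>t h. a t h * cur_t t h + b t h * cur_h t h) t"
    by (rule circ_add[of far, symmetric]) (use t in \<open>auto intro!: cyl_intros\<close>)
  also have "\<dots> = circ (\<lambda>t h. 0 + 1 * (modsq t h * ((a t h)^2 + (b t h)^2)) + deg * (modsq t h * b t h)) t"
    by (rule circ_cong) (simp add: cur_t_eq[OF t] cur_h_eq[OF t] power2_eq_square algebra_simps)
  also have "\<dots> = 2 * pi * 0 + 1 * phase_energy t + deg * circ (\<lambda>t h. modsq t h * b t h) t" unfolding phase_energy_def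
    by (rule circ_affine[of far _ _ t "\<lambda>_. 0" "\<lambda>_. 1" "\<lambda>_. deg"]) (use t in \<open>auto intro!: cyl_intros\<close>)
  finally show ?thesis using phase_pairing circ_modsq_b[OF t] by simp
qed

lemma phase_energy_nonneg: "t \<in> far \<Longrightarrow> phase_energy t \<ge> 0"
  unfolding phase_energy_def by (rule circ_nonneg[of far]) (auto intro!: cyl_intros mult_nonneg_nonneg modsq_nonneg)

lemma phase_energy_cont: "continuous_on {T1..} phase_energy"
  unfolding phase_energy_def by (rule continuous_on_subset[OF circ_continuous[of far]]) (auto intro!: cyl_intros far_ge)

text \<open>Zero flux allows \<open>\<psi>\<close> to be centred at its midrange. The resulting factor is \<open>\<pi> / 4\<close> times
  \<open>20 / 19\<close>, the latter from the variation of \<open>|u|^2\<close>.\<close>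

lemma phase_pairing_bound: "t \<in> far \<Longrightarrow> \<bar>phase_pairing t\<bar> \<le> 21 / 25 * phase_energy t"
proof -
  assume t: "t \<in> far"
  note sl = cyl_cont_slice[of far, OF _ t]
  have cb: "continuous_on A (b t)" "continuous_on A (cur_t t)" for A using sl cont_b cont_far conts2 by blast+
  obtain \<mu> where \<mu>: "\<And>h. h \<in> {0..2*pi} \<Longrightarrow> \<bar>\<psi> t h - \<mu>\<bar> \<le> integral {0..2*pi} (\<lambda>h. \<bar>b t h\<bar>) / 4"
  proof -
    have "\<exists>\<mu>. \<forall>h\<in>{0..2*pi}. \<bar>\<psi> t h - \<mu>\<bar> \<le> integral {0..2*pi} (\<lambda>h. \<bar>b t h\<bar>) / 4"
      by (rule periodic_midrange) (use psi_dh[OF t] cb psi_per[OF t] in auto)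
    then show thesis using that by blast
  qed
  define X where "X = integral {0..2*pi} (\<lambda>h. \<bar>b t h\<bar>)"
  define Y where "Y = integral {0..2*pi} (\<lambda>h. \<bar>cur_t t h\<bar>)"
  have c\<psi>: "continuous_on {0..2*pi} (\<psi> t)"
    by (rule DERIV_continuous_on[where D="b t"], rule has_field_derivative_at_within, rule psi_dh) (use t in auto)
  have "((\<lambda>h. \<psi> t h * cur_t t h - \<mu> * cur_t t h) has_integral phase_pairing t - \<mu> * circ cur_t t) {0..2*pi}"
    unfolding phase_pairing_def circ_def
    by (intro has_integral_diff has_integral_mult_right integrable_integral integrable_continuous_real continuous_intros c\<psi> cb)
  then have Bi: "((\<lambda>h. (\<psi> t h - \<mu>) * cur_t t h) has_integral phase_pairing t) {0..2*pi}" by (simp add: flux_zero left_diff_distrib)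
  have "norm (integral {0..2*pi} (\<lambda>h. (\<psi> t h - \<mu>) * cur_t t h)) \<le> integral {0..2*pi} (\<lambda>h. X / 4 * \<bar>cur_t t h\<bar>)"
  proof (rule integral_norm_bound_integral)
    show "norm ((\<psi> t h - \<mu>) * cur_t t h) \<le> X / 4 * \<bar>cur_t t h\<bar>" if "h \<in> {0..2*pi}" for h
      using mult_right_mono[OF \<mu>[OF that], of "\<bar>cur_t t h\<bar>"] unfolding X_def by (simp add: abs_mult)
    show "(\<lambda>h. (\<psi> t h - \<mu>) * cur_t t h) integrable_on {0..2*pi}" using Bi by blast
    show "(\<lambda>h. X / 4 * \<bar>cur_t t h\<bar>) integrable_on {0..2*pi}"
      by (intro integrable_continuous_real continuous_on_mult continuous_on_const continuous_on_rabs cb)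
  qed
  then have 1: "\<bar>phase_pairing t\<bar> \<le> X / 4 * Y" using integral_unique[OF Bi] by (simp add: Y_def)
  define Ib where "Ib = circ (\<lambda>t h. modsq t h * (b t h)^2) t"
  define Ia where "Ia = circ (\<lambda>t h. modsq t h * (a t h)^2) t"
  have X2: "\<alpha>^2 * X^2 \<le> 2 * pi * (20 / 19 * Ib)"
  proof -
    have "X^2 \<le> 2 * pi * circ (\<lambda>t h. (b t h)^2) t"
      using integral_square_le[of 0 "2*pi" "\<lambda>h. \<bar>b t h\<bar>"] cb unfolding X_def circ_def by (auto intro!: continuous_intros)
    then have "\<alpha>^2 * X^2 \<le> \<alpha>^2 * (2 * pi * circ (\<lambda>t h. (b t h)^2) t)" by (intro mult_left_mono) auto
    also have "\<dots> = 2 * pi * circ (\<lambda>t h. \<alpha>^2 * (b t h)^2) t" by (simp only: circ_cmult[of "\<lambda>_. \<alpha>^2"] mult_ac)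
    also have "\<dots> \<le> 2 * pi * circ (\<lambda>t h. 20 / 19 * (modsq t h * (b t h)^2)) t"
    proof (intro mult_left_mono circ_mono[of far])
      show "\<alpha>^2 * (b t h)^2 \<le> 20 / 19 * (modsq t h * (b t h)^2)" for h
        using mult_right_mono[OF modsq_bounds(1)[OF t, of h], of "(b t h)^2"] by simp
    qed (use t in \<open>auto intro!: cyl_intros\<close>)
    also have "\<dots> = 2 * pi * (20 / 19 * Ib)" by (simp only: circ_cmult[of "\<lambda>_. 20 / 19"] Ib_def)
    finally show ?thesis .
  qed
  have Y2: "Y^2 \<le> 2 * pi * (21 / 20 * \<alpha>^2 * Ia)"
  proof -
    have "Y^2 \<le> 2 * pi * circ (\<lambda>t h. (cur_t t h)^2) t"
      using integral_square_le[of 0 "2*pi" "\<lambda>h. \<bar>cur_t t h\<bar>"] cb unfolding Y_def circ_def by (auto intro!: continuous_intros)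
    also have "\<dots> \<le> 2 * pi * circ (\<lambda>t h. 21 / 20 * \<alpha>^2 * (modsq t h * (a t h)^2)) t"
    proof (intro mult_left_mono circ_mono[of far])
      show "(cur_t t h)^2 \<le> 21 / 20 * \<alpha>^2 * (modsq t h * (a t h)^2)" for h
        using mult_right_mono[OF modsq_bounds(2)[OF t, of h], of "modsq t h * (a t h)^2"] modsq_nonneg[of t h]
        by (simp add: cur_t_eq[OF t] power2_eq_square mult_ac)
    qed (use t in \<open>auto intro!: cyl_intros\<close>)
    also have "\<dots> = 2 * pi * (21 / 20 * \<alpha>^2 * Ia)" by (simp only: circ_cmult[of "\<lambda>_. 21 / 20 * \<alpha>^2"] Ia_def)
    finally show ?thesis .
  qed
  have nn: "Ia \<ge> 0" "Ib \<ge> 0" unfolding Ia_def Ib_def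
    by (rule circ_nonneg[of far]; use t in \<open>auto intro!: cyl_intros mult_nonneg_nonneg modsq_nonneg\<close>)+
  have fI: "phase_energy t = Ia + Ib" unfolding phase_energy_def Ia_def Ib_def distrib_left
    by (rule circ_add[of far]) (use t in \<open>auto intro!: cyl_intros\<close>)
  have XY: "X * Y \<le> pi * (20 / 19 * Ib + 21 / 20 * Ia)"
  proof -
    have "X * Y \<le> \<bar>X * Y\<bar>" by simp
    also have "\<dots> \<le> \<alpha>^2 / 2 * X^2 + 1 / (2 * \<alpha>^2) * Y^2" by (rule abs_mult_amgm[OF al2])
    also have "\<dots> \<le> \<alpha>^2 / 2 * X^2 + 1 / (2 * \<alpha>^2) * (2 * pi * (21 / 20 * \<alpha>^2 * Ia))"
      using Y2 al2 by (intro add_left_mono mult_left_mono) auto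
    also have "1 / (2 * \<alpha>^2) * (2 * pi * (21 / 20 * \<alpha>^2 * Ia)) = pi * (21 / 20 * Ia)" using al2 by simp
    also have "\<alpha>^2 / 2 * X^2 \<le> pi * (20 / 19 * Ib)" using X2 by simp
    finally show ?thesis by (simp add: algebra_simps)
  qed
  have "\<bar>phase_pairing t\<bar> \<le> pi / 4 * (20 / 19 * Ib + 21 / 20 * Ia)" using 1 XY by simp
  also have "\<dots> \<le> pi / 4 * (20 / 19 * phase_energy t)"
    using nn unfolding fI by (intro mult_left_mono) auto
  also have "\<dots> = (pi / 4 * (20 / 19)) * phase_energy t" by simp
  also have "\<dots> \<le> 21 / 25 * phase_energy t"
    using pi_approx phase_energy_nonneg[OF t] by (intro mult_right_mono) auto
  finally show ?thesis .
qed

lemma dens_integrable_tail: "integrable_tail T1 (dens w)" "integrable_tail T1 (dens W)"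
proof -
  have "integral {T1..T} (\<lambda>t. \<bar>dens g t\<bar>) = integral {T1..T} (dens g)" if "cyl_cont UNIV g" for g T
    by (rule integral_cong) (use dens_nonneg[OF that] in simp)
  from this[OF conts2(2)] this[OF conts(3)] show "integrable_tail T1 (dens w)" "integrable_tail T1 (dens W)"
    using Ew EW by (simp_all add: integrable_tailI[of T1 _ Ew] integrable_tailI[of T1 _ EW] dens_cont conts conts2)
qed

lemma circ_w2_le: "t \<ge> T1 \<Longrightarrow> circ (\<lambda>t h. (w t h)^2) t \<le> dens w t"
proof -
  assume t: "t \<ge> T1"
  have "1 * circ (\<lambda>t h. (w t h)^2) t \<le> dens w t"
    using t T1 by (intro mult_right_mono circ_nonneg[of UNIV] cyl_intros) auto
  then show ?thesis by simp
qed

text \<open>Integrating the energy identity, with the error \<open>w b\<close> absorbed at the cost of one twentieth of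
  the energy, gives an inequality with the factor \<open>20/19 * 21/25 < 1\<close> in front of the density at the
  end point. Linear growth of the Dirichlet energy then leaves only boundedness.\<close>

lemma phase_energy_finite: "integrable_tail T1 phase_energy"
proof -
  \<comment> \<open>Large enough for \<open>|deg w b|\<close> to be split with one twentieth of \<open>modsq b^2\<close> on one side.\<close>
  define k where "k = 6 * (real_of_int deg)^2 / \<alpha>^2"
  have k: "k \<ge> 0" by (simp add: k_def)
  have wb: "\<bar>deg * circ (\<lambda>t h. w t h * b t h) t\<bar> \<le> 1 / 20 * phase_energy t + k * dens w t" if t: "t \<ge> T1" for t
  proof -
    have tS: "t \<in> far" by (rule far_ge[OF t])
    have pt: "\<bar>deg * (w t h * b t h)\<bar> \<le> 1 / 20 * (modsq t h * ((a t h)^2 + (b t h)^2)) + k * (w t h)^2" for h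
    proof -
      have "\<bar>b t h * (deg * w t h)\<bar> \<le> (19 / 200 * \<alpha>^2) / 2 * (b t h)^2 + 1 / (2 * (19 / 200 * \<alpha>^2)) * (deg * w t h)^2"
        by (rule abs_mult_amgm) (use al2 in simp)
      also have "(19 / 200 * \<alpha>^2) / 2 * (b t h)^2 \<le> 1 / 20 * (modsq t h * (b t h)^2)"
        using mult_right_mono[OF modsq_bounds(1)[OF tS, of h], of "(b t h)^2"] by simp
      also have "1 / (2 * (19 / 200 * \<alpha>^2)) * (deg * w t h)^2 \<le> k * (w t h)^2"
        using al2 unfolding k_def power_mult_distrib by (simp add: field_simps)
      also have "1 / 20 * (modsq t h * (b t h)^2) \<le> 1 / 20 * (modsq t h * ((a t h)^2 + (b t h)^2))"
        using modsq_nonneg by (intro mult_left_mono) auto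
      finally show ?thesis by (simp add: mult_ac)
    qed
    have "\<bar>deg * circ (\<lambda>t h. w t h * b t h) t\<bar> = \<bar>circ (\<lambda>t h. deg * (w t h * b t h)) t\<bar>"
      by (simp only: circ_cmult[of "\<lambda>_. real_of_int deg"])
    also have "\<dots> \<le> circ (\<lambda>t h. 0 + 1 / 20 * (modsq t h * ((a t h)^2 + (b t h)^2)) + k * (w t h)^2) t"
      by (rule circ_abs_le[of far]) (use tS pt in \<open>auto intro!: cyl_intros\<close>)
    also have "\<dots> = 2 * pi * 0 + 1 / 20 * phase_energy t + k * circ (\<lambda>t h. (w t h)^2) t" unfolding phase_energy_def
      by (rule circ_affine[of far _ _ t "\<lambda>_. 0" "\<lambda>_. 1/20" "\<lambda>_. k"]) (use tS in \<open>auto intro!: cyl_intros\<close>)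
    also have "\<dots> \<le> 1 / 20 * phase_energy t + k * dens w t"
      using mult_left_mono[OF circ_w2_le[OF t] k] by simp
    finally show ?thesis .
  qed
  have cwb: "continuous_on {T1..} (circ (\<lambda>t h. w t h * b t h))"
    by (rule continuous_on_subset[OF circ_continuous[of far]]) (auto intro!: cyl_intros far_ge)
  define C where "C = 20 / 19 * (\<bar>phase_pairing T1\<bar> + k * Ew)"
  have main: "integral {T1..T} phase_energy \<le> C + 20 / 19 * (21 / 25) * phase_energy T" if T: "T \<ge> T1" for T
  proof -
    have i: "phase_energy integrable_on {T1..T}" "dens w integrable_on {T1..T}"
      by (rule cont_int[OF phase_energy_cont], simp) (rule cint, intro dens_cont cyl_intros)
    have BI: "((\<lambda>t. phase_energy t - deg * circ (\<lambda>t h. w t h * b t h) t) has_integral (phase_pairing T - phase_pairing T1)) {T1..T}"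
      by (rule ftc_real[OF T]) (use phase_pairing_deriv far_ge in auto)
    have LI: "((\<lambda>t. 19 / 20 * phase_energy t - k * dens w t) has_integral (19 / 20 * integral {T1..T} phase_energy - k * integral {T1..T} (dens w))) {T1..T}"
      by (intro has_integral_diff has_integral_mult_right integrable_integral i)
    have "19 / 20 * integral {T1..T} phase_energy - k * integral {T1..T} (dens w) \<le> phase_pairing T - phase_pairing T1"
    proof -
      have "19 / 20 * phase_energy t - k * dens w t \<le> phase_energy t - deg * circ (\<lambda>t h. w t h * b t h) t" if "t \<in> {T1..T}" for t
        using wb[of t] that by (simp add: abs_le_iff)
      then show ?thesis using has_integral_le[OF LI BI] by blast
    qed
    moreover have "k * integral {T1..T} (dens w) \<le> k * Ew" using Ew[OF T] k by (intro mult_left_mono)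
    moreover have "phase_pairing T \<le> 21 / 25 * phase_energy T" using phase_pairing_bound[OF far_ge[OF T]] by linarith
    ultimately have "19 / 20 * integral {T1..T} phase_energy \<le> 21 / 25 * phase_energy T + \<bar>phase_pairing T1\<bar> + k * Ew" by linarith
    then show ?thesis unfolding C_def by argo
  qed
  obtain D where D: "\<And>T. T \<ge> 0 \<Longrightarrow> integral {0..T} (circ grad2) \<le> D * exp T"
    using gradient_growth(1)[OF Ew EW] by blast
  define e where "e = 21 / 5 * pi * \<alpha>^2 * (real_of_int deg)^2"
  have e0: "e \<ge> 0" unfolding e_def by simp
  have fb: "phase_energy t \<le> 2 * circ grad2 t + e" if t: "t \<ge> T1" for t
  proof -
    have tS: "t \<in> far" by (rule far_ge[OF t])
    have "phase_energy t \<le> circ (\<lambda>t h. 21 / 10 * \<alpha>^2 * (real_of_int deg)^2 + 2 * grad2 t h + 0 * grad2 t h) t" unfolding phase_energy_def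
    proof (rule circ_mono[of far])
      fix h
      have r: "modsq t h > 0" by (rule modsq_pos[OF tS])
      have "modsq t h * (modsq t h * (a t h)^2 + modsq t h * (b0 t h)^2) = (cur_t t h)^2 + (cur_h t h)^2"
        using r by (simp add: a_def b0_def power2_eq_square field_simps)
      also have "\<dots> \<le> modsq t h * grad2 t h"
      proof -
        have "modsq t h * grad2 t h = (cur_t t h)^2 + (cur_h t h)^2 + (p t h * dt p t h + q t h * dt q t h)^2 + (p t h * dh p t h + q t h * dh q t h)^2"
          unfolding modsq_def grad2_def cur_t_def cur_h_def by algebra
        then show ?thesis by simp
      qed
      finally have g: "modsq t h * (a t h)^2 + modsq t h * (b0 t h)^2 \<le> grad2 t h" using r by simp
      have "(b t h)^2 \<le> 2 * (b0 t h)^2 + 2 * (real_of_int deg)^2"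
        using sum_squares_ge_zero[of "b0 t h + deg" 0] unfolding b_def by (simp add: power2_eq_square algebra_simps)
      then have "modsq t h * ((a t h)^2 + (b t h)^2) \<le> modsq t h * (2 * (a t h)^2 + (2 * (b0 t h)^2 + 2 * (real_of_int deg)^2))"
        using r by (intro mult_left_mono add_mono) auto
      also have "\<dots> = 2 * (modsq t h * (a t h)^2 + modsq t h * (b0 t h)^2) + modsq t h * (2 * (real_of_int deg)^2)"
        by (simp add: algebra_simps)
      also have "\<dots> \<le> 2 * grad2 t h + 21 / 20 * \<alpha>^2 * (2 * (real_of_int deg)^2)"
        using g modsq_bounds(2)[OF tS, of h] by (intro add_mono mult_left_mono mult_right_mono) auto
      finally show "modsq t h * ((a t h)^2 + (b t h)^2) \<le> 21 / 10 * \<alpha>^2 * (real_of_int deg)^2 + 2 * grad2 t h + 0 * grad2 t h" by simp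
    qed (use tS in \<open>auto intro!: cyl_intros\<close>)
    also have "\<dots> = 2 * pi * (21 / 10 * \<alpha>^2 * (real_of_int deg)^2) + 2 * circ grad2 t + 0 * circ grad2 t"
      by (rule circ_affine[of UNIV _ _ t "\<lambda>_. 21 / 10 * \<alpha>^2 * (real_of_int deg)^2" "\<lambda>_. 2" "\<lambda>_. 0"]) (auto intro!: cyl_intros)
    finally show ?thesis by (simp add: e_def)
  qed
  have slow: "integral {T1..T} phase_energy \<le> (2 * D + e) * exp T" if T: "T \<ge> T1" for T
  proof -
    have ig: "circ grad2 integrable_on {x..y}" for x y by (intro cint circ_cont cyl_intros)
    have g0: "circ grad2 t \<ge> 0" for t by (rule circ_nonneg[of UNIV], intro cyl_intros) (auto simp: grad2_def)
    have "integral {T1..T} phase_energy \<le> integral {T1..T} (\<lambda>t. 2 * circ grad2 t + e)"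
      by (rule integral_le) (use fb cont_int[OF phase_energy_cont] ig in \<open>auto intro!: integrable_add integrable_on_cmult_left\<close>)
    also have "\<dots> = 2 * integral {T1..T} (circ grad2) + (T - T1) * e"
    proof (rule integral_unique)
      show "((\<lambda>t. 2 * circ grad2 t + e) has_integral 2 * integral {T1..T} (circ grad2) + (T - T1) * e) {T1..T}"
        using has_integral_const_real[of e T1 T] T
        by (intro has_integral_add has_integral_mult_right integrable_integral ig) simp
    qed
    also have "integral {T1..T} (circ grad2) \<le> integral {0..T} (circ grad2)"
      by (rule integral_subset_le) (use T1 ig g0 in auto)
    also have "\<dots> \<le> D * exp T" using D[of T] T T1 by simp
    also have "(T - T1) * e \<le> exp T * e"
    proof (rule mult_right_mono[OF _ e0])
      have "T - T1 \<le> 1 + T" using T1 by simp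
      also have "\<dots> \<le> exp T" by (rule exp_ge_add_one_self)
      finally show "T - T1 \<le> exp T" .
    qed
    finally show ?thesis by (simp add: algebra_simps)
  qed
  show ?thesis
    by (rule slow_growth_imp_bounded[OF phase_energy_cont _ _ _ main slow]) (use phase_energy_nonneg far_ge in auto)
qed

definition "wt = (\<lambda>t h. - (2 * (p t h * dt p t h + q t h * dt q t h)))"
definition "wh = (\<lambda>t h. - (2 * (p t h * dh p t h + q t h * dh q t h)))"
definition "modulus_energy = circ (\<lambda>t h. (wt t h)^2 + (wh t h)^2)"

lemma conts4 [cyl_intros]: "cyl_cont UNIV wt" "cyl_cont UNIV wh"
  unfolding wt_def wh_def by (intro cyl_intros)+

lemmas conts4_far [cyl_intros] = conts4[THEN cont_far]

text \<open>The gradient splits into the part along \<open>u\<close>, seen by \<open>w\<close>, and the part across, seen by the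
  phase.\<close>

lemma grad2_split: "t \<in> far \<Longrightarrow> grad2 t h = ((wt t h)^2 + (wh t h)^2) / (4 * modsq t h) + modsq t h * ((a t h)^2 + (b0 t h)^2)"
proof -
  assume t: "t \<in> far"
  have r: "modsq t h > 0" by (rule modsq_pos[OF t])
  have "4 * (modsq t h * grad2 t h) = (wt t h)^2 + (wh t h)^2 + 4 * ((cur_t t h)^2 + (cur_h t h)^2)"
    unfolding modsq_def grad2_def cur_t_def cur_h_def wt_def wh_def by algebra
  moreover have "(cur_t t h)^2 + (cur_h t h)^2 = modsq t h * (modsq t h * ((a t h)^2 + (b0 t h)^2))"
    using r by (simp add: a_def b0_def power2_eq_square field_simps)
  ultimately have "grad2 t h = ((wt t h)^2 + (wh t h)^2 + 4 * (modsq t h * (modsq t h * ((a t h)^2 + (b0 t h)^2)))) / (4 * modsq t h)"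
    using r by (simp add: field_simps)
  also have "\<dots> = ((wt t h)^2 + (wh t h)^2) / (4 * modsq t h) + modsq t h * ((a t h)^2 + (b0 t h)^2)"
    using r by (simp add: add_divide_distrib)
  finally show ?thesis .
qed

lemma w_abs_le: "t \<ge> T1 \<Longrightarrow> circ (\<lambda>t h. \<bar>w t h\<bar>) t \<le> pi * exp (- (2 * t)) + 1 / 2 * dens w t"
  using w_circ_bound[of 1 t] by simp

text \<open>The second derivative of the integral of \<open>w^2\<close> over circles dominates \<open>|\<nabla>w|^2\<close> up to
  terms that are integrable once the phase energy is. As \<open>w\<close> is square integrable itself, this
  bounds the energy of \<open>w\<close>.\<close>

lemma modulus_energy_finite: "integrable_tail T1 modulus_energy"
proof -
  define wtt where "wtt = (\<lambda>t h. - (2 * ((dt p t h)^2 + p t h * dt (dt p) t h + (dt q t h)^2 + q t h * dt (dt q) t h)))"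
  define whh where "whh = (\<lambda>t h. - (2 * ((dh p t h)^2 + p t h * dh (dh p) t h + (dh q t h)^2 + q t h * dh (dh q) t h)))"
  have c2nd [cyl_intros]: "cyl_cont UNIV wtt" "cyl_cont UNIV whh" unfolding wtt_def whh_def by (intro cyl_intros)+
  note [cyl_intros] = c2nd[THEN cont_far]
  have dw: "((\<lambda>s. w s h) has_real_derivative wt t h) (at t)" "(w t has_real_derivative wh t h) (at h)"
    "((\<lambda>s. wt s h) has_real_derivative wtt t h) (at t)" "(wh t has_real_derivative whh t h) (at h)" for t h
    unfolding w_def modsq_def wt_def wh_def wtt_def whh_def
    by (auto intro!: derivative_eq_intros derivs simp: power2_eq_square algebra_simps)
  let ?y = "circ (\<lambda>t h. (w t h)^2)"
  let ?y1 = "circ (\<lambda>t h. 2 * (w t h * wt t h))"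
  let ?A = "\<lambda>t h. 2 * ((wt t h)^2 + w t h * wtt t h)"
  \<comment> \<open>The integral of \<open>?Bh\<close> over a circle vanishes; adding it to that of \<open>?A\<close> produces the Laplacian of \<open>w\<close>.\<close>
  let ?Bh = "\<lambda>t h. 2 * ((wh t h)^2 + w t h * whh t h)"
  have y: "(?y has_real_derivative ?y1 t) (at t)" for t
    by (rule circ_intros; (intro cyl_intros)?) (auto intro!: derivative_eq_intros dw)
  have y1: "(?y1 has_real_derivative circ ?A t) (at t)" for t
    by (rule circ_intros; (intro cyl_intros)?) (auto intro!: derivative_eq_intros dw simp: power2_eq_square)
  have zero: "circ ?Bh t = 0" for t
    by (rule circ_dh_zero[of UNIV "\<lambda>t h. 2 * (w t h * wh t h)"]; (intro cyl_intros)?)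
      (auto intro!: derivative_eq_intros dw simp: power2_eq_square)
  have lap: "wtt t h + whh t h = - 2 * grad2 t h + 2 * exp (2 * t) / lam * (modsq t h * W t h)" for t h
  proof -
    have "wtt t h + whh t h = - 2 * grad2 t h - 2 * (p t h * (dt (dt p) t h + dh (dh p) t h) + q t h * (dt (dt q) t h + dh (dh q) t h))"
      unfolding wtt_def whh_def grad2_def by algebra
    then show ?thesis unfolding eqp eqq modsq_def using lam by (simp add: field_simps power2_eq_square)
  qed
  define c1 where "c1 = 2 / 5 * \<alpha>^2"
  define c2 where "c2 = 42 / 5 * \<alpha>^2 * (real_of_int deg)^2"
  define c3 where "c3 = 21 / 10 * \<alpha>^2 / lam"
  define k where "k t = c1 * phase_energy t + c2 * (pi * exp (- (2 * t)) + 1 / 2 * dens w t) + c3 * (dens w t + dens W t)" for t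
  have c: "c1 \<ge> 0" "c2 \<ge> 0" "c3 \<ge> 0" using lam by (auto simp: c1_def c2_def c3_def)
  have "integrable_tail T1 (\<lambda>t. c1 * phase_energy t + c2 * (pi * exp (- (2 * t)) + 1 / 2 * dens w t) + c3 * (dens w t + dens W t))"
    by (intro integrable_tail_add integrable_tail_cmult phase_energy_finite dens_integrable_tail integrable_tail_exp_minus) simp
  then have kb: "integrable_tail T1 k" unfolding k_def .
  have low: "modulus_energy t - k t \<le> circ ?A t" if t: "t \<ge> T1" for t
  proof -
    have tS: "t \<in> far" by (rule far_ge[OF t])
    let ?L = "\<lambda>t h. ((wt t h)^2 + (wh t h)^2) - c1 * (modsq t h * ((a t h)^2 + (b t h)^2)) - c2 * \<bar>w t h\<bar> - c3 * exp (2 * t) * ((w t h)^2 + (W t h)^2)"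
    have pt: "?L t h \<le> ?A t h + ?Bh t h" for h
    proof -
      have r: "modsq t h > 0" by (rule modsq_pos[OF tS])
      have rb: "19 / 20 * \<alpha>^2 \<le> modsq t h" "modsq t h \<le> 21 / 20 * \<alpha>^2" using modsq_bounds[OF tS] by auto
      have wn: "\<bar>w t h\<bar> \<le> \<alpha>^2 / 20" using near tS unfolding far_def by auto
      define D where "D = (wt t h)^2 + (wh t h)^2"
      define X where "X = modsq t h * ((a t h)^2 + (b0 t h)^2)"
      define Y where "Y = modsq t h * ((a t h)^2 + (b t h)^2)"
      have D0: "D \<ge> 0" by (simp add: D_def)
      have X0: "X \<ge> 0" using r by (simp add: X_def)
      have eq: "?A t h + ?Bh t h = 2 * D - 4 * (w t h * (D / (4 * modsq t h))) - 4 * (w t h * X) + 4 * exp (2 * t) / lam * (w t h * modsq t h * W t h)"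
      proof -
        have "?A t h + ?Bh t h = 2 * D + 2 * w t h * (wtt t h + whh t h)" unfolding D_def by algebra
        also have "\<dots> = 2 * D - 4 * (w t h * grad2 t h) + 4 * exp (2 * t) / lam * (w t h * modsq t h * W t h)"
          unfolding lap using lam by (simp add: field_simps)
        also have "grad2 t h = D / (4 * modsq t h) + X" unfolding D_def X_def by (rule grad2_split[OF tS])
        finally show ?thesis by (simp add: algebra_simps)
      qed
      have t1: "4 * (w t h * (D / (4 * modsq t h))) \<le> D"
      proof -
        have "w t h \<le> modsq t h" using wn rb al2 by (simp add: abs_le_iff)
        then have "w t h * D \<le> modsq t h * D" using D0 by (intro mult_right_mono) auto
        then show ?thesis using r by (simp add: field_simps)
      qed
      have t2: "4 * (w t h * X) \<le> c1 * Y + c2 * \<bar>w t h\<bar>"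
      proof -
        have "(b0 t h)^2 \<le> 2 * (b t h)^2 + 2 * (real_of_int deg)^2"
          using sum_squares_ge_zero[of "b t h - deg" 0] unfolding b_def by (simp add: power2_eq_square algebra_simps)
        then have "X \<le> modsq t h * (2 * (a t h)^2 + (2 * (b t h)^2 + 2 * (real_of_int deg)^2))"
          unfolding X_def using r by (intro mult_left_mono add_mono) auto
        also have "\<dots> = 2 * Y + modsq t h * (2 * (real_of_int deg)^2)" unfolding Y_def by (simp add: algebra_simps)
        also have "\<dots> \<le> 2 * Y + 21 / 20 * \<alpha>^2 * (2 * (real_of_int deg)^2)"
          using rb by (intro add_left_mono mult_right_mono) auto
        finally have Xb: "X \<le> 2 * Y + 21 / 10 * \<alpha>^2 * (real_of_int deg)^2" by simp
        have Y0: "Y \<ge> 0" using r by (simp add: Y_def)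
        have "w t h * X \<le> \<bar>w t h\<bar> * X" using X0 by (intro mult_right_mono) auto
        also have "\<dots> \<le> \<bar>w t h\<bar> * (2 * Y + 21 / 10 * \<alpha>^2 * (real_of_int deg)^2)" using Xb by (intro mult_left_mono) auto
        also have "\<dots> = \<bar>w t h\<bar> * (2 * Y) + 21 / 10 * \<alpha>^2 * (real_of_int deg)^2 * \<bar>w t h\<bar>" by (simp add: algebra_simps)
        also have "\<dots> \<le> \<alpha>^2 / 20 * (2 * Y) + 21 / 10 * \<alpha>^2 * (real_of_int deg)^2 * \<bar>w t h\<bar>"
          using wn Y0 by (intro add_right_mono mult_right_mono) auto
        finally show ?thesis unfolding c1_def c2_def by (simp add: algebra_simps)
      qed
      have t3: "- (4 * exp (2 * t) / lam * (w t h * modsq t h * W t h)) \<le> c3 * exp (2 * t) * ((w t h)^2 + (W t h)^2)"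
      proof -
        have "- (w t h * modsq t h * W t h) \<le> \<bar>w t h * W t h\<bar> * modsq t h"
          using mult_right_mono[OF abs_ge_minus_self[of "w t h * W t h"], of "modsq t h"] r by (simp add: mult_ac)
        also have "\<dots> \<le> (1 / 2 * (w t h)^2 + 1 / 2 * (W t h)^2) * (21 / 20 * \<alpha>^2)"
          using abs_mult_amgm[of 1 "w t h" "W t h"] rb r by (intro mult_mono) auto
        finally have z: "- (w t h * modsq t h * W t h) \<le> 21 / 40 * \<alpha>^2 * ((w t h)^2 + (W t h)^2)" by (simp add: algebra_simps)
        have "4 * exp (2 * t) / lam * (- (w t h * modsq t h * W t h)) \<le> 4 * exp (2 * t) / lam * (21 / 40 * \<alpha>^2 * ((w t h)^2 + (W t h)^2))"
          using z lam by (intro mult_left_mono) auto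
        moreover have "4 * exp (2 * t) / lam * (21 / 40 * \<alpha>^2 * ((w t h)^2 + (W t h)^2)) = c3 * exp (2 * t) * ((w t h)^2 + (W t h)^2)"
          by (simp add: c3_def)
        ultimately show ?thesis by simp
      qed
      have gen: "A \<le> x \<Longrightarrow> A' \<le> y + v \<Longrightarrow> - A'' \<le> z \<Longrightarrow> x - y - v - z \<le> 2 * x - A - A' + A''" for A A' A'' x y v z :: real
        by linarith
      show ?thesis unfolding eq D_def[symmetric] Y_def[symmetric] by (rule gen[OF t1 t2 t3])
    qed
    have "modulus_energy t - k t \<le> circ ?L t"
    proof -
      have 1: "circ (\<lambda>t h. ((wt t h)^2 + (wh t h)^2) - c1 * (modsq t h * ((a t h)^2 + (b t h)^2)) - c2 * \<bar>w t h\<bar>) t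
        = modulus_energy t - c1 * phase_energy t - c2 * circ (\<lambda>t h. \<bar>w t h\<bar>) t"
        unfolding phase_energy_def modulus_energy_def using tS
        by (subst circ_diff[of far], intro cyl_intros, intro cyl_intros, simp,
            subst circ_diff[of far], intro cyl_intros, intro cyl_intros, simp)
           (simp only: circ_cmult[of "\<lambda>_. c1"] circ_cmult[of "\<lambda>_. c2"])
      have 2: "circ (\<lambda>t h. c3 * exp (2 * t) * ((w t h)^2 + (W t h)^2)) t = c3 * (dens w t + dens W t)"
        by (simp only: circ_cmult[of "\<lambda>t. c3 * exp (2 * t)"], subst circ_add[of UNIV], intro cyl_intros, intro cyl_intros)
           (simp_all add: algebra_simps)
      have 3: "circ ?L t = modulus_energy t - c1 * phase_energy t - c2 * circ (\<lambda>t h. \<bar>w t h\<bar>) t - c3 * (dens w t + dens W t)"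
        unfolding 1[symmetric] 2[symmetric]
        by (rule circ_diff[of far]) (use tS in \<open>auto intro!: cyl_intros cyl_cont_fst continuous_intros\<close>)
      have "c2 * circ (\<lambda>t h. \<bar>w t h\<bar>) t \<le> c2 * (pi * exp (- (2 * t)) + 1 / 2 * dens w t)"
        using w_abs_le[OF t] c by (intro mult_left_mono)
      then show ?thesis unfolding 3 k_def by linarith
    qed
    also have "circ ?L t \<le> circ (\<lambda>t h. ?A t h + ?Bh t h) t"
      by (rule circ_mono[of far]) (use tS pt in \<open>auto intro!: cyl_intros cyl_cont_fst continuous_intros\<close>)
    also have "\<dots> = circ ?A t + circ ?Bh t"
      by (rule circ_add[of UNIV]) (auto intro!: cyl_intros)
    finally show ?thesis using zero by simp
  qed
  have yb: "integrable_tail T1 ?y"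
  proof (rule integrable_tail_mono[OF dens_integrable_tail(1)])
    show "continuous_on {T1..} ?y" by (intro circ_cont cyl_intros)
    show "\<bar>?y t\<bar> \<le> \<bar>dens w t\<bar>" if "t \<ge> T1" for t
    proof -
      have "circ (\<lambda>t h. (w t h)^2) t \<ge> 0" by (rule circ_nonneg[of UNIV]) (auto intro!: cyl_intros)
      then show ?thesis using circ_w2_le[OF that] by linarith
    qed
  qed
  show ?thesis
  proof (rule convex_integrable_imp_bounded[OF y y1 low _ _ kb yb])
    show "continuous_on {T1..} modulus_energy" unfolding modulus_energy_def by (intro circ_cont cyl_intros)
    show "modulus_energy t \<ge> 0" for t unfolding modulus_energy_def by (rule circ_nonneg[of UNIV]) (auto intro!: cyl_intros)
    show "circ (\<lambda>t h. (w t h)^2) t \<ge> 0" for t by (rule circ_nonneg[of UNIV]) (auto intro!: cyl_intros)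
  qed
qed

text \<open>Expanding \<open>(b + deg)^2\<close>, the square of \<open>deg\<close> gives the limit, and every other term is
  integrable. The mixed term is linear in \<open>b\<close> and becomes integrable because \<open>\<alpha>^2 b\<close> has mean zero.\<close>

lemma stress_limit: "integrable_tail T1 (\<lambda>t. stress t + 2 * pi * \<alpha>^2 * (real_of_int deg)^2)"
proof -
  define c where "c = 1 / (19 / 5 * \<alpha>^2)"
  define d where "d = real_of_int deg"
  define k where "k t = c * modulus_energy t + 1 * phase_energy t + (d^2 * (pi * exp (- (2 * t)) + 1 / 2 * dens w t)
     + (2 * \<bar>d\<bar>) * (1 / (2 * (19 / 20 * \<alpha>^2)) * dens w t + 1 / 2 * phase_energy t))" for t
  have kb: "integrable_tail T1 k" unfolding k_def
    by (intro integrable_tail_add integrable_tail_cmult phase_energy_finite modulus_energy_finite dens_integrable_tail integrable_tail_exp_minus) simp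
  show ?thesis
  proof (rule integrable_tail_mono[OF kb])
    show "continuous_on {T1..} (\<lambda>t. stress t + 2 * pi * \<alpha>^2 * (real_of_int deg)^2)"
      unfolding stress_def by (intro continuous_intros circ_cont cyl_intros)
    fix t assume t: "t \<ge> T1"
    have tS: "t \<in> far" by (rule far_ge[OF t])
    let ?X = "\<lambda>t h. ((wt t h)^2 - (wh t h)^2) / (4 * modsq t h) + modsq t h * ((a t h)^2 - (b t h)^2)"
    have r: "modsq t h > 0" if "t \<in> far" for t h by (rule modsq_pos[OF that])
    have rn: "4 * modsq t h \<noteq> 0" if "t \<in> far" for t h using r[OF that, of h] by simp
    have cX: "cyl_cont far ?X" by (intro cyl_intros rn)
    have pt: "(dt p t h)^2 + (dt q t h)^2 - (dh p t h)^2 - (dh q t h)^2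
       = ?X t h + (- (d^2) * \<alpha>^2 + d^2 * w t h + (- 2 * d) * (modsq t h * b t h))" for h
    proof -
      have "4 * (modsq t h * ((dt p t h)^2 + (dt q t h)^2 - (dh p t h)^2 - (dh q t h)^2))
         = (wt t h)^2 - (wh t h)^2 + 4 * ((cur_t t h)^2 - (cur_h t h)^2)"
        unfolding modsq_def cur_t_def cur_h_def wt_def wh_def by algebra
      moreover have "(cur_t t h)^2 - (cur_h t h)^2 = modsq t h * (modsq t h * ((a t h)^2 - (b t h + d)^2))"
        unfolding cur_t_eq[OF tS] cur_h_eq[OF tS] d_def by (simp add: power2_eq_square algebra_simps)
      ultimately have "(dt p t h)^2 + (dt q t h)^2 - (dh p t h)^2 - (dh q t h)^2
         = ((wt t h)^2 - (wh t h)^2 + 4 * (modsq t h * (modsq t h * ((a t h)^2 - (b t h + d)^2)))) / (4 * modsq t h)"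
        using r[OF tS, of h] by (simp add: field_simps)
      also have "\<dots> = ((wt t h)^2 - (wh t h)^2) / (4 * modsq t h) + modsq t h * ((a t h)^2 - (b t h + d)^2)"
        using r[OF tS, of h] by (simp add: add_divide_distrib)
      also have "modsq t h * ((a t h)^2 - (b t h + d)^2) = modsq t h * ((a t h)^2 - (b t h)^2) - d^2 * modsq t h + (- 2 * d) * (modsq t h * b t h)"
        by (simp add: power2_eq_square algebra_simps)
      also have "modsq t h = \<alpha>^2 - w t h" by (simp add: w_def)
      finally show ?thesis by (simp add: w_def algebra_simps)
    qed
    have "stress t = circ (\<lambda>t h. ?X t h + (- (d^2) * \<alpha>^2 + d^2 * w t h + (- 2 * d) * (modsq t h * b t h))) t"
      unfolding stress_def by (rule circ_cong) (rule pt)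
    also have "\<dots> = circ ?X t + circ (\<lambda>t h. - (d^2) * \<alpha>^2 + d^2 * w t h + (- 2 * d) * (modsq t h * b t h)) t"
      by (rule circ_add[of far]) (use tS cX in \<open>auto intro!: cyl_intros\<close>)
    also have "circ (\<lambda>t h. - (d^2) * \<alpha>^2 + d^2 * w t h + (- 2 * d) * (modsq t h * b t h)) t
        = 2 * pi * (- (d^2) * \<alpha>^2) + d^2 * circ w t + (- 2 * d) * circ (\<lambda>t h. modsq t h * b t h) t"
      by (rule circ_affine[of far _ _ t "\<lambda>_. - (d^2) * \<alpha>^2" "\<lambda>_. d^2" "\<lambda>_. - 2 * d"]) (use tS in \<open>auto intro!: cyl_intros\<close>)
    finally have Keq: "stress t + 2 * pi * \<alpha>^2 * d^2 = circ ?X t + d^2 * circ w t + (2 * d) * circ (\<lambda>t h. w t h * b t h) t"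
      unfolding circ_modsq_b[OF tS] by simp
    have b1: "\<bar>circ ?X t\<bar> \<le> c * modulus_energy t + 1 * phase_energy t"
    proof -
      have "\<bar>circ ?X t\<bar> \<le> circ (\<lambda>t h. 0 + c * ((wt t h)^2 + (wh t h)^2) + 1 * (modsq t h * ((a t h)^2 + (b t h)^2))) t"
      proof (rule circ_abs_le[OF cX _ tS])
        fix h
        have "\<bar>((wt t h)^2 - (wh t h)^2) / (4 * modsq t h)\<bar> \<le> ((wt t h)^2 + (wh t h)^2) / (4 * modsq t h)"
          unfolding abs_divide using r[OF tS, of h] by (auto intro!: divide_right_mono simp: abs_le_iff)
        also have "\<dots> \<le> ((wt t h)^2 + (wh t h)^2) / (19 / 5 * \<alpha>^2)"
          using modsq_bounds(1)[OF tS, of h] al2 r[OF tS, of h] by (intro divide_left_mono) (auto simp: zero_less_mult_iff)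
        finally have 1: "\<bar>((wt t h)^2 - (wh t h)^2) / (4 * modsq t h)\<bar> \<le> c * ((wt t h)^2 + (wh t h)^2)"
          unfolding c_def by (simp only: mult.commute[of "1 / _"] times_divide_eq_right mult_1_right)
        have "\<bar>modsq t h * ((a t h)^2 - (b t h)^2)\<bar> = modsq t h * \<bar>(a t h)^2 - (b t h)^2\<bar>" using r[OF tS, of h] by (simp add: abs_mult)
        also have "\<dots> \<le> modsq t h * ((a t h)^2 + (b t h)^2)" using r[OF tS, of h] by (intro mult_left_mono) (auto simp: abs_le_iff)
        finally show "\<bar>?X t h\<bar> \<le> 0 + c * ((wt t h)^2 + (wh t h)^2) + 1 * (modsq t h * ((a t h)^2 + (b t h)^2))"
          using 1 by linarith
      qed (intro cyl_intros)
      also have "\<dots> = 2 * pi * 0 + c * modulus_energy t + 1 * phase_energy t" unfolding phase_energy_def modulus_energy_def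
        by (rule circ_affine[of far _ _ t "\<lambda>_. 0" "\<lambda>_. c" "\<lambda>_. 1"]) (use tS in \<open>auto intro!: cyl_intros\<close>)
      finally show ?thesis by simp
    qed
    have b2: "\<bar>d^2 * circ w t\<bar> \<le> d^2 * (pi * exp (- (2 * t)) + 1 / 2 * dens w t)"
    proof -
      have "\<bar>circ w t\<bar> \<le> circ (\<lambda>t h. \<bar>w t h\<bar>) t" by (rule circ_abs_le[of UNIV]) (auto intro!: cyl_intros)
      then have "\<bar>circ w t\<bar> \<le> pi * exp (- (2 * t)) + 1 / 2 * dens w t" using w_abs_le[OF t] by linarith
      then have "d^2 * \<bar>circ w t\<bar> \<le> d^2 * (pi * exp (- (2 * t)) + 1 / 2 * dens w t)" by (rule mult_left_mono) simp
      then show ?thesis by (simp only: abs_mult abs_power2)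
    qed
    have b3: "\<bar>(2 * d) * circ (\<lambda>t h. w t h * b t h) t\<bar> \<le> (2 * \<bar>d\<bar>) * (1 / (2 * (19 / 20 * \<alpha>^2)) * dens w t + 1 / 2 * phase_energy t)"
    proof -
      let ?c = "1 / (2 * (19 / 20 * \<alpha>^2))"
      have "\<bar>circ (\<lambda>t h. w t h * b t h) t\<bar> \<le> circ (\<lambda>t h. 0 + ?c * (w t h)^2 + 1 / 2 * (modsq t h * ((a t h)^2 + (b t h)^2))) t"
      proof (rule circ_abs_le[of far])
        fix h
        have "\<bar>b t h * w t h\<bar> \<le> (19 / 20 * \<alpha>^2) / 2 * (b t h)^2 + ?c * (w t h)^2"
          by (rule abs_mult_amgm) (use al2 in simp)
        also have "(19 / 20 * \<alpha>^2) / 2 * (b t h)^2 \<le> 1 / 2 * (modsq t h * (b t h)^2)"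
          using mult_right_mono[OF modsq_bounds(1)[OF tS, of h], of "(b t h)^2"] by simp
        also have "\<dots> \<le> 1 / 2 * (modsq t h * ((a t h)^2 + (b t h)^2))"
          using r[OF tS, of h] by (intro mult_left_mono) auto
        finally show "\<bar>w t h * b t h\<bar> \<le> 0 + ?c * (w t h)^2 + 1 / 2 * (modsq t h * ((a t h)^2 + (b t h)^2))"
          by (simp add: mult.commute)
      qed (intro cyl_intros tS)+
      also have "\<dots> = 2 * pi * 0 + ?c * circ (\<lambda>t h. (w t h)^2) t + 1 / 2 * phase_energy t" unfolding phase_energy_def
        by (rule circ_affine[of far _ _ t "\<lambda>_. 0" "\<lambda>_. ?c" "\<lambda>_. 1/2"]) (use tS in \<open>auto intro!: cyl_intros\<close>)
      also have "\<dots> \<le> ?c * dens w t + 1 / 2 * phase_energy t"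
        using mult_left_mono[OF circ_w2_le[OF t], of ?c] al2 by simp
      finally have "(2 * \<bar>d\<bar>) * \<bar>circ (\<lambda>t h. w t h * b t h) t\<bar> \<le> (2 * \<bar>d\<bar>) * (?c * dens w t + 1 / 2 * phase_energy t)"
        by (rule mult_left_mono) simp
      then show ?thesis by (simp only: abs_mult abs_numeral)
    qed
    have "\<bar>stress t + 2 * pi * \<alpha>^2 * d^2\<bar> \<le> k t"
      using b1 b2 b3 unfolding Keq k_def by linarith
    also have "\<dots> \<le> \<bar>k t\<bar>" by simp
    finally show "\<bar>stress t + 2 * pi * \<alpha>^2 * (real_of_int deg)^2\<bar> \<le> \<bar>k t\<bar>" unfolding d_def .
  qed
qed

end

section \<open>Polar coordinates in the plane\<close>

definition polar :: "real ^ 2 \<Rightarrow> real \<Rightarrow> real \<Rightarrow> real ^ 2" where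
  "polar c t h = c + (exp t * cos h) *\<^sub>R axis 1 1 + (exp t * sin h) *\<^sub>R axis 2 1"

lemma polar_nth: "polar c t h $ 1 = c $ 1 + exp t * cos h" "polar c t h $ 2 = c $ 2 + exp t * sin h"
  by (simp_all add: polar_def axis_def)

lemma polar_dist: "norm (polar c t h - c) = exp t"
proof -
  have "(norm (polar c t h - c))^2 = (exp t * cos h)^2 + (exp t * sin h)^2"
    unfolding power2_norm_eq_inner by (simp add: inner_vec_def sum_2 polar_nth power2_eq_square)
  also have "\<dots> = (exp t)^2 * ((cos h)^2 + (sin h)^2)" by (simp only: power_mult_distrib distrib_left)
  finally have "(norm (polar c t h - c))^2 = (exp t)^2 * ((cos h)^2 + (sin h)^2)" .
  then have "(norm (polar c t h - c))^2 = (exp t)^2" by simp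
  then show ?thesis by (simp add: power2_eq_iff_nonneg)
qed

lemma polar_continuous [continuous_intros]:
  fixes f g :: "'a::t2_space \<Rightarrow> real"
  shows "continuous_on A f \<Longrightarrow> continuous_on A g \<Longrightarrow> continuous_on A (\<lambda>x. polar c (f x) (g x))"
  unfolding polar_def by (auto intro!: continuous_intros)

lemma polar_periodic: "polar c t (h + 2 * pi) = polar c t h"
  by (simp add: polar_def)

lemma polar_cyl_cont: "continuous_on UNIV f \<Longrightarrow> cyl_cont UNIV (\<lambda>t h. f (polar c t h))"
  unfolding cyl_cont_def polar_periodic
  by (auto intro!: continuous_on_compose2[of UNIV f] continuous_intros)

lemma dir_deriv_chain:
  fixes f :: "real ^ 2 \<Rightarrow> real"
  assumes f: "f differentiable (at (polar c t h))"
  shows "((\<lambda>s. f (polar c s h)) has_real_derivative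
      exp t * cos h * dir_deriv f (axis 1 1) (polar c t h) + exp t * sin h * dir_deriv f (axis 2 1) (polar c t h)) (at t)"
    and "((\<lambda>k. f (polar c t k)) has_real_derivative
      - exp t * sin h * dir_deriv f (axis 1 1) (polar c t h) + exp t * cos h * dir_deriv f (axis 2 1) (polar c t h)) (at h)"
proof -
  let ?D = "frechet_derivative f (at (polar c t h))"
  have D: "(f has_derivative ?D) (at (polar c t h))" using f by (simp add: frechet_derivative_works)
  then have lin: "linear ?D" by (rule has_derivative_linear)
  have 1: "((\<lambda>s. polar c s h) has_vector_derivative (exp t * cos h) *\<^sub>R axis 1 1 + (exp t * sin h) *\<^sub>R axis 2 1) (at t)"
    unfolding polar_def
    by (auto intro!: derivative_eq_intros has_vector_derivative_scaleR simp: has_real_derivative_iff_has_vector_derivative[symmetric])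
  have 2: "((\<lambda>k. polar c t k) has_vector_derivative (- exp t * sin h) *\<^sub>R axis 1 1 + (exp t * cos h) *\<^sub>R axis 2 1) (at h)"
    unfolding polar_def
    by (auto intro!: derivative_eq_intros has_vector_derivative_scaleR simp: mult.commute has_real_derivative_iff_has_vector_derivative[symmetric])
  have L: "?D (x *\<^sub>R axis 1 1 + y *\<^sub>R axis 2 1) = x * dir_deriv f (axis 1 1) (polar c t h) + y * dir_deriv f (axis 2 1) (polar c t h)" for x y
    by (simp add: linear_add[OF lin] linear_scale[OF lin] dir_deriv_def)
  have "((f \<circ> (\<lambda>s. polar c s h)) has_vector_derivative ?D ((exp t * cos h) *\<^sub>R axis 1 1 + (exp t * sin h) *\<^sub>R axis 2 1)) (at t)"
    by (rule vector_derivative_diff_chain_within[OF 1]) (use D has_derivative_at_withinI in blast)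
  then show "((\<lambda>s. f (polar c s h)) has_real_derivative
      exp t * cos h * dir_deriv f (axis 1 1) (polar c t h) + exp t * sin h * dir_deriv f (axis 2 1) (polar c t h)) (at t)"
    unfolding L o_def has_real_derivative_iff_has_vector_derivative .
  have "((f \<circ> (\<lambda>k. polar c t k)) has_vector_derivative ?D ((- exp t * sin h) *\<^sub>R axis 1 1 + (exp t * cos h) *\<^sub>R axis 2 1)) (at h)"
    by (rule vector_derivative_diff_chain_within[OF 2]) (use D has_derivative_at_withinI in blast)
  then show "((\<lambda>k. f (polar c t k)) has_real_derivative
      - exp t * sin h * dir_deriv f (axis 1 1) (polar c t h) + exp t * cos h * dir_deriv f (axis 2 1) (polar c t h)) (at h)"
    unfolding L o_def has_real_derivative_iff_has_vector_derivative .
qed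

lemma cyl_exp_trig: "cyl k UNIV (\<lambda>t h. exp t * cos h)" "cyl k UNIV (\<lambda>t h. exp t * sin h)" "cyl k UNIV (\<lambda>t h. - exp t * sin h)"
proof -
  have "cos (h + pi / 2) = - sin h" "cos (h + - (pi / 2)) = sin h" for h
    using cos_add[of h "pi / 2"] cos_diff[of h "pi / 2"] by auto
  then show "cyl k UNIV (\<lambda>t h. exp t * cos h)" "cyl k UNIV (\<lambda>t h. exp t * sin h)" "cyl k UNIV (\<lambda>t h. - exp t * sin h)"
    using cyl_exp_cos[of k 1 0] cyl_exp_cos[of k 1 "- (pi / 2)"] cyl_exp_cos[of k 1 "pi / 2"] by auto
qed

lemma C_diff_continuous: "C_diff k f \<Longrightarrow> continuous_on UNIV f" for f :: "'a::euclidean_space \<Rightarrow> 'b::real_normed_vector"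
  by (cases k) (auto simp: continuous_on_eq_continuous_within differentiable_imp_continuous_within)

lemma C_diff_cyl: "C_diff k f \<Longrightarrow> cyl k UNIV (\<lambda>t h. f (polar c t h))" for f :: "real ^ 2 \<Rightarrow> real"
proof (induction k arbitrary: f)
  case 0
  then show ?case by (simp add: polar_cyl_cont)
next
  case (Suc k)
  have d: "f differentiable (at (polar c t h))" for t h using Suc.prems by simp
  have IH: "cyl k UNIV (\<lambda>t h. dir_deriv f v (polar c t h))" for v using Suc by simp
  show ?case
  proof (rule cyl_SucI[OF open_UNIV _ dir_deriv_chain(1)[OF d] dir_deriv_chain(2)[OF d]])
    show "cyl_cont UNIV (\<lambda>t h. f (polar c t h))" by (rule polar_cyl_cont[OF C_diff_continuous[OF Suc.prems]])
  qed (intro open_UNIV cyl_add cyl_mult cyl_exp_trig IH)+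
qed

lemma dt_polar: "f differentiable (at (polar c t h)) \<Longrightarrow> dt (\<lambda>t h. f (polar c t h)) t h =
    exp t * cos h * dir_deriv f (axis 1 1) (polar c t h) + exp t * sin h * dir_deriv f (axis 2 1) (polar c t h)"
  and dh_polar: "f differentiable (at (polar c t h)) \<Longrightarrow> dh (\<lambda>t h. f (polar c t h)) t h =
    - exp t * sin h * dir_deriv f (axis 1 1) (polar c t h) + exp t * cos h * dir_deriv f (axis 2 1) (polar c t h)"
  for f :: "real ^ 2 \<Rightarrow> real"
  unfolding dt_def dh_def by (intro DERIV_imp_deriv dir_deriv_chain; assumption)+

lemma Basis_2: "(Basis :: (real ^ 2) set) = {axis 1 1, axis 2 1}"
  by (auto simp: Basis_vec_def UNIV_2)

text \<open>The first order terms of the two second derivatives cancel, and so do the mixed ones.\<close>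

lemma laplacian_polar:
  fixes f :: "real ^ 2 \<Rightarrow> real"
  assumes f: "C_diff 2 f"
  shows "dt (dt (\<lambda>t h. f (polar c t h))) t h + dh (dh (\<lambda>t h. f (polar c t h))) t h = exp (2 * t) * laplacian f (polar c t h)"
proof -
  have d0: "f differentiable (at x)" and d1: "dir_deriv f v differentiable (at x)" for x v
    using f by (auto simp: numeral_2_eq_2)
  let ?u = "\<lambda>v. dir_deriv f v"
  let ?x = "axis 1 1 :: real ^ 2" let ?y = "axis 2 1 :: real ^ 2"
  let ?P = "polar c t h"
  have F: "dt (\<lambda>t h. f (polar c t h)) = (\<lambda>t h. exp t * cos h * ?u ?x (polar c t h) + exp t * sin h * ?u ?y (polar c t h))"
    "dh (\<lambda>t h. f (polar c t h)) = (\<lambda>t h. - exp t * sin h * ?u ?x (polar c t h) + exp t * cos h * ?u ?y (polar c t h))"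
    by (intro ext dt_polar dh_polar d0)+
  note E = dir_deriv_chain[OF d1, where c=c]
  have "((\<lambda>s. exp s * cos h * ?u ?x (polar c s h) + exp s * sin h * ?u ?y (polar c s h)) has_real_derivative
      exp t * cos h * ?u ?x ?P + exp t * sin h * ?u ?y ?P
      + exp t * cos h * (exp t * cos h * dir_deriv (?u ?x) ?x ?P + exp t * sin h * dir_deriv (?u ?x) ?y ?P)
      + exp t * sin h * (exp t * cos h * dir_deriv (?u ?y) ?x ?P + exp t * sin h * dir_deriv (?u ?y) ?y ?P)) (at t)"
    by (rule derivative_eq_intros E(1) refl | simp add: algebra_simps)+
  then have 1: "dt (dt (\<lambda>t h. f (polar c t h))) t h = 
      exp t * cos h * ?u ?x ?P + exp t * sin h * ?u ?y ?P
      + exp t * cos h * (exp t * cos h * dir_deriv (?u ?x) ?x ?P + exp t * sin h * dir_deriv (?u ?x) ?y ?P)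
      + exp t * sin h * (exp t * cos h * dir_deriv (?u ?y) ?x ?P + exp t * sin h * dir_deriv (?u ?y) ?y ?P)"
    unfolding F unfolding dt_def by (rule DERIV_imp_deriv)
  have "((\<lambda>k. - exp t * sin k * ?u ?x (polar c t k) + exp t * cos k * ?u ?y (polar c t k)) has_real_derivative
      - exp t * cos h * ?u ?x ?P - exp t * sin h * ?u ?y ?P
      + - exp t * sin h * (- exp t * sin h * dir_deriv (?u ?x) ?x ?P + exp t * cos h * dir_deriv (?u ?x) ?y ?P)
      + exp t * cos h * (- exp t * sin h * dir_deriv (?u ?y) ?x ?P + exp t * cos h * dir_deriv (?u ?y) ?y ?P)) (at h)"
    by (rule derivative_eq_intros E(2) refl | simp add: algebra_simps)+
  then have 2: "dh (dh (\<lambda>t h. f (polar c t h))) t h = 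
      - exp t * cos h * ?u ?x ?P - exp t * sin h * ?u ?y ?P
      + - exp t * sin h * (- exp t * sin h * dir_deriv (?u ?x) ?x ?P + exp t * cos h * dir_deriv (?u ?x) ?y ?P)
      + exp t * cos h * (- exp t * sin h * dir_deriv (?u ?y) ?x ?P + exp t * cos h * dir_deriv (?u ?y) ?y ?P)"
    unfolding F unfolding dh_def by (rule DERIV_imp_deriv)
  have cs: "(cos h)^2 + (sin h)^2 = 1" by simp
  have "dt (dt (\<lambda>t h. f (polar c t h))) t h + dh (dh (\<lambda>t h. f (polar c t h))) t h
     = (exp t)^2 * ((cos h)^2 + (sin h)^2) * (dir_deriv (?u ?x) ?x ?P + dir_deriv (?u ?y) ?y ?P)"
    unfolding 1 2 by algebra
  moreover have "laplacian f ?P = dir_deriv (?u ?x) ?x ?P + dir_deriv (?u ?y) ?y ?P"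
    by (simp add: laplacian_def Basis_2 axis_eq_axis)
  moreover have "(exp t)^2 = exp (2 * t)" by (simp add: power2_eq_square exp_add[symmetric])
  ultimately show ?thesis unfolding cs by simp
qed

lemma polar_bounds:
  fixes f :: "real ^ 2 \<Rightarrow> real"
  assumes f: "C_diff 1 f"
  shows "\<exists>C. \<forall>t\<le>0. \<forall>h. \<bar>f (polar c t h)\<bar> \<le> C \<and> \<bar>dt (\<lambda>t h. f (polar c t h)) t h\<bar> \<le> C * exp t
     \<and> \<bar>dh (\<lambda>t h. f (polar c t h)) t h\<bar> \<le> C * exp t"
proof -
  have d0: "f differentiable (at x)" for x using f by simp
  have bd: "\<exists>C. \<forall>x\<in>cball c 1. \<bar>g x\<bar> \<le> C" if "continuous_on UNIV g" for g :: "real ^ 2 \<Rightarrow> real"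
  proof -
    have "compact (g ` cball c 1)" by (rule compact_continuous_image) (use that in \<open>auto elim: continuous_on_subset\<close>)
    then show ?thesis using compact_imp_bounded bounded_iff by (metis imageI real_norm_def)
  qed
  obtain C0 where C0: "\<And>x. x \<in> cball c 1 \<Longrightarrow> \<bar>f x\<bar> \<le> C0" using bd[OF C_diff_continuous[OF f]] by blast
  obtain C1 where C1: "\<And>x. x \<in> cball c 1 \<Longrightarrow> \<bar>dir_deriv f (axis 1 1) x\<bar> \<le> C1" using bd f by fastforce
  obtain C2 where C2: "\<And>x. x \<in> cball c 1 \<Longrightarrow> \<bar>dir_deriv f (axis 2 1) x\<bar> \<le> C2" using bd f by fastforce
  define C where "C = max C0 (C1 + C2)"
  have "\<bar>f (polar c t h)\<bar> \<le> C \<and> \<bar>dt (\<lambda>t h. f (polar c t h)) t h\<bar> \<le> C * exp t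
     \<and> \<bar>dh (\<lambda>t h. f (polar c t h)) t h\<bar> \<le> C * exp t" if t: "t \<le> 0" for t h
  proof (intro conjI)
    have P: "polar c t h \<in> cball c 1" using polar_dist[of c t h] t by (simp add: dist_norm norm_minus_commute)
    show "\<bar>f (polar c t h)\<bar> \<le> C" using C0[OF P] by (simp add: C_def)
    have 1: "\<bar>cos h * dir_deriv f (axis 1 1) (polar c t h)\<bar> \<le> 1 * C1"
      unfolding abs_mult by (rule mult_mono) (use C1[OF P] in auto)
    have 2: "\<bar>sin h * dir_deriv f (axis 2 1) (polar c t h)\<bar> \<le> 1 * C2"
      unfolding abs_mult by (rule mult_mono) (use C2[OF P] in auto)
    have "dt (\<lambda>t h. f (polar c t h)) t h = exp t * (cos h * dir_deriv f (axis 1 1) (polar c t h) + sin h * dir_deriv f (axis 2 1) (polar c t h))"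
      unfolding dt_polar[OF d0] by (simp add: algebra_simps)
    then have "\<bar>dt (\<lambda>t h. f (polar c t h)) t h\<bar> = exp t * \<bar>cos h * dir_deriv f (axis 1 1) (polar c t h) + sin h * dir_deriv f (axis 2 1) (polar c t h)\<bar>"
      by (simp add: abs_mult)
    also have "\<dots> \<le> exp t * C"
      using 1 2 unfolding C_def by (intro mult_left_mono) auto
    finally show "\<bar>dt (\<lambda>t h. f (polar c t h)) t h\<bar> \<le> C * exp t" by (simp add: mult.commute)
    have 1: "\<bar>sin h * dir_deriv f (axis 1 1) (polar c t h)\<bar> \<le> 1 * C1"
      unfolding abs_mult by (rule mult_mono) (use C1[OF P] in auto)
    have 2: "\<bar>cos h * dir_deriv f (axis 2 1) (polar c t h)\<bar> \<le> 1 * C2"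
      unfolding abs_mult by (rule mult_mono) (use C2[OF P] in auto)
    have "dh (\<lambda>t h. f (polar c t h)) t h = exp t * (cos h * dir_deriv f (axis 2 1) (polar c t h) - sin h * dir_deriv f (axis 1 1) (polar c t h))"
      unfolding dh_polar[OF d0] by (simp add: algebra_simps)
    then have "\<bar>dh (\<lambda>t h. f (polar c t h)) t h\<bar> = exp t * \<bar>cos h * dir_deriv f (axis 2 1) (polar c t h) - sin h * dir_deriv f (axis 1 1) (polar c t h)\<bar>"
      by (simp add: abs_mult)
    also have "\<dots> \<le> exp t * C"
      using 1 2 unfolding C_def by (intro mult_left_mono) auto
    finally show "\<bar>dh (\<lambda>t h. f (polar c t h)) t h\<bar> \<le> C * exp t" by (simp add: mult.commute)
  qed
  then show ?thesis by blast
qed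

lemma circ_polar_limit:
  fixes f :: "real ^ 2 \<Rightarrow> real"
  assumes f: "continuous_on UNIV f"
  shows "(circ (\<lambda>t h. f (polar c t h)) \<longlongrightarrow> 2 * pi * f c) at_bot"
proof (rule tendstoI)
  fix e :: real assume e: "e > 0"
  have "isCont f c" using f by (simp add: continuous_on_eq_continuous_at)
  then obtain d where d: "d > 0" "\<And>x. dist x c < d \<Longrightarrow> dist (f x) (f c) < e / 8"
    using e unfolding continuous_at_eps_delta by (metis zero_less_divide_iff zero_less_numeral)
  have "dist (circ (\<lambda>t h. f (polar c t h)) t) (2 * pi * f c) < e" if t: "t < ln d" for t
  proof -
    have "exp t < d" using t d(1) by (metis exp_less_cancel_iff exp_ln)
    then have pd: "\<bar>f (polar c t h) - f c\<bar> \<le> e / 8" for h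
      using d(2)[of "polar c t h"] polar_dist[of c t h] by (simp add: dist_norm less_imp_le)
    have cc: "cyl_cont UNIV (\<lambda>t h. f (polar c t h))" by (rule polar_cyl_cont[OF f])
    have "circ (\<lambda>t h. f (polar c t h) - f c) t = circ (\<lambda>t h. f (polar c t h)) t - circ (\<lambda>t h. f c) t"
      by (rule circ_diff[of UNIV]) (use cc in \<open>auto intro!: cyl_intros\<close>)
    moreover have "circ (\<lambda>t h. f c) t = 2 * pi * f c" by (rule circ_const)
    moreover have "\<bar>circ (\<lambda>t h. f (polar c t h) - f c) t\<bar> \<le> circ (\<lambda>t h. e / 8) t"
      by (rule circ_abs_le[of UNIV]) (use cc pd in \<open>auto intro!: cyl_intros\<close>)
    moreover have "circ (\<lambda>t h. e / 8) t = 2 * pi * (e / 8)" by (rule circ_const)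
    moreover have "2 * pi * (e / 8) < e" using pi_less_4 e by (simp add: field_simps)
    ultimately show ?thesis by (simp add: dist_real_def)
  qed
  then show "\<forall>\<^sub>F t in at_bot. dist (circ (\<lambda>t h. f (polar c t h)) t) (2 * pi * f c) < e"
    unfolding eventually_at_bot_dense by blast
qed

definition annulus :: "real ^ 2 \<Rightarrow> real \<Rightarrow> real \<Rightarrow> (real ^ 2) set" where
  "annulus c S T = {x. exp S \<le> norm (x - c) \<and> norm (x - c) \<le> exp T}"

text \<open>Vectors with two entries and pairs carry the same integral; on pairs it can be iterated.\<close>

lemma has_integral_vec2:
  fixes F :: "real \<times> real \<Rightarrow> real"
  assumes "(F has_integral i) (cbox (a, b) (c, d))"
  shows "((\<lambda>y. F (y $ 1, y $ 2)) has_integral i) (cbox (vector [a, b]) (vector [c, d]) :: (real ^ 2) set)"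
proof -
  let ?g = "\<lambda>y :: real ^ 2. (y $ 1, y $ 2)"
  let ?h = "\<lambda>z :: real \<times> real. vector [fst z, snd z] :: real ^ 2"
  have gh: "?g (?h z) = z" for z by simp
  have hg: "?h (?g y) = y" for y by (simp add: vec_eq_iff forall_2)
  have gi: "?g ` cbox u v = cbox (?g u) (?g v)" for u v
  proof (intro equalityI subsetI)
    fix z assume "z \<in> cbox (?g u) (?g v)"
    then have "?h z \<in> cbox u v" by (auto simp: mem_box_cart forall_2 cbox_Pair_eq)
    then show "z \<in> ?g ` cbox u v" using imageI[of "?h z" "cbox u v" ?g] by simp
  qed (auto simp: mem_box_cart cbox_Pair_eq)
  have hi: "?h ` cbox u v = cbox (?h u) (?h v)" for u v
  proof (intro equalityI subsetI)
    fix y assume "y \<in> cbox (?h u) (?h v)"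
    then have "?g y \<in> cbox u v" by (cases u; cases v) (auto simp: mem_box_cart forall_2 cbox_Pair_eq)
    then show "y \<in> ?h ` cbox u v" using imageI[of "?g y" "cbox u v" ?h] hg by simp
  next
    fix y assume "y \<in> ?h ` cbox u v"
    then show "y \<in> cbox (?h u) (?h v)" by (cases u; cases v) (auto simp: mem_box_cart forall_2 cbox_Pair_eq)
  qed
  have "((\<lambda>y. F (?g y)) has_integral (1 / 1) *\<^sub>R i) (?h ` cbox (a, b) (c, d))"
  proof (rule has_integral_twiddle[OF _ _ _ _ _ _ _ assms])
    show "?h (?g y) = y" "?g (?h z) = z" for y z by (rule hg, rule gh)
    show "continuous (at y) ?g" for y by (intro continuous_intros)
    show "\<exists>w z. ?g ` cbox u v = cbox w z" for u v using gi by blast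
    show "\<exists>w z. ?h ` cbox u v = cbox w z" for u v using hi by blast
    show "measure lborel (?g ` cbox u v) = 1 * measure lborel (cbox u v)" for u v
    proof (cases "cbox u v = {}")
      case False
      then have "u $ 1 \<le> v $ 1" "u $ 2 \<le> v $ 2" by (auto simp: interval_eq_empty_cart not_less)
      then show ?thesis unfolding gi content_cbox_cart[OF False]
        by (simp add: content_Pair UNIV_2)
    qed simp
  qed simp
  then show ?thesis unfolding hi by simp
qed

lemma polar_has_derivative:
  "((\<lambda>y. polar c (y $ 1) (y $ 2)) has_derivative
     (\<lambda>v. (exp (y $ 1) * cos (y $ 2) * v $ 1 - exp (y $ 1) * sin (y $ 2) * v $ 2) *\<^sub>R axis 1 1
        + (exp (y $ 1) * sin (y $ 2) * v $ 1 + exp (y $ 1) * cos (y $ 2) * v $ 2) *\<^sub>R axis 2 1)) (at y within A)"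
  unfolding polar_def
  by (rule derivative_eq_intros bounded_linear.has_derivative[OF bounded_linear_vec_nth] refl | simp add: algebra_simps)+

lemma polar_inj:
  assumes "polar c t h = polar c t' h'" "0 \<le> h" "h < 2 * pi" "0 \<le> h'" "h' < 2 * pi"
  shows "t = t' \<and> h = h'"
proof -
  have t: "t = t'" using polar_dist[of c t h] polar_dist[of c t' h'] assms(1) by simp
  have "cos h = cos h'" "sin h = sin h'"
    using polar_nth[of c t h] polar_nth[of c t' h'] assms(1) t by auto
  then obtain n :: int where n: "h = h' + 2 * pi * n" using sin_cos_eq_iff by metis
  have "\<bar>2 * pi * n\<bar> < 2 * pi" using n assms by linarith
  then have "\<bar>real_of_int n\<bar> < 1" by (simp add: abs_mult)
  then have "n = 0" by linarith
  with n t show ?thesis by simp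
qed

lemma polar_image: "(\<lambda>y :: real ^ 2. polar c (y $ 1) (y $ 2)) ` {y. S \<le> y $ 1 \<and> y $ 1 \<le> T \<and> 0 \<le> y $ 2 \<and> y $ 2 < 2 * pi} = annulus c S T"
proof (intro equalityI subsetI)
  fix x assume x: "x \<in> annulus c S T"
  define r where "r = norm (x - c)"
  have r: "exp S \<le> r" "r \<le> exp T" using x by (auto simp: annulus_def r_def)
  have r0: "r > 0" using r(1) exp_gt_zero[of S] by linarith
  have "r^2 = ((x - c) $ 1)^2 + ((x - c) $ 2)^2"
    unfolding r_def power2_norm_eq_inner by (simp add: inner_vec_def sum_2 power2_eq_square)
  then have "((x - c) $ 1 / r)^2 + ((x - c) $ 2 / r)^2 = r^2 / r^2" by (simp only: power_divide add_divide_distrib)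
  then have "((x - c) $ 1 / r)^2 + ((x - c) $ 2 / r)^2 = 1" using r0 by simp
  then obtain h where h: "0 \<le> h" "h < 2 * pi" "(x - c) $ 1 / r = cos h" "(x - c) $ 2 / r = sin h" using sincos_total_2pi by blast
  have e: "exp (ln r) = r" using r0 by simp
  have "polar c (ln r) h = x"
    unfolding vec_eq_iff forall_2 polar_nth e using h(3,4) r0 by (auto simp: field_simps)
  moreover have "S \<le> ln r" "ln r \<le> T" using r r0 by (auto simp: ln_ge_iff) (metis ln_exp ln_le_cancel_iff exp_gt_zero)
  ultimately show "x \<in> (\<lambda>y :: real ^ 2. polar c (y $ 1) (y $ 2)) ` {y. S \<le> y $ 1 \<and> y $ 1 \<le> T \<and> 0 \<le> y $ 2 \<and> y $ 2 < 2 * pi}"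
    using h by (intro image_eqI[of _ _ "vector [ln r, h]"]) auto
qed (auto simp: annulus_def polar_dist)

text \<open>Change of variables with Jacobian \<open>exp (2 t)\<close>. The half-open angular range makes the map a
  bijection onto the annulus; the closed box differs from it by a null set.\<close>

lemma polar_integral:
  fixes f :: "real ^ 2 \<Rightarrow> real"
  assumes f: "continuous_on UNIV f" and nn: "\<And>x. f x \<ge> 0" and ST: "S \<le> T"
  shows "(\<integral>\<^sup>+ x. ennreal (f x) * indicator (annulus c S T) x \<partial>lborel)
    = ennreal (integral {S..T} (\<lambda>t. exp (2 * t) * circ (\<lambda>t h. f (polar c t h)) t))"
proof -
  define D where "D = {y :: real ^ 2. S \<le> y $ 1 \<and> y $ 1 \<le> T \<and> 0 \<le> y $ 2 \<and> y $ 2 < 2 * pi}"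
  define F where "F = (\<lambda>z :: real \<times> real. exp (2 * fst z) * f (polar c (fst z) (snd z)))"
  define I where "I = integral {S..T} (\<lambda>t. exp (2 * t) * circ (\<lambda>t h. f (polar c t h)) t)"
  have cF: "continuous_on A F" for A
    unfolding F_def by (intro continuous_intros continuous_on_compose2[OF f]) auto
  have "(F has_integral integral (cbox (S, 0) (T, 2 * pi)) F) (cbox (S, 0) (T, 2 * pi))"
    by (intro integrable_integral integrable_continuous cF)
  also have "integral (cbox (S, 0) (T, 2 * pi)) F = integral {S..T} (\<lambda>t. integral {0..2*pi} (\<lambda>h. F (t, h)))"
    using integral_prod_continuous[OF cF, of "(S)" 0 T "2*pi"] by simp
  also have "\<dots> = I" unfolding I_def F_def circ_def by simp
  finally have "(F has_integral I) (cbox (S, 0) (T, 2 * pi))" .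
  from has_integral_vec2[OF this]
  have 1: "((\<lambda>y. F (y $ 1, y $ 2)) has_integral I) (cbox (vector [S, 0]) (vector [T, 2 * pi]) :: (real ^ 2) set)" .
  have DF: "((\<lambda>y. F (y $ 1, y $ 2)) has_integral I) D"
  proof (rule has_integral_spike_set_eq[THEN iffD1, OF _ _ 1])
    have "negligible {y :: real ^ 2. y $ 2 = 2 * pi}"
    proof -
      have "negligible {y :: real ^ 2. (axis 2 1) \<bullet> y = 2 * pi}" by (rule negligible_hyperplane) simp
      then show ?thesis by (simp add: inner_axis inner_commute)
    qed
    then show "negligible {x \<in> cbox (vector [S, 0]) (vector [T, 2 * pi]) - D. F (x $ 1, x $ 2) \<noteq> 0}"
      by (rule negligible_subset) (auto simp: mem_box_cart forall_2 D_def)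
    show "negligible {x \<in> D - cbox (vector [S, 0]) (vector [T, 2 * pi]). F (x $ 1, x $ 2) \<noteq> 0}"
      by (rule negligible_subset[of "{}"]) (auto simp: mem_box_cart forall_2 D_def)
  qed
  let ?g = "\<lambda>y :: real ^ 2. polar c (y $ 1) (y $ 2)"
  let ?g' = "\<lambda>y v. (exp (y $ 1) * cos (y $ 2) * v $ 1 - exp (y $ 1) * sin (y $ 2) * v $ 2) *\<^sub>R axis 1 1
        + (exp (y $ 1) * sin (y $ 2) * v $ 1 + exp (y $ 1) * cos (y $ 2) * v $ 2) *\<^sub>R axis 2 1 :: real ^ 2"
  let ?f = "\<lambda>x. vec (f x) :: real ^ 1"
  have Dm: "D \<in> sets lebesgue"
  proof -
    have "D = {y. S \<le> y $ 1} \<inter> {y. y $ 1 \<le> T} \<inter> {y. 0 \<le> y $ 2} \<inter> {y. y $ 2 < 2 * pi}" unfolding D_def by auto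
    moreover have "{y :: real ^ 2. S \<le> y $ 1} \<in> sets borel" "{y :: real ^ 2. y $ 1 \<le> T} \<in> sets borel"
      "{y :: real ^ 2. 0 \<le> y $ 2} \<in> sets borel" "{y :: real ^ 2. y $ 2 < 2 * pi} \<in> sets borel"
      by (intro borel_closed borel_open closed_Collect_le open_Collect_less continuous_intros)+
    ultimately have "D \<in> sets borel" by auto
    then show ?thesis by simp
  qed
  have det: "\<bar>det (matrix (?g' y))\<bar> = exp (2 * y $ 1)" for y :: "real ^ 2"
  proof -
    have cs: "(cos (y $ 2))^2 + (sin (y $ 2))^2 = 1" by simp
    have "det (matrix (?g' y)) = exp (y $ 1) * cos (y $ 2) * (exp (y $ 1) * cos (y $ 2)) + exp (y $ 1) * sin (y $ 2) * (exp (y $ 1) * sin (y $ 2))"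
      by (simp add: det_2 matrix_def axis_def)
    also have "\<dots> = (exp (y $ 1))^2 * ((cos (y $ 2))^2 + (sin (y $ 2))^2)" by algebra
    finally show ?thesis unfolding cs by (simp add: power2_eq_square exp_add[symmetric])
  qed
  have "(\<lambda>x. \<bar>det (matrix (?g' x))\<bar> *\<^sub>R ?f (?g x)) absolutely_integrable_on D \<and>
           integral D (\<lambda>x. \<bar>det (matrix (?g' x))\<bar> *\<^sub>R ?f (?g x)) = vec I"
  proof
    have "(\<lambda>y. F (y $ 1, y $ 2)) absolutely_integrable_on D"
      by (rule nonnegative_absolutely_integrable_1) (use DF nn in \<open>auto simp: F_def\<close>)
    then show "(\<lambda>x. \<bar>det (matrix (?g' x))\<bar> *\<^sub>R ?f (?g x)) absolutely_integrable_on D"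
      unfolding absolutely_integrable_on_1_iff det by (simp add: F_def)
    show "integral D (\<lambda>x. \<bar>det (matrix (?g' x))\<bar> *\<^sub>R ?f (?g x)) = vec I"
      using integral_unique[OF DF] unfolding integral_on_1_eq det by (simp add: F_def)
  qed
  then have "?f absolutely_integrable_on (?g ` D) \<and> integral (?g ` D) ?f = vec I"
  proof (rule has_absolute_integral_change_of_variables[THEN iffD1, rotated -1])
    show "(?g has_derivative ?g' x) (at x within D)" for x by (rule polar_has_derivative)
    show "inj_on ?g D"
    proof (rule inj_onI)
      fix x y assume "x \<in> D" "y \<in> D" "?g x = ?g y"
      then have "x $ 1 = y $ 1 \<and> x $ 2 = y $ 2" by (intro polar_inj) (auto simp: D_def)
      then show "x = y" by (simp add: vec_eq_iff forall_2)
    qed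
  qed (rule Dm)
  moreover have "?g ` D = annulus c S T" unfolding D_def by (rule polar_image)
  ultimately have "f absolutely_integrable_on (annulus c S T)" "integral (annulus c S T) f = I"
    unfolding absolutely_integrable_on_1_iff integral_on_1_eq by (auto simp: vec_eq_iff)
  then have "(f has_integral I) (annulus c S T)"
    using set_lebesgue_integral_eq_integral(1) integrable_integral by blast
  from nn_integral_has_integral_lebesgue'[OF nn this] show ?thesis unfolding I_def .
qed

section \<open>Pohozaev identity and quantization\<close>

lemma dir_deriv_bounded_linear:
  assumes L: "bounded_linear L" and f: "f differentiable (at x)"
  shows "(\<lambda>x. L (f x)) differentiable (at x)"
    and "dir_deriv (\<lambda>x. L (f x)) v x = L (dir_deriv f v x)"
proof -
  have "(f has_derivative frechet_derivative f (at x)) (at x)" using f by (simp add: frechet_derivative_works)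
  then have D: "((\<lambda>x. L (f x)) has_derivative (\<lambda>v. L (frechet_derivative f (at x) v))) (at x)"
    by (rule bounded_linear.has_derivative[OF L])
  then show "(\<lambda>x. L (f x)) differentiable (at x)" by (rule differentiableI)
  show "dir_deriv (\<lambda>x. L (f x)) v x = L (dir_deriv f v x)"
    using frechet_derivative_at[OF D] by (simp add: dir_deriv_def) metis
qed

lemma C_diff_bounded_linear:
  assumes L: "bounded_linear L"
  shows "C_diff k f \<Longrightarrow> C_diff k (\<lambda>x. L (f x))"
proof (induction k arbitrary: f)
  case 0
  then show ?case using L by (auto intro: bounded_linear.continuous_on)
next
  case (Suc k)
  have "dir_deriv (\<lambda>x. L (f x)) v = (\<lambda>x. L (dir_deriv f v x))" for v
    by (intro ext dir_deriv_bounded_linear(2)[OF L]) (use Suc.prems in auto)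
  moreover have "(\<lambda>x. L (f x)) differentiable (at x)" for x
    by (rule dir_deriv_bounded_linear(1)[OF L]) (use Suc.prems in auto)
  ultimately show ?case using Suc by auto
qed

lemma laplacian_bounded_linear:
  assumes L: "bounded_linear L" and f: "C_diff 2 f"
  shows "laplacian (\<lambda>x. L (f x)) x = L (laplacian f x)"
proof -
  have d: "f differentiable (at x)" "dir_deriv f v differentiable (at x)" for x v
    using f by (auto simp: numeral_2_eq_2)
  have 1: "dir_deriv (\<lambda>x. L (f x)) v = (\<lambda>x. L (dir_deriv f v x))" for v
    by (intro ext dir_deriv_bounded_linear(2)[OF L] d(1))
  show ?thesis unfolding laplacian_def 1
    by (simp add: dir_deriv_bounded_linear(2)[OF L d(2)] linear_sum[OF bounded_linear.linear[OF L]])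
qed

text \<open>The measure with density \<open>f\<close> is finite, and unit discs with far centres lie in sets that
  decrease to the empty set.\<close>

lemma tail_small:
  fixes f :: "real ^ 2 \<Rightarrow> real"
  assumes f: "continuous_on UNIV f" and fin: "(\<integral>\<^sup>+ x. ennreal (f x) \<partial>lborel) < \<infinity>" and e: "e > 0"
  shows "\<exists>R. \<forall>c. norm c > R \<longrightarrow> (\<integral>\<^sup>+ x. ennreal (f x) * indicator (cball c 1) x \<partial>lborel) \<le> ennreal e"
proof -
  have [measurable]: "f \<in> borel_measurable borel" using f by (rule borel_measurable_continuous_onI)
  define M where "M = density lborel (\<lambda>x. ennreal (f x))"
  define A where "A k = {x :: real ^ 2. real k \<le> norm x}" for k
  have Am [measurable]: "A k \<in> sets borel" for k unfolding A_def by measurable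
  have em: "emeasure M B = (\<integral>\<^sup>+ x. ennreal (f x) * indicator B x \<partial>lborel)" if "B \<in> sets borel" for B
    unfolding M_def using that by (intro emeasure_density) auto
  have fin': "emeasure M B \<noteq> \<infinity>" if "B \<in> sets borel" for B
  proof -
    have "emeasure M B \<le> (\<integral>\<^sup>+ x. ennreal (f x) \<partial>lborel)"
      unfolding em[OF that] by (intro nn_integral_mono) (auto simp: indicator_def)
    with fin show ?thesis by (auto simp: top_unique)
  qed
  have "(\<lambda>k. emeasure M (A k)) \<longlonglongrightarrow> emeasure M (\<Inter>k. A k)"
  proof (rule Lim_emeasure_decseq)
    show "decseq A" unfolding A_def decseq_def by (auto intro: order_trans)
  qed (use fin' in \<open>auto simp: M_def\<close>)
  also have "(\<Inter>k. A k) = {}"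
  proof -
    have "x \<notin> (\<Inter>k. A k)" for x
    proof -
      obtain k :: nat where "norm x < real k" using reals_Archimedean2 by blast
      then show ?thesis unfolding A_def by (auto intro!: exI[of _ k])
    qed
    then show ?thesis by blast
  qed
  finally have "(\<lambda>k. emeasure M (A k)) \<longlonglongrightarrow> 0" by simp
  then have "\<forall>\<^sub>F k in sequentially. emeasure M (A k) < ennreal e" using e by (intro order_tendstoD) auto
  then obtain k where k: "emeasure M (A k) < ennreal e" by (auto simp: eventually_sequentially)
  have "(\<integral>\<^sup>+ x. ennreal (f x) * indicator (cball c 1) x \<partial>lborel) \<le> ennreal e" if c: "norm c > real k + 1" for c
  proof -
    have "cball c 1 \<subseteq> A k"
    proof
      fix x assume "x \<in> cball c 1"
      then have "norm (c - x) \<le> 1" by (simp add: dist_norm)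
      moreover have "norm c \<le> norm (c - x) + norm x" using norm_triangle_ineq[of "c - x" x] by simp
      ultimately show "x \<in> A k" using c by (simp add: A_def)
    qed
    then have "(\<integral>\<^sup>+ x. ennreal (f x) * indicator (cball c 1) x \<partial>lborel) \<le> emeasure M (A k)"
      unfolding em[OF Am] by (intro nn_integral_mono mult_left_mono) (auto simp: indicator_def)
    with k show ?thesis by simp
  qed
  then show ?thesis by blast
qed

lemma polar_integral_le:
  fixes f :: "real ^ 2 \<Rightarrow> real"
  assumes "continuous_on UNIV f" "\<And>x. f x \<ge> 0" "S \<le> T" "annulus c S T \<subseteq> B"
    and "(\<integral>\<^sup>+ x. ennreal (f x) * indicator B x \<partial>lborel) \<le> ennreal e" "e \<ge> 0"
  shows "integral {S..T} (\<lambda>t. exp (2 * t) * circ (\<lambda>t h. f (polar c t h)) t) \<le> e"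
proof -
  have "ennreal (integral {S..T} (\<lambda>t. exp (2 * t) * circ (\<lambda>t h. f (polar c t h)) t))
      = (\<integral>\<^sup>+ x. ennreal (f x) * indicator (annulus c S T) x \<partial>lborel)"
    using polar_integral[OF assms(1-3)] by simp
  also have "\<dots> \<le> (\<integral>\<^sup>+ x. ennreal (f x) * indicator B x \<partial>lborel)"
    using assms(4) by (intro nn_integral_mono mult_left_mono) (auto simp: indicator_def)
  also have "\<dots> \<le> ennreal e" by fact
  finally show ?thesis using assms(6) by (simp add: ennreal_le_iff)
qed

lemma polar_integral_tendsto:
  fixes f :: "real ^ 2 \<Rightarrow> real"
  assumes f: "continuous_on UNIV f" and nn: "\<And>x. f x \<ge> 0" and fin: "(\<integral>\<^sup>+ x. ennreal (f x) \<partial>lborel) = ennreal E" "E \<ge> 0"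
  shows "(\<lambda>k. integral {- real k..real k} (\<lambda>t. exp (2 * t) * circ (\<lambda>t h. f (polar c t h)) t)) \<longlonglongrightarrow> E"
proof -
  have [measurable]: "f \<in> borel_measurable borel" using f by (rule borel_measurable_continuous_onI)
  let ?A = "\<lambda>k. annulus c (- real k) (real k)"
  let ?I = "\<lambda>k. integral {- real k..real k} (\<lambda>t. exp (2 * t) * circ (\<lambda>t h. f (polar c t h)) t)"
  have Am [measurable]: "annulus c S T \<in> sets borel" for S T unfolding annulus_def by measurable
  have cc: "cyl_cont UNIV (\<lambda>t h. f (polar c t h))" by (rule polar_cyl_cont[OF f])
  have I0: "?I k \<ge> 0" for k
  proof (rule Henstock_Kurzweil_Integration.integral_nonneg)
    show "(\<lambda>t. exp (2 * t) * circ (\<lambda>t h. f (polar c t h)) t) integrable_on {- real k..real k}"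
      by (intro integrable_continuous_real continuous_intros continuous_on_subset[OF circ_continuous[OF cc]]) auto
    show "0 \<le> exp (2 * t) * circ (\<lambda>t h. f (polar c t h)) t" for t
      by (intro mult_nonneg_nonneg circ_nonneg[OF cc]) (use nn in auto)
  qed
  have inc: "incseq (\<lambda>k x. ennreal (f x) * indicator (?A k) x)"
  proof (rule incseq_SucI, rule le_funI, rule mult_left_mono)
    fix k x
    have "?A k \<subseteq> ?A (Suc k)" unfolding annulus_def
      by (auto elim!: order_trans[rotated] intro: order_trans)
    then show "(indicator (?A k) x :: ennreal) \<le> indicator (?A (Suc k)) x" by (auto simp: indicator_def)
  qed simp
  have "(\<lambda>k. \<integral>\<^sup>+ x. ennreal (f x) * indicator (?A k) x \<partial>lborel) \<longlonglongrightarrow> (\<integral>\<^sup>+ x. (SUP k. ennreal (f x) * indicator (?A k) x) \<partial>lborel)"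
  proof (subst nn_integral_monotone_convergence_SUP[OF inc])
    show "(\<lambda>k. \<integral>\<^sup>+ x. ennreal (f x) * indicator (?A k) x \<partial>lborel) \<longlonglongrightarrow> (SUP k. \<integral>\<^sup>+ x. ennreal (f x) * indicator (?A k) x \<partial>lborel)"
      by (rule LIMSEQ_SUP) (use inc in \<open>auto simp: incseq_def le_fun_def intro!: nn_integral_mono\<close>)
  qed measurable
  also have "(\<integral>\<^sup>+ x. (SUP k. ennreal (f x) * indicator (?A k) x) \<partial>lborel) = (\<integral>\<^sup>+ x. ennreal (f x) \<partial>lborel)"
  proof (rule nn_integral_cong_AE)
    have "AE x in lborel. x \<noteq> c" by (rule AE_lborel_singleton)
    then show "AE x in lborel. (SUP k. ennreal (f x) * indicator (?A k) x) = ennreal (f x)"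
    proof eventually_elim
      case (elim x)
      define r where "r = norm (x - c)"
      have r: "r > 0" using elim by (simp add: r_def)
      obtain k :: nat where k: "\<bar>ln r\<bar> < real k" using reals_Archimedean2 by blast
      have er: "exp (ln r) = r" using r by simp
      have "exp (- real k) \<le> r" "r \<le> exp (real k)" by (subst er[symmetric], use k in simp)+
      then have "x \<in> ?A k" by (simp add: annulus_def r_def)
      then have "ennreal (f x) \<le> ennreal (f x) * indicator (?A k) x" by simp
      also have "\<dots> \<le> (SUP k. ennreal (f x) * indicator (?A k) x)" by (rule SUP_upper) simp
      finally have "ennreal (f x) \<le> (SUP k. ennreal (f x) * indicator (?A k) x)" .
      moreover have "(SUP k. ennreal (f x) * indicator (?A k) x) \<le> ennreal (f x)"
        by (rule SUP_least) (auto simp: indicator_def)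
      ultimately show ?case by (rule antisym[rotated])
    qed
  qed
  also have "(\<lambda>k. \<integral>\<^sup>+ x. ennreal (f x) * indicator (?A k) x \<partial>lborel) = (\<lambda>k. ennreal (?I k))"
    by (intro ext polar_integral f nn) simp
  finally have "(\<lambda>k. ennreal (?I k)) \<longlonglongrightarrow> ennreal E" unfolding fin .
  then show ?thesis using fin(2) I0 by (simp add: tendsto_ennreal_iff)
qed

locale solution =
  fixes n :: nat and lam :: "nat \<Rightarrow> real" and u :: "nat \<Rightarrow> real ^ 2 \<Rightarrow> complex" and \<alpha> :: "nat \<Rightarrow> real"
  assumes lam: "\<And>i. i \<in> {1..n} \<Longrightarrow> lam i > 0"
    and sol: "is_solution n lam u"
    and fin: "energy n u < \<infinity>"
    and al0: "\<And>j. j \<in> {1..n} \<Longrightarrow> \<alpha> j \<ge> 0"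
    and fin_i: "\<And>j. j \<in> {1..n} \<Longrightarrow> I_func (\<alpha> j) (u j) < \<infinity>"
begin

definition "V = (\<lambda>x. real n - (\<Sum>j=1..n. (cmod (u j x))^2))"
definition "v i = (\<lambda>x. (\<alpha> i)^2 - (cmod (u i x))^2)"
definition "p i c = (\<lambda>t h. Re (u i (polar c t h)))"
definition "q i c = (\<lambda>t h. Im (u i (polar c t h)))"
definition "W c = (\<lambda>t h. V (polar c t h))"

lemma C_diff_u: "i \<in> {1..n} \<Longrightarrow> C_diff k (u i)"
  using sol by (auto simp: is_solution_def smooth_def)

lemma u_cont: "i \<in> {1..n} \<Longrightarrow> continuous_on UNIV (u i)"
  using C_diff_continuous[OF C_diff_u] .

lemma V_cont: "continuous_on UNIV V" unfolding V_def
  by (intro continuous_intros u_cont)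

lemma v_cont: "i \<in> {1..n} \<Longrightarrow> continuous_on UNIV (v i)" unfolding v_def
  by (intro continuous_intros u_cont)

lemma component: assumes i: "i \<in> {1..n}" shows "component (p i c) (q i c) (W c) (lam i)"
proof
  show "lam i > 0" by (rule lam[OF i])
  have C: "C_diff k (\<lambda>x. Re (u i x))" "C_diff k (\<lambda>x. Im (u i x))" for k
    using C_diff_bounded_linear[OF bounded_linear_Re C_diff_u[OF i]] C_diff_bounded_linear[OF bounded_linear_Im C_diff_u[OF i]] .
  show "cyl 2 UNIV (p i c)" "cyl 2 UNIV (q i c)" unfolding p_def q_def using C_diff_cyl[OF C(1)] C_diff_cyl[OF C(2)] .
  show "cyl_cont UNIV (W c)" unfolding W_def by (rule polar_cyl_cont[OF V_cont])
  have eq: "- (complex_of_real (lam i) * laplacian (u i) x) = u i x * complex_of_real (V x)" for x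
    using sol i by (simp add: is_solution_def V_def)
  have lr: "lam i * laplacian (\<lambda>x. Re (u i x)) x = - (Re (u i x) * V x)" for x
    using arg_cong[OF eq[of x], of Re] laplacian_bounded_linear[OF bounded_linear_Re C_diff_u[OF i], of x] by simp
  have li: "lam i * laplacian (\<lambda>x. Im (u i x)) x = - (Im (u i x) * V x)" for x
    using arg_cong[OF eq[of x], of Im] laplacian_bounded_linear[OF bounded_linear_Im C_diff_u[OF i], of x] by simp
  show "dt (dt (p i c)) t h + dh (dh (p i c)) t h = - (exp (2 * t) * p i c t h * W c t h / lam i)" for t h
    using arg_cong[OF lr[of "polar c t h"], of "\<lambda>z. exp (2 * t) * z"] lam[OF i] unfolding p_def W_def laplacian_polar[OF C(1)] by (simp add: field_simps)
  show "dt (dt (q i c)) t h + dh (dh (q i c)) t h = - (exp (2 * t) * q i c t h * W c t h / lam i)" for t h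
    using arg_cong[OF li[of "polar c t h"], of "\<lambda>z. exp (2 * t) * z"] lam[OF i] unfolding q_def W_def laplacian_polar[OF C(2)] by (simp add: field_simps)
  obtain C1 where C1: "\<forall>t\<le>0. \<forall>h. \<bar>p i c t h\<bar> \<le> C1 \<and> \<bar>dt (p i c) t h\<bar> \<le> C1 * exp t \<and> \<bar>dh (p i c) t h\<bar> \<le> C1 * exp t"
    using polar_bounds[OF C(1)] unfolding p_def by blast
  obtain C2 where C2: "\<forall>t\<le>0. \<forall>h. \<bar>q i c t h\<bar> \<le> C2 \<and> \<bar>dt (q i c) t h\<bar> \<le> C2 * exp t \<and> \<bar>dh (q i c) t h\<bar> \<le> C2 * exp t"
    using polar_bounds[OF C(2)] unfolding q_def by blast
  have m: "C1 * exp t \<le> max C1 C2 * exp t" "C2 * exp t \<le> max C1 C2 * exp t" for t by auto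
  show "\<exists>C. \<forall>t\<le>0. \<forall>h. \<bar>p i c t h\<bar> \<le> C \<and> \<bar>q i c t h\<bar> \<le> C \<and>
        \<bar>dt (p i c) t h\<bar> \<le> C * exp t \<and> \<bar>dt (q i c) t h\<bar> \<le> C * exp t \<and>
        \<bar>dh (p i c) t h\<bar> \<le> C * exp t \<and> \<bar>dh (q i c) t h\<bar> \<le> C * exp t"
  proof (intro exI[of _ "max C1 C2"] allI impI)
    fix t h :: real assume t: "t \<le> 0"
    show "\<bar>p i c t h\<bar> \<le> max C1 C2 \<and> \<bar>q i c t h\<bar> \<le> max C1 C2 \<and>
        \<bar>dt (p i c) t h\<bar> \<le> max C1 C2 * exp t \<and> \<bar>dt (q i c) t h\<bar> \<le> max C1 C2 * exp t \<and>
        \<bar>dh (p i c) t h\<bar> \<le> max C1 C2 * exp t \<and> \<bar>dh (q i c) t h\<bar> \<le> max C1 C2 * exp t"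
      using C1[rule_format, OF t, of h] C2[rule_format, OF t, of h] m[of t] by linarith
  qed
qed

lemma dens_w: assumes "i \<in> {1..n}"
  shows "(\<lambda>t. exp (2 * t) * circ (\<lambda>t h. (component.w (p i c) (q i c) (\<alpha> i) t h)^2) t)
    = (\<lambda>t. exp (2 * t) * circ (\<lambda>t h. (v i (polar c t h))^2) t)"
  unfolding component.w_def[OF component[OF assms]] component.modsq_def[OF component[OF assms]]
  unfolding v_def p_def q_def cmod_power2 ..

lemma v2: "i \<in> {1..n} \<Longrightarrow> continuous_on UNIV (\<lambda>x. (v i x)^2)" and V2: "continuous_on UNIV (\<lambda>x. (V x)^2)"
  by (intro continuous_intros v_cont V_cont; assumption)+

lemma fin_v: "i \<in> {1..n} \<Longrightarrow> (\<integral>\<^sup>+ x. ennreal ((v i x)^2) \<partial>lborel) < \<infinity>"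
  using fin_i[of i] by (simp add: I_func_def v_def)

lemma energy_V: "energy n u = (\<integral>\<^sup>+ x. ennreal ((V x)^2) \<partial>lborel)"
  by (simp add: energy_def V_def)

lemma global_bound:
  assumes "continuous_on UNIV f" "\<And>x. f x \<ge> 0" "(\<integral>\<^sup>+ x. ennreal (f x) \<partial>lborel) < \<infinity>" "S \<le> T"
  shows "integral {S..T} (\<lambda>t. exp (2 * t) * circ (\<lambda>t h. f (polar c t h)) t) \<le> enn2real (\<integral>\<^sup>+ x. ennreal (f x) \<partial>lborel)"
  by (rule polar_integral_le[where B=UNIV]) (use assms in auto)

text \<open>The estimate of \<open>local_modulus\<close> applied in unit discs around far points, with constants that
  do not depend on the centre.\<close>

lemma modulus_limit:
  assumes i: "i \<in> {1..n}" and e: "e > 0"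
  shows "\<exists>R. \<forall>x. norm x > R \<longrightarrow> \<bar>v i x\<bar> \<le> e"
proof -
  define Cd where "Cd = \<bar>decay_const (lam i) (\<alpha> i)\<bar> + 1"
  have Cd: "Cd > 0" by (simp add: Cd_def)
  define \<delta> where "\<delta> = min 1 (e / Cd)"
  have \<delta>: "0 < \<delta>" "\<delta> \<le> 1" using e Cd by (auto simp: \<delta>_def)
  obtain R1 where R1: "\<And>c. norm c > R1 \<Longrightarrow> (\<integral>\<^sup>+ x. ennreal ((v i x)^2) * indicator (cball c 1) x \<partial>lborel) \<le> ennreal (\<delta>^2)"
    using tail_small[OF v2[OF i] fin_v[OF i], of "\<delta>^2"] \<delta> by auto
  obtain R2 where R2: "\<And>c. norm c > R2 \<Longrightarrow> (\<integral>\<^sup>+ x. ennreal ((V x)^2) * indicator (cball c 1) x \<partial>lborel) \<le> ennreal (\<delta>^2)"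
    using tail_small[OF V2 fin[unfolded energy_V], of "\<delta>^2"] \<delta> by auto
  have "\<bar>v i c\<bar> \<le> e" if c: "norm c > max R1 R2" for c
  proof -
    interpret component "p i c" "q i c" "W c" "lam i" "\<alpha> i" by (rule component[OF i])
    have sub: "annulus c S T \<subseteq> cball c 1" if "T \<le> 0" for S T
    proof -
      have "exp T \<le> 1" using that by simp
      then have "norm (c - x) \<le> 1" if "x \<in> annulus c S T" for x
        using that unfolding annulus_def norm_minus_commute[of c] by (auto intro: order_trans)
      then show ?thesis by (auto simp: dist_norm)
    qed
    have "\<bar>(Re (u i c))^2 + (Im (u i c))^2 - (\<alpha> i)^2\<bar> \<le> decay_const (lam i) (\<alpha> i) * \<delta>"
    proof (rule local_modulus[OF _ _ \<delta>])
      show "(circ (p i c) \<longlongrightarrow> 2 * pi * Re (u i c)) at_bot" "(circ (q i c) \<longlongrightarrow> 2 * pi * Im (u i c)) at_bot"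
        unfolding p_def q_def by (intro circ_polar_limit continuous_intros u_cont i)+
      fix S T :: real assume "S \<le> T" "T \<le> 0"
      then show "integral {S..T} (dens w) \<le> \<delta>^2" unfolding dens_w[OF i]
        using R1[of c] c by (intro polar_integral_le[where B="cball c 1"] v2 i sub) auto
      show "integral {S..T} (dens (W c)) \<le> \<delta>^2" unfolding W_def
        using R2[of c] c \<open>S \<le> T\<close> \<open>T \<le> 0\<close> by (intro polar_integral_le[where B="cball c 1"] V2 sub) auto
    qed
    moreover have "v i c = - ((Re (u i c))^2 + (Im (u i c))^2 - (\<alpha> i)^2)" unfolding v_def cmod_power2 by simp
    ultimately have "\<bar>v i c\<bar> \<le> decay_const (lam i) (\<alpha> i) * \<delta>" by simp
    also have "\<dots> \<le> Cd * (e / Cd)" using \<delta> Cd by (intro mult_mono) (auto simp: Cd_def \<delta>_def)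
    also have "\<dots> = e" using Cd by simp
    finally show ?thesis .
  qed
  then show ?thesis by blast
qed

abbreviation "stress_of i \<equiv> component.stress (p i 0) (q i 0)"

text \<open>For \<open>\<alpha> i = 0\<close> the stress is bounded by the Dirichlet density, which is then integrable. For
  \<open>\<alpha> i > 0\<close> the decay of \<open>\<alpha>^2 - |u|^2\<close> puts the exterior of a disc into the setting of
  \<open>far_field\<close>.\<close>

lemma stress_quantized:
  assumes i: "i \<in> {1..n}"
  shows "\<exists>d::int. \<exists>T. integrable_tail T (\<lambda>t. stress_of i t + 2 * pi * (\<alpha> i)^2 * (real_of_int d)^2)"
proof -
  interpret component "p i 0" "q i 0" "W 0" "lam i" "\<alpha> i" by (rule component[OF i])
  define Ew where "Ew = enn2real (\<integral>\<^sup>+ x. ennreal ((v i x)^2) \<partial>lborel)"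
  define EW where "EW = enn2real (\<integral>\<^sup>+ x. ennreal ((V x)^2) \<partial>lborel)"
  have Ew: "integral {S..T} (dens w) \<le> Ew" if "S \<le> T" for S T
    unfolding dens_w[OF i] Ew_def by (rule global_bound) (use v2 fin_v i that in auto)
  have EW: "integral {S..T} (dens (W 0)) \<le> EW" if "S \<le> T" for S T
    unfolding W_def EW_def by (rule global_bound) (use V2 fin energy_V that in auto)
  show ?thesis
  proof (cases "\<alpha> i = 0")
    case True
    have "integrable_tail 0 (circ grad2)" by (rule gradient_growth(2)[OF Ew EW True])
    then have "integrable_tail 0 stress"
    proof (rule integrable_tail_mono)
      show "continuous_on {0..} stress" unfolding stress_def by (intro circ_cont cyl_intros)
      show "\<bar>stress t\<bar> \<le> \<bar>circ grad2 t\<bar>" for t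
      proof -
        have "\<bar>stress t\<bar> \<le> circ grad2 t" unfolding stress_def
        proof (rule circ_abs_le[of UNIV])
          show "\<bar>(dt (p i 0) t h)^2 + (dt (q i 0) t h)^2 - (dh (p i 0) t h)^2 - (dh (q i 0) t h)^2\<bar> \<le> grad2 t h" for h
            unfolding grad2_def by (auto simp: abs_le_iff)
        qed (auto intro!: cyl_intros)
        then show ?thesis by linarith
      qed
    qed
    then have "integrable_tail 0 (\<lambda>t. stress t + 2 * pi * (\<alpha> i)^2 * (real_of_int 0)^2)" by (simp add: True)
    then show ?thesis by blast
  next
    case False
    then have al: "\<alpha> i > 0" using al0[OF i] by simp
    obtain R where R: "\<And>x. norm x > R \<Longrightarrow> \<bar>v i x\<bar> \<le> (\<alpha> i)^2 / 20"
      using modulus_limit[OF i, of "(\<alpha> i)^2 / 20"] al by auto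
    \<comment> \<open>From \<open>t > R\<close> on, the radius \<open>exp t\<close> exceeds \<open>R\<close>.\<close>
    define T1 where "T1 = max 1 (R + 1)"
    interpret far_field "p i 0" "q i 0" "W 0" "lam i" "\<alpha> i" T1 Ew EW
    proof
      show "1 \<le> T1" by (simp add: T1_def)
      show "0 < \<alpha> i" by (rule al)
      show "\<bar>w t h\<bar> \<le> (\<alpha> i)^2 / 20" if "T1 - 1 < t" for t h
      proof -
        have "R < t" using that by (simp add: T1_def)
        also have "t < 1 + t" by simp
        also have "\<dots> \<le> exp t" by (rule exp_ge_add_one_self)
        finally have "\<bar>v i (polar 0 t h)\<bar> \<le> (\<alpha> i)^2 / 20" using polar_dist[of 0 t h] by (intro R) simp
        then show ?thesis unfolding w_def modsq_def unfolding p_def q_def v_def cmod_power2 .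
      qed
    qed (use Ew EW in auto)
    show ?thesis using stress_limit by blast
  qed
qed

definition "Q = (\<lambda>t. 1 / 2 * (exp (2 * t) * circ (\<lambda>t h. (W 0 t h)^2) t) - (\<Sum>i=1..n. lam i * stress_of i t))"

abbreviation "densW \<equiv> (\<lambda>t. exp (2 * t) * circ (\<lambda>t h. (W 0 t h)^2) t)"

text \<open>The derivatives of the stresses, weighted by \<open>lam\<close>, add up to \<open>exp (2 t)\<close> times the integral of \<open>W d_t W\<close>, half
  the derivative of \<open>W^2\<close>; only the derivative of the weight \<open>exp (2 t)\<close> survives.\<close>

lemma pohozaev: "(Q has_real_derivative densW t) (at t)"
proof -
  let ?P = "\<lambda>i t h. p i 0 t h * dt (p i 0) t h + q i 0 t h * dt (q i 0) t h"
  have cP: "cyl_cont UNIV (?P i)" if "i \<in> {1..n}" for i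
    using component.conts[OF component[OF that, of 0]] by (intro cyl_intros)
  have cW: "cyl_cont UNIV (W 0)" unfolding W_def by (rule polar_cyl_cont[OF V_cont])
  have Weq: "W 0 t h = real n - (\<Sum>j=1..n. (p j 0 t h)^2 + (q j 0 t h)^2)" for t h
    unfolding W_def V_def p_def q_def cmod_power2 ..
  have dW: "((\<lambda>s. W 0 s h) has_real_derivative - (\<Sum>j=1..n. 2 * ?P j t h)) (at t)" for t h
  proof -
    have "((\<lambda>s. (p j 0 s h)^2 + (q j 0 s h)^2) has_real_derivative 2 * ?P j t h) (at t)" if "j \<in> {1..n}" for j
      using component.derivs(1,2)[OF component[OF that, of 0]]
      by (auto intro!: derivative_eq_intros simp: algebra_simps)
    then have "((\<lambda>s. real n - (\<Sum>j=1..n. (p j 0 s h)^2 + (q j 0 s h)^2)) has_real_derivative 0 - (\<Sum>j=1..n. 2 * ?P j t h)) (at t)"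
      by (intro DERIV_diff DERIV_sum DERIV_const) auto
    then show ?thesis unfolding Weq by simp
  qed
  let ?D = "\<lambda>t h. 2 * W 0 t h * - (\<Sum>j=1..n. 2 * ?P j t h)"
  have cD: "cyl_cont UNIV ?D" by (intro cyl_intros cW cP)
  have "(circ (\<lambda>t h. (W 0 t h)^2) has_real_derivative circ ?D t) (at t)"
    by (rule circ_has_derivative[OF open_UNIV])
      (use cW cD dW in \<open>auto intro!: cyl_intros derivative_eq_intros simp: power2_eq_square\<close>)
  moreover have "circ ?D t = - 4 * (\<Sum>i=1..n. circ (\<lambda>t h. W 0 t h * ?P i t h) t)"
  proof -
    have "circ ?D t = circ (\<lambda>t h. (- 4) * (\<Sum>i=1..n. W 0 t h * ?P i t h)) t"
      by (rule circ_cong) (simp add: sum_distrib_left sum_negf[symmetric] algebra_simps)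
    also have "\<dots> = - 4 * circ (\<lambda>t h. \<Sum>i=1..n. W 0 t h * ?P i t h) t" by (rule circ_cmult)
    also have "circ (\<lambda>t h. \<Sum>i=1..n. W 0 t h * ?P i t h) t = (\<Sum>i=1..n. circ (\<lambda>t h. W 0 t h * ?P i t h) t)"
      by (rule circ_sum[of _ UNIV]) (auto intro!: cyl_cont_mult cW cP)
    finally show ?thesis .
  qed
  ultimately have d1: "(circ (\<lambda>t h. (W 0 t h)^2) has_real_derivative - 4 * (\<Sum>i=1..n. circ (\<lambda>t h. W 0 t h * ?P i t h) t)) (at t)"
    by simp
  have d2: "((\<lambda>t. \<Sum>i=1..n. lam i * stress_of i t) has_real_derivative
     (\<Sum>i=1..n. lam i * - (2 / lam i * exp (2 * t) * circ (\<lambda>t h. W 0 t h * ?P i t h) t))) (at t)"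
    by (intro DERIV_sum DERIV_cmult component.stress_deriv[OF component])
  have s: "(\<Sum>i=1..n. lam i * - (2 / lam i * exp (2 * t) * circ (\<lambda>t h. W 0 t h * ?P i t h) t))
     = - 2 * exp (2 * t) * (\<Sum>i=1..n. circ (\<lambda>t h. W 0 t h * ?P i t h) t)"
    unfolding sum_distrib_left using lam by (intro sum.cong) (force simp: field_simps)+
  have "(Q has_real_derivative 1 / 2 * (exp (2 * t) * 2 * circ (\<lambda>t h. (W 0 t h)^2) t
      + (- 4 * (\<Sum>i=1..n. circ (\<lambda>t h. W 0 t h * ?P i t h) t)) * exp (2 * t))
      - (- 2 * exp (2 * t) * (\<Sum>i=1..n. circ (\<lambda>t h. W 0 t h * ?P i t h) t))) (at t)"
    unfolding Q_def
  proof (rule DERIV_diff[OF DERIV_cmult[OF DERIV_mult[OF _ d1]] d2[unfolded s]])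
    show "((\<lambda>t. exp (2 * t)) has_real_derivative exp (2 * t) * 2) (at t)" by (auto intro!: derivative_eq_intros)
  qed
  then show ?thesis by (simp add: algebra_simps)
qed

lemma Q_at_bot: "(Q \<longlongrightarrow> 0) at_bot"
proof -
  have "(circ (\<lambda>t h. (W 0 t h)^2) \<longlongrightarrow> 2 * pi * (V 0)^2) at_bot"
    unfolding W_def using circ_polar_limit[OF V2] .
  moreover have "((\<lambda>t::real. exp (2 * t)) \<longlongrightarrow> 0) at_bot"
    using filterlim_tendsto_pos_mult_at_bot[OF tendsto_const[of "2::real"] _ filterlim_ident] by (intro filterlim_compose[OF exp_at_bot]) simp
  ultimately have "(densW \<longlongrightarrow> 0 * (2 * pi * (V 0)^2)) at_bot" by (intro tendsto_mult)
  moreover have "((\<lambda>t. \<Sum>i=1..n. lam i * stress_of i t) \<longlongrightarrow> (\<Sum>i=1..n. lam i * 0)) at_bot"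
    by (intro tendsto_sum tendsto_mult tendsto_const component.stress_small_at_bot[OF component])
  ultimately have "(Q \<longlongrightarrow> 1 / 2 * (0 * (2 * pi * (V 0)^2)) - (\<Sum>i=1..n. lam i * 0)) at_bot"
    unfolding Q_def by (rule tendsto_diff[OF tendsto_mult[OF tendsto_const]])
  then show ?thesis by simp
qed

text \<open>By the identity the increments of \<open>Q\<close> are energies of annuli. As \<open>Q\<close> is monotone, convergence
  along the integers suffices.\<close>

lemma Q_at_top: "(Q \<longlongrightarrow> enn2real (energy n u)) at_top"
proof -
  define E where "E = enn2real (energy n u)"
  have mono: "Q s \<le> Q t" if "s \<le> t" for s t
  proof (rule DERIV_nonneg_imp_nondecreasing[OF that])
    fix x
    have cW: "cyl_cont UNIV (W 0)" unfolding W_def by (rule polar_cyl_cont[OF V_cont])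
    have "densW x \<ge> 0" by (intro mult_nonneg_nonneg circ_nonneg[of UNIV] cyl_intros cW) auto
    with pohozaev[of x] show "\<exists>y. (Q has_real_derivative y) (at x) \<and> 0 \<le> y" by blast
  qed
  have "(\<lambda>k. integral {- real k..real k} densW) \<longlonglongrightarrow> E"
    unfolding W_def by (rule polar_integral_tendsto[OF V2]) (use fin in \<open>auto simp: energy_V E_def\<close>)
  moreover have "integral {- real k..real k} densW = Q (real k) - Q (- real k)" for k
    by (rule integral_unique, rule ftc_real) (auto intro: pohozaev)
  ultimately have "(\<lambda>k. Q (real k) - Q (- real k)) \<longlonglongrightarrow> E" by simp
  moreover have "(\<lambda>k. Q (- real k)) \<longlonglongrightarrow> 0"
    by (rule filterlim_compose[OF Q_at_bot])
      (simp add: filterlim_uminus_at_bot filterlim_real_sequentially)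
  ultimately have "(\<lambda>k. (Q (real k) - Q (- real k)) + Q (- real k)) \<longlonglongrightarrow> E + 0" by (rule tendsto_add)
  then have lim: "(\<lambda>k. Q (real k)) \<longlonglongrightarrow> E" by simp
  have up: "Q t \<le> E" for t
  proof -
    obtain k :: nat where k: "t \<le> real k" using real_arch_simple by blast
    have "\<forall>\<^sub>F j in sequentially. Q t \<le> Q (real j)"
      unfolding eventually_sequentially using k by (intro exI[of _ k] allI impI mono) simp
    from tendsto_lowerbound[OF lim this] show ?thesis by simp
  qed
  have "(Q \<longlongrightarrow> E) at_top"
  proof (rule tendstoI)
    fix e :: real assume e: "e > 0"
    then have "\<forall>\<^sub>F k in sequentially. dist (Q (real k)) E < e" using lim by (rule tendstoD[rotated])
    then obtain k where k: "dist (Q (real k)) E < e" by (auto simp: eventually_sequentially)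
    have "dist (Q t) E < e" if "t \<ge> real k" for t
      using k mono[OF that] up[of t] by (simp add: dist_real_def)
    then show "\<forall>\<^sub>F t in at_top. dist (Q t) E < e" unfolding eventually_at_top_linorder by blast
  qed
  then show ?thesis unfolding E_def .
qed

text \<open>Up to an integrable error \<open>Q\<close> is the constant on the right-hand side, and its limit is the
  energy.\<close>

lemma energy_quantized: "\<exists>d :: nat \<Rightarrow> nat. energy n u = ennreal (2 * pi * (\<Sum>j=1..n. lam j * (\<alpha> j)^2 * (real (d j))^2))"
proof -
  have "\<forall>i\<in>{1..n}. \<exists>d::int. \<exists>T. integrable_tail T (\<lambda>t. stress_of i t + 2 * pi * (\<alpha> i)^2 * (real_of_int d)^2)"
    using stress_quantized by blast
  then obtain d :: "nat \<Rightarrow> int" where d: "\<forall>i\<in>{1..n}. \<exists>T. integrable_tail T (\<lambda>t. stress_of i t + 2 * pi * (\<alpha> i)^2 * (real_of_int (d i))^2)"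
    by metis
  then obtain T where T: "\<And>i. i \<in> {1..n} \<Longrightarrow> integrable_tail (T i) (\<lambda>t. stress_of i t + 2 * pi * (\<alpha> i)^2 * (real_of_int (d i))^2)"
    by metis
  define T0 where "T0 = Max (insert 0 (T ` {1..n}))"
  have T0: "T i \<le> T0" if "i \<in> {1..n}" for i unfolding T0_def using that by (intro Max_ge) auto
  define L where "L = 2 * pi * (\<Sum>j=1..n. lam j * (\<alpha> j)^2 * (real_of_int (d j))^2)"
  have cW: "cyl_cont UNIV (W 0)" unfolding W_def by (rule polar_cyl_cont[OF V_cont])
  have bW: "integrable_tail T0 densW"
  proof (rule integrable_tailI)
    show "continuous_on {T0..} densW"
      by (intro continuous_intros continuous_on_subset[OF circ_continuous[of UNIV]] cyl_intros cW) auto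
    have "integral {T0..T} (\<lambda>t. \<bar>densW t\<bar>) = integral {T0..T} densW" for T
      by (intro integral_cong abs_of_nonneg mult_nonneg_nonneg circ_nonneg[of UNIV] cyl_intros cW) auto
    moreover have "integral {T0..T} densW \<le> enn2real (energy n u)" if "T \<ge> T0" for T
      unfolding W_def energy_V by (rule global_bound) (use V2 fin energy_V that in auto)
    ultimately show "T \<ge> T0 \<Longrightarrow> integral {T0..T} (\<lambda>t. \<bar>densW t\<bar>) \<le> enn2real (energy n u)" for T by simp
  qed
  have "integrable_tail T0 (\<lambda>t. 1 / 2 * densW t + (\<Sum>i=1..n. - lam i * (stress_of i t + 2 * pi * (\<alpha> i)^2 * (real_of_int (d i))^2)))"
    by (intro integrable_tail_add integrable_tail_sum integrable_tail_cmult bW integrable_tail_later[OF T T0])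
  moreover have "1 / 2 * densW t + (\<Sum>i=1..n. - lam i * (stress_of i t + 2 * pi * (\<alpha> i)^2 * (real_of_int (d i))^2)) = Q t - L" for t
  proof -
    have "(\<Sum>i=1..n. - lam i * (stress_of i t + 2 * pi * (\<alpha> i)^2 * (real_of_int (d i))^2)) = - (\<Sum>i=1..n. lam i * stress_of i t) - L"
      unfolding L_def sum_distrib_left sum_negf[symmetric] sum_subtractf[symmetric]
      by (intro sum.cong) (auto simp: algebra_simps)
    then show ?thesis by (simp add: Q_def)
  qed
  ultimately have "integrable_tail T0 (\<lambda>t. Q t - L)" by simp
  moreover have "((\<lambda>t. Q t - L) \<longlongrightarrow> enn2real (energy n u) - L) at_top" by (intro tendsto_intros Q_at_top)
  ultimately have "enn2real (energy n u) - L = 0" by (rule integrable_tail_limit_zero)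
  then have "enn2real (energy n u) = L" by simp
  moreover have "energy n u = ennreal (enn2real (energy n u))" using fin by simp
  moreover have "L = 2 * pi * (\<Sum>j=1..n. lam j * (\<alpha> j)^2 * (real (nat \<bar>d j\<bar>))^2)" unfolding L_def by simp
  ultimately show ?thesis by (intro exI[of _ "\<lambda>j. nat \<bar>d j\<bar>"]) simp
qed

end

theorem theorem1p3:
  fixes n :: nat
    and lam :: "nat \<Rightarrow> real"
    and u :: "nat \<Rightarrow> real ^ 2 \<Rightarrow> complex"
    and \<alpha> :: "nat \<Rightarrow> real"
  assumes "n \<ge> 1"
    and "\<And>i. i \<in> {1..n} \<Longrightarrow> lam i > 0"
    and "is_solution n lam u"
    and "energy n u < \<infinity>"
    and "\<And>j. j \<in> {1..n} \<Longrightarrow> \<alpha> j \<ge> 0"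
    and "(\<Sum>j=1..n. (\<alpha> j)\<^sup>2) = real n"
    and "\<And>j. j \<in> {1..n} \<Longrightarrow> I_func (\<alpha> j) (u j) < \<infinity>"
  shows "\<exists>d :: nat \<Rightarrow> nat.
    energy n u = ennreal (2 * pi * (\<Sum>j=1..n. lam j * (\<alpha> j)\<^sup>2 * (real (d j))\<^sup>2))"
proof -
  interpret solution n lam u \<alpha>
    by unfold_locales (use assms in auto)
  show ?thesis by (rule energy_quantized)
qed

end
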